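(* Let $D\subset\mathbb{C}^n$ be a bounded homogeneous domain with $0\in D$, and let $\varphi$ be a holomorphic self-map of $D$. For $\psi\in H(D)$ let $W_{\psi,\varphi}f=\psi\,(f\circ\varphi)$. (a) Let $\psi\in\mathcal{B}(D)$. Then $W_{\psi,\varphi}:H^\infty(D)\to\mathcal{B}(D)$ is compact if $$\lim_{\varphi(z)\to\partial D}Q_\psi(z)=0\quad\text{and}\quad\lim_{\varphi(z)\to\partial D}|\psi(z)|\,\theta_\varphi(z)=0.$$ (b) Let $\psi\in\mathcal{B}_{0*}(D)$. Then $W_{\psi,\varphi}:H^\infty(D)\to\mathcal{B}_{0*}(D)$ is compact if $$\lim_{z\to\partial D}Q_\psi(z)=0\quad\text{and}\quad\lim_{z\to\partial D}|\psi(z)|\,\theta_\varphi(z)=0.$$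
   Context: A domain $D\subset\mathbb{C}^n$ is homogeneous if the group $\mathrm{Aut}(D)$ of biholomorphic self-maps of $D$ acts transitively on $D$. $H(D)$ is the set of holomorphic functions $D\to\mathbb{C}$, and $H^\infty(D)$ is the space of bounded ones with norm $\|f\|_\infty=\sup_D|f|$. Bergman metric: $H_z(u,\overline{v})=\frac12\sum_{j,k}\frac{\partial^2\log K(z,z)}{\partial z_j\partial\overline{z_k}}u_j\overline{v_k}$, where $K$ is the Bergman kernel of $D$. For $f\in H(D)$ and $z\in D$, let $Q_f(z)=\sup_{u\in\mathbb{C}^n\setminus\{0\}}\frac{|\nabla(f)(z)u|}{H_z(u,\overline{u})^{1/2}}$, where $\nabla(f)(z)u=\sum_{k=1}^n\frac{\partial f}{\partial z_k}(z)u_k$, and $\beta_f=\sup_{z\in D}Q_f(z)$. The Bloch space is $\mathcal{B}(D)=\{f\in H(D):\beta_f<\infty\}$ with norm $\|f\|_{\mathcal{B}}=|f(0)|+\beta_f$. $\partial D$ is the topological boundary and $\partial^*D$ the distinguished (Shilov) boundary of $D$; $z\to\partial^*D$ means that the Euclidean distance from $z\in D$ to $\partial^*D$ tends to $0$, and similarly for $\partial D$. The $*$-little Bloch space is $\mathcal{B}_{0*}(D)=\{f\in\mathcal{B}(D):\lim_{z\to\partial^*D}Q_f(z)=0\}$, with the norm of $\mathcal{B}(D)$. $\theta_\varphi(z)=\sup\{Q_{f\circ\varphi}(z):f\in H^\infty(D),\ \|f\|_\infty\le1\}$. $\lim_{\varphi(z)\to\partial D}F(z)=0$ means: for each $\varepsilon>0$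 there is a compact $K\subset D$ such that $|F(z)|<\varepsilon$ for all $z\in D$ with $\varphi(z)\notin K$ (vacuously true if $\varphi(D)$ is relatively compact in $D$).
   Formalization: In (a) it is additionally assumed that W maps H^∞(D) into B(D); without this (a) fails, e.g. on the unit disc with ψ(z) = −log(1−z), φ(z) = exp(−(1+z)/(1−z))/2, where both limits hold vacuously but ψφ is not Bloch. *)

theory Defs
  imports "HOL-Analysis.Analysis"
begin

text \<open>
  Function spaces on a domain \<open>D\<close> are sets of total functions \<open>complex ^ 'n \<Rightarrow> complex\<close>. All notions
  below depend only on the values on \<open>D\<close> (which is always open here); the values off \<open>D\<close> are
  arbitrary, so functions agreeing on \<open>D\<close> have distance \<open>0\<close>.
\<close>

subsection \<open>Holomorphic functions of several variables\<close>

definition holo :: "(complex ^ 'n) set \<Rightarrow> (complex ^ 'n \<Rightarrow> complex) set" where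
  "holo D = {f. \<forall>z\<in>D. \<exists>f'. (f has_derivative f') (at z) \<and> (\<forall>c v. f' (c *s v) = c * f' v)}"

definition holo_map :: "(complex ^ 'n) set \<Rightarrow> (complex ^ 'n \<Rightarrow> complex ^ 'm) set" where
  "holo_map D = {F. \<forall>k. (\<lambda>z. F z $ k) \<in> holo D}"

definition holo_self_map :: "(complex ^ 'n) set \<Rightarrow> (complex ^ 'n \<Rightarrow> complex ^ 'n) set" where
  "holo_self_map D = {F \<in> holo_map D. F ` D \<subseteq> D}"

definition Aut :: "(complex ^ 'n) set \<Rightarrow> (complex ^ 'n \<Rightarrow> complex ^ 'n) set" where
  "Aut D = {F \<in> holo_self_map D. \<exists>G \<in> holo_self_map D. \<forall>z\<in>D. G (F z) = z \<and> F (G z) = z}"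

definition bounded_homogeneous_domain :: "(complex ^ 'n) set \<Rightarrow> bool" where
  "bounded_homogeneous_domain D \<longleftrightarrow>
     D \<noteq> {} \<and> open D \<and> connected D \<and> bounded D \<and> (\<forall>z\<in>D. \<forall>w\<in>D. \<exists>F\<in>Aut D. F z = w)"

definition dir_deriv :: "(complex ^ 'n \<Rightarrow> complex) \<Rightarrow> complex ^ 'n \<Rightarrow> complex ^ 'n \<Rightarrow> complex" where
  "dir_deriv g v z = vector_derivative (\<lambda>t::real. g (z + t *\<^sub>R v)) (at 0)"

text \<open>The Wirtinger derivatives
  \<open>\<partial>/\<partial>z\<^sub>j = (\<partial>/\<partial>x\<^sub>j - \<i> \<partial>/\<partial>y\<^sub>j) / 2\<close> and its conjugate, where \<open>z\<^sub>j = x\<^sub>j + \<i> y\<^sub>j\<close>. On holomorphic functions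
  the former is the complex partial derivative.\<close>

definition dz :: "'n \<Rightarrow> (complex ^ 'n \<Rightarrow> complex) \<Rightarrow> complex ^ 'n \<Rightarrow> complex" where
  "dz j g z = (dir_deriv g (axis j 1) z - \<i> * dir_deriv g (axis j \<i>) z) / 2"

definition dzbar :: "'n \<Rightarrow> (complex ^ 'n \<Rightarrow> complex) \<Rightarrow> complex ^ 'n \<Rightarrow> complex" where
  "dzbar j g z = (dir_deriv g (axis j 1) z + \<i> * dir_deriv g (axis j \<i>) z) / 2"

definition grad_app :: "(complex ^ 'n \<Rightarrow> complex) \<Rightarrow> complex ^ 'n \<Rightarrow> complex ^ 'n \<Rightarrow> complex" where
  "grad_app f z u = (\<Sum>k\<in>UNIV. dz k f z * u $ k)"


subsection \<open>Bergman kernel and Bergman metric\<close>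

definition bergman_space :: "(complex ^ 'n) set \<Rightarrow> (complex ^ 'n \<Rightarrow> complex) set" where
  "bergman_space D = {f \<in> holo D. set_integrable lborel D (\<lambda>z. (cmod (f z))\<^sup>2)}"

text \<open>The reproducing kernel of the Bergman space; it is unique on \<open>D \<times> D\<close>, and the choice operator
  only fixes irrelevant values elsewhere.\<close>

definition bergman_kernel :: "(complex ^ 'n) set \<Rightarrow> complex ^ 'n \<Rightarrow> complex ^ 'n \<Rightarrow> complex" where
  "bergman_kernel D = (SOME K. \<forall>w\<in>D. (\<lambda>z. K z w) \<in> bergman_space D \<and>
     (\<forall>f\<in>bergman_space D. f w = (LINT z:D|lborel. f z * cnj (K z w))))"

text \<open>\<open>bergman_metric D z u v\<close> is \<open>H\<^sub>z(u, cnj v)\<close>. The number \<open>K(z,z)\<close> is real and positive.\<close>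

definition bergman_metric ::
    "(complex ^ 'n) set \<Rightarrow> complex ^ 'n \<Rightarrow> complex ^ 'n \<Rightarrow> complex ^ 'n \<Rightarrow> complex" where
  "bergman_metric D z u v =
     1 / 2 * (\<Sum>j\<in>UNIV. \<Sum>k\<in>UNIV.
       dz j (dzbar k (\<lambda>w. of_real (ln (Re (bergman_kernel D w w))))) z * u $ j * cnj (v $ k))"


subsection \<open>The spaces of bounded holomorphic functions and of Bloch functions\<close>

definition sup_norm :: "(complex ^ 'n) set \<Rightarrow> (complex ^ 'n \<Rightarrow> complex) \<Rightarrow> real" where
  "sup_norm D f = (SUP z\<in>D. cmod (f z))"

definition H_infty :: "(complex ^ 'n) set \<Rightarrow> (complex ^ 'n \<Rightarrow> complex) set" where
  "H_infty D = {f \<in> holo D. bounded (f ` D)}"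

text \<open>Suprema are taken in \<open>[0, \<infinity>]\<close>.\<close>

definition Q :: "(complex ^ 'n) set \<Rightarrow> (complex ^ 'n \<Rightarrow> complex) \<Rightarrow> complex ^ 'n \<Rightarrow> ennreal" where
  "Q D f z = (SUP u\<in>UNIV - {0}. ennreal (cmod (grad_app f z u) / sqrt (Re (bergman_metric D z u u))))"

definition bloch_seminorm :: "(complex ^ 'n) set \<Rightarrow> (complex ^ 'n \<Rightarrow> complex) \<Rightarrow> ennreal" where
  "bloch_seminorm D f = (SUP z\<in>D. Q D f z)"

definition bloch :: "(complex ^ 'n) set \<Rightarrow> (complex ^ 'n \<Rightarrow> complex) set" where
  "bloch D = {f \<in> holo D. bloch_seminorm D f < \<infinity>}"

definition bloch_norm :: "(complex ^ 'n) set \<Rightarrow> (complex ^ 'n \<Rightarrow> complex) \<Rightarrow> real" where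
  "bloch_norm D f = cmod (f 0) + enn2real (bloch_seminorm D f)"

text \<open>The Shilov boundary of the algebra of continuous functions on the closure of \<open>D\<close> that are
  holomorphic in \<open>D\<close>: the intersection of all closed sets on which each such function attains its
  maximum modulus; by Shilov's theorem it is itself such a set.\<close>

definition disc_algebra :: "(complex ^ 'n) set \<Rightarrow> (complex ^ 'n \<Rightarrow> complex) set" where
  "disc_algebra D = {f \<in> holo D. continuous_on (closure D) f}"

definition shilov_boundary :: "(complex ^ 'n) set \<Rightarrow> (complex ^ 'n) set" where
  "shilov_boundary D = \<Inter> {S. closed S \<and> S \<subseteq> closure D \<and>
     (\<forall>f\<in>disc_algebra D. \<exists>w\<in>S. \<forall>z\<in>closure D. cmod (f z) \<le> cmod (f w))}"

text \<open>\<open>F(z) \<rightarrow> 0\<close> as the Euclidean distance from \<open>z \<in> D\<close> to \<open>S\<close> tends to \<open>0\<close>.\<close>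

definition vanishes_towards ::
    "(complex ^ 'n) set \<Rightarrow> (complex ^ 'n) set \<Rightarrow> (complex ^ 'n \<Rightarrow> ennreal) \<Rightarrow> bool" where
  "vanishes_towards D S F \<longleftrightarrow>
     (\<forall>\<epsilon>::real. \<epsilon> > 0 \<longrightarrow> (\<exists>\<delta>>0. \<forall>z\<in>D. (\<exists>w\<in>S. dist z w < \<delta>) \<longrightarrow> F z < ennreal \<epsilon>))"

text \<open>\<open>F(z) \<rightarrow> 0\<close> as \<open>\<phi>(z) \<rightarrow> \<partial>D\<close>.\<close>

definition vanishes_along ::
    "(complex ^ 'n) set \<Rightarrow> (complex ^ 'n \<Rightarrow> complex ^ 'n) \<Rightarrow> (complex ^ 'n \<Rightarrow> ennreal) \<Rightarrow> bool" where
  "vanishes_along D \<phi> F \<longleftrightarrow>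
     (\<forall>\<epsilon>::real. \<epsilon> > 0 \<longrightarrow>
       (\<exists>C. compact C \<and> C \<subseteq> D \<and> (\<forall>z\<in>D. \<phi> z \<notin> C \<longrightarrow> F z < ennreal \<epsilon>)))"

definition star_little_bloch :: "(complex ^ 'n) set \<Rightarrow> (complex ^ 'n \<Rightarrow> complex) set" where
  "star_little_bloch D = {f \<in> bloch D. vanishes_towards D (shilov_boundary D) (Q D f)}"

definition theta :: "(complex ^ 'n) set \<Rightarrow> (complex ^ 'n \<Rightarrow> complex ^ 'n) \<Rightarrow> complex ^ 'n \<Rightarrow> ennreal" where
  "theta D \<phi> z = (SUP f\<in>{f \<in> H_infty D. sup_norm D f \<le> 1}. Q D (f \<circ> \<phi>) z)"


subsection \<open>Weighted composition operators and compactness\<close>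

definition weighted_comp ::
    "(complex ^ 'n \<Rightarrow> complex) \<Rightarrow> (complex ^ 'n \<Rightarrow> complex ^ 'n) \<Rightarrow>
     (complex ^ 'n \<Rightarrow> complex) \<Rightarrow> complex ^ 'n \<Rightarrow> complex" where
  "weighted_comp \<psi> \<phi> f = (\<lambda>z. \<psi> z * f (\<phi> z))"

text \<open>Compact linear operators from \<open>X\<close> with norm \<open>nX\<close> to \<open>Y\<close> with norm \<open>nY\<close>: bounded sets are mapped to
  relatively compact sets. Relative compactness is sequential because the norms are only seminorms
  on total functions.\<close>

definition relatively_compact_in ::
    "('a \<Rightarrow> complex) set \<Rightarrow> (('a \<Rightarrow> complex) \<Rightarrow> real) \<Rightarrow> ('a \<Rightarrow> complex) set \<Rightarrow> bool" where
  "relatively_compact_in Y nY A \<longleftrightarrow> A \<subseteq> Y \<and>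
     (\<forall>a::nat \<Rightarrow> 'a \<Rightarrow> complex. range a \<subseteq> A \<longrightarrow>
       (\<exists>g\<in>Y. \<exists>r::nat \<Rightarrow> nat. strict_mono r \<and> (\<lambda>i. nY (\<lambda>z. a (r i) z - g z)) \<longlonglongrightarrow> 0))"

definition compact_operator ::
    "('a \<Rightarrow> complex) set \<Rightarrow> (('a \<Rightarrow> complex) \<Rightarrow> real) \<Rightarrow> ('b \<Rightarrow> complex) set \<Rightarrow>
     (('b \<Rightarrow> complex) \<Rightarrow> real) \<Rightarrow> (('a \<Rightarrow> complex) \<Rightarrow> ('b \<Rightarrow> complex)) \<Rightarrow> bool" where
  "compact_operator X nX Y nY T \<longleftrightarrow>
     T \<in> X \<rightarrow> Y \<and>
     (\<forall>f\<in>X. \<forall>g\<in>X. \<forall>c. T (\<lambda>z. c * f z + g z) = (\<lambda>z. c * T f z + T g z)) \<and>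
     (\<forall>A\<subseteq>X. (\<exists>M. \<forall>f\<in>A. nX f \<le> M) \<longrightarrow> relatively_compact_in Y nY (T ` A))"

end

theory Submission
  imports Defs "HOL-Complex_Analysis.Great_Picard"
begin

text \<open>
  Along a sequence bounded in \<open>H\<^sup>\<infinity>\<close>, Montel's theorem gives a locally uniform limit; let \<open>d\<close> be the
  difference to it. Where \<open>\<phi>(z)\<close> is outside a large compact set, \<open>Q(\<psi> (d \<circ> \<phi>))\<close> is small by the
  two limit hypotheses. Where \<open>\<phi>(z)\<close> is in that set, \<open>d\<close> and its gradient at \<open>\<phi>(z)\<close> are small,
  and \<open>\<bar>\<psi>\<bar> Q(\<phi>\<^sub>k)\<close> is bounded because the operator maps the coordinate functions to Bloch functions.

  The hypotheses of the second part imply those of the first, so there it remains to see that the operator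
  maps into the little Bloch space. Near the boundary this follows from the hypotheses. On compact sets one
  needs \<open>Q(f) \<le> 3 sup \<bar>f\<bar>\<close>, i.e. that the Bergman metric dominates the Caratheodory metric. The
  kernel function \<open>k\<close> at \<open>z\<close>, normalised, and \<open>f k\<close>, with \<open>f(z) = 0\<close>, are orthogonal, which bounds
  \<open>K(w,w)\<close> below by \<open>\<bar>k(w)\<bar>\<^sup>2 (1 + \<bar>f(w)\<bar>\<^sup>2 / M\<^sup>2)\<close> with equality at \<open>w = z\<close>; comparing Levi forms
  at this minimum of the difference gives the estimate.
\<close>

subsection \<open>Holomorphic functions of several variables\<close>

text \<open>The kernel is only a chosen function with the reproducing property, while the metric
  differentiates log K(w,w) in both kinds of variable. So the existence of the kernel and its
  smoothness along the diagonal come before any comparison. Everything is reduced to one variable by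
  restriction to complex lines, which yields \<open>holo_taylor\<close>: a second order remainder
  controlled by a radius and a supremum only. Such a bound survives pointwise limits; holomorphy of
  limits and of partial derivatives and differentiability along the diagonal all rest on it.

  The two parts meet different difficulties. In the first, the exceptional compact set is one for
  \<phi>(z), so z itself may approach the boundary there, and no bound for \<psi> is at hand. In the
  second it is a compact set for z, where \<psi> is bounded, but the hypotheses say nothing about
  \<open>theta\<close>. Its size there has to come from the metric, since \<open>Q\<close> compares
  gradients with a form that might a priori degenerate.\<close>

definition has_cderiv :: "(complex ^ 'n \<Rightarrow> complex) \<Rightarrow> (complex ^ 'n \<Rightarrow> complex) \<Rightarrow> complex ^ 'n \<Rightarrow> bool" where
  "has_cderiv f f' z \<longleftrightarrow> (f has_derivative f') (at z) \<and> (\<forall>c v. f' (c *s v) = c * f' v)"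

lemma norm_smult_vec: "norm (c *s (v :: complex ^ 'n)) = cmod c * norm v"
  by (simp add: norm_vec_def L2_set_def norm_mult power_mult_distrib sum_distrib_left [symmetric]
      real_sqrt_mult)

lemma scaleR_eq_smult_vec: "t *\<^sub>R (v :: complex ^ 'n) = of_real t *s v"
  unfolding vec_eq_iff vector_scaleR_component vector_smult_component
  by (simp add: scaleR_conv_of_real)

lemma bounded_linear_smult_vec: "bounded_linear (\<lambda>c. c *s (v :: complex ^ 'n))"
  by (intro linear_conv_bounded_linear[THEN iffD1] linearI)
     (simp_all add: scaleR_eq_smult_vec, simp_all add: vec_eq_iff algebra_simps scaleR_conv_of_real)

lemma bounded_linear_smult_vec_right: "bounded_linear (\<lambda>v :: complex ^ 'n. c *s v)"
  by (intro linear_conv_bounded_linear[THEN iffD1] linearI)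
     (simp_all only: scaleR_eq_smult_vec, simp_all add: vec_eq_iff algebra_simps)

lemma vec_eq_sum_axis: "(u :: complex ^ 'n) = (\<Sum>k\<in>UNIV. u $ k *s axis k 1)"
  by (simp add: vec_eq_iff axis_def if_distrib sum.delta' cong: if_cong)

lemma axis_imag_eq: "axis k \<i> = \<i> *s (axis k 1 :: complex ^ 'n)"
  by (simp add: vec_eq_iff axis_def)

lemma dir_deriv_eq:
  assumes "(f has_derivative f') (at z)"
  shows "dir_deriv f v z = f' v"
proof -
  have "((\<lambda>t::real. z + t *\<^sub>R v) has_derivative (\<lambda>t. t *\<^sub>R v)) (at 0)"
    by (auto intro!: derivative_eq_intros)
  from diff_chain_at[OF this, of f f'] assms
  have "((\<lambda>t. f (z + t *\<^sub>R v)) has_derivative (\<lambda>t. f' (t *\<^sub>R v))) (at 0)"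
    by (simp add: o_def)
  moreover have "f' (t *\<^sub>R v) = t *\<^sub>R f' v" for t
    using assms by (metis has_derivative_bounded_linear linear_simps(5))
  ultimately have "((\<lambda>t. f (z + t *\<^sub>R v)) has_vector_derivative f' v) (at 0)"
    by (simp add: has_vector_derivative_def)
  then show ?thesis
    by (simp add: dir_deriv_def vector_derivative_at)
qed

lemma dir_deriv_cong_open:
  assumes "open S" "z \<in> S" and eq: "\<And>w. w \<in> S \<Longrightarrow> f w = g w"
  shows "dir_deriv f v z = dir_deriv g v z"
proof -
  have "open ((\<lambda>t::real. z + t *\<^sub>R v) -` S)"
    by (intro open_vimage assms continuous_intros)
  moreover have "0 \<in> (\<lambda>t::real. z + t *\<^sub>R v) -` S" using assms by simp
  ultimately have "eventually (\<lambda>t. t \<in> (\<lambda>t::real. z + t *\<^sub>R v) -` S) (nhds 0)"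
    by (rule eventually_nhds_in_open)
  then have ev: "eventually (\<lambda>t. f (z + t *\<^sub>R v) = g (z + t *\<^sub>R v)) (nhds 0)"
    by eventually_elim (auto intro: eq)
  show ?thesis unfolding dir_deriv_def
    by (rule vector_derivative_cong_eq) (use ev in auto)
qed

text \<open>Stated for real derivatives, because it is also applied to functions of the form w
  \<mapsto> \<Phi>(w,w), which are not holomorphic.\<close>

lemma dz_eq:
  assumes "(f has_derivative f') (at z)"
  shows "dz j f z = (f' (axis j 1) - \<i> * f' (axis j \<i>)) / 2"
    and "dzbar j f z = (f' (axis j 1) + \<i> * f' (axis j \<i>)) / 2"
  by (simp_all add: dz_def dzbar_def dir_deriv_eq[OF assms])

lemma dz_cong_open:
  assumes "open S" "z \<in> S" "\<And>w. w \<in> S \<Longrightarrow> f w = g w"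
  shows "dz j f z = dz j g z"
  unfolding dz_def using dir_deriv_cong_open[OF assms] by simp

lemma has_cderiv_imp_dz:
  assumes "has_cderiv f f' z"
  shows "dz j f z = f' (axis j 1)"
  using assms unfolding has_cderiv_def
  by (auto simp: dz_eq(1) axis_imag_eq)

lemma has_cderiv_imp_grad_app:
  assumes "has_cderiv f f' z"
  shows "grad_app f z = f'"
proof
  fix u
  have bl: "bounded_linear f'"
    using assms has_derivative_bounded_linear has_cderiv_def by blast
  have "f' u = f' (\<Sum>k\<in>UNIV. u $ k *s axis k 1)"
    using vec_eq_sum_axis by metis
  also have "\<dots> = (\<Sum>k\<in>UNIV. f' (u $ k *s axis k 1))"
    using bl bounded_linear.linear linear_sum by blast
  also have "\<dots> = (\<Sum>k\<in>UNIV. u $ k * f' (axis k 1))"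
    using assms by (simp add: has_cderiv_def)
  finally show "grad_app f z u = f' u"
    using has_cderiv_imp_dz[OF assms] by (simp add: grad_app_def mult.commute)
qed

lemma grad_app_smult: "grad_app f z (c *s u) = c * grad_app f z u"
  by (simp add: grad_app_def sum_distrib_left algebra_simps)

lemma grad_app_axis: "grad_app f z (axis k 1) = dz k f z"
  by (simp add: grad_app_def axis_def if_distrib sum.delta' cong: if_cong)

text \<open>Turns \<open>grad_app f z\<close> into the canonical derivative, so that no later
  statement has to quantify over one.\<close>

lemma holo_iff: "f \<in> holo D \<longleftrightarrow> (\<forall>z\<in>D. has_cderiv f (grad_app f z) z)"
  unfolding holo_def by (auto simp: has_cderiv_def[symmetric] has_cderiv_imp_grad_app)

lemma holo_has_cderiv: "f \<in> holo D \<Longrightarrow> z \<in> D \<Longrightarrow> has_cderiv f (grad_app f z) z"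
  by (simp add: holo_iff)

lemma holo_has_derivative: "f \<in> holo D \<Longrightarrow> z \<in> D \<Longrightarrow> (f has_derivative grad_app f z) (at z)"
  using holo_has_cderiv has_cderiv_def by blast

lemma holoI: "(\<And>z. z \<in> D \<Longrightarrow> has_cderiv f (f' z) z) \<Longrightarrow> f \<in> holo D"
  by (auto simp: holo_def has_cderiv_def)

lemma holo_subset: "f \<in> holo D \<Longrightarrow> E \<subseteq> D \<Longrightarrow> f \<in> holo E"
  by (auto simp: holo_def)

lemma holo_continuous_on: "f \<in> holo D \<Longrightarrow> continuous_on D f"
  by (meson continuous_at_imp_continuous_on has_derivative_continuous holo_has_derivative)

lemma has_cderiv_const [intro]: "has_cderiv (\<lambda>_. c) (\<lambda>_. 0) z"
  by (simp add: has_cderiv_def)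

lemma has_cderiv_add [intro]:
  "has_cderiv f f' z \<Longrightarrow> has_cderiv g g' z \<Longrightarrow> has_cderiv (\<lambda>z. f z + g z) (\<lambda>v. f' v + g' v) z"
  by (auto simp: has_cderiv_def algebra_simps intro: has_derivative_add)

lemma has_cderiv_diff [intro]:
  "has_cderiv f f' z \<Longrightarrow> has_cderiv g g' z \<Longrightarrow> has_cderiv (\<lambda>z. f z - g z) (\<lambda>v. f' v - g' v) z"
  by (auto simp: has_cderiv_def algebra_simps intro: has_derivative_diff)

lemma has_cderiv_mult [intro]:
  "has_cderiv f f' z \<Longrightarrow> has_cderiv g g' z \<Longrightarrow>
    has_cderiv (\<lambda>z. f z * g z) (\<lambda>v. f z * g' v + f' v * g z) z"
  by (auto simp: has_cderiv_def algebra_simps intro: has_derivative_mult)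

lemma has_cderiv_coord [intro]: "has_cderiv (\<lambda>z. z $ k) (\<lambda>v. v $ k) z"
  unfolding has_cderiv_def
  using bounded_linear_imp_has_derivative[OF bounded_linear_vec_nth] by auto

lemma holo_const [intro]: "(\<lambda>_. c) \<in> holo D"
  and holo_coord [intro]: "(\<lambda>z. z $ k) \<in> holo D"
  by (rule holoI, blast)+

lemma holo_add [intro]: "f \<in> holo D \<Longrightarrow> g \<in> holo D \<Longrightarrow> (\<lambda>z. f z + g z) \<in> holo D"
  and holo_diff [intro]: "f \<in> holo D \<Longrightarrow> g \<in> holo D \<Longrightarrow> (\<lambda>z. f z - g z) \<in> holo D"
  and holo_mult [intro]: "f \<in> holo D \<Longrightarrow> g \<in> holo D \<Longrightarrow> (\<lambda>z. f z * g z) \<in> holo D"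
  by (rule holoI; blast intro: holo_has_cderiv)+

lemma grad_app_diff:
  "f \<in> holo D \<Longrightarrow> g \<in> holo D \<Longrightarrow> z \<in> D \<Longrightarrow>
    grad_app (\<lambda>z. f z - g z) z u = grad_app f z u - grad_app g z u"
  by (simp add: has_cderiv_imp_grad_app[OF has_cderiv_diff[OF holo_has_cderiv holo_has_cderiv]])

lemma grad_app_mult:
  "f \<in> holo D \<Longrightarrow> g \<in> holo D \<Longrightarrow> z \<in> D \<Longrightarrow>
    grad_app (\<lambda>z. f z * g z) z u = f z * grad_app g z u + grad_app f z u * g z"
  by (simp add: has_cderiv_imp_grad_app[OF has_cderiv_mult[OF holo_has_cderiv holo_has_cderiv]])

lemma grad_app_cmult:
  "f \<in> holo D \<Longrightarrow> z \<in> D \<Longrightarrow> grad_app (\<lambda>z. c * f z) z u = c * grad_app f z u"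
  using grad_app_mult[OF holo_const[of c], of f D z u]
  by (simp add: has_cderiv_imp_grad_app[OF has_cderiv_const])

lemma has_cderiv_compose:
  assumes f: "f \<in> holo D" and F: "F \<in> holo_map E" "F ` E \<subseteq> D" and z: "z \<in> E"
  shows "has_cderiv (f \<circ> F) (\<lambda>u. \<Sum>k\<in>UNIV. dz k f (F z) * grad_app (\<lambda>z. F z $ k) z u) z"
proof -
  \<comment> \<open>\<open>holo_map\<close> speaks of coordinates only; the derivative of the vector
    valued map is assembled from theirs.\<close>
  define F' where "F' u = (\<Sum>k\<in>UNIV. grad_app (\<lambda>z. F z $ k) z u *s axis k 1)" for u
  have "((\<lambda>w. \<Sum>k\<in>UNIV. F w $ k *s axis k 1) has_derivative F') (at z)"
    unfolding F'_def
    by (intro has_derivative_sum bounded_linear.has_derivative[OF bounded_linear_smult_vec]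
        holo_has_derivative[OF _ z]) (use F in \<open>auto simp: holo_map_def\<close>)
  then have dF: "(F has_derivative F') (at z)"
    by (simp add: vec_eq_sum_axis[symmetric])
  have Fz: "F z \<in> D" using F z by auto
  have "(f \<circ> F has_derivative grad_app f (F z) \<circ> F') (at z)"
    by (rule diff_chain_at[OF dF holo_has_derivative[OF f Fz]])
  moreover have "grad_app f (F z) \<circ> F' =
      (\<lambda>u. \<Sum>k\<in>UNIV. dz k f (F z) * grad_app (\<lambda>z. F z $ k) z u)"
  proof
    fix u
    have "F' u $ k = grad_app (\<lambda>z. F z $ k) z u" for k
      by (simp add: F'_def axis_def if_distrib sum.delta' cong: if_cong)
    then show "(grad_app f (F z) \<circ> F') u =
        (\<Sum>k\<in>UNIV. dz k f (F z) * grad_app (\<lambda>z. F z $ k) z u)"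
      by (simp add: grad_app_def)
  qed
  ultimately show ?thesis
    by (simp add: has_cderiv_def grad_app_smult sum_distrib_left algebra_simps)
qed

lemma holo_compose:
  "f \<in> holo D \<Longrightarrow> F \<in> holo_map E \<Longrightarrow> F ` E \<subseteq> D \<Longrightarrow> f \<circ> F \<in> holo E"
  by (rule holoI, rule has_cderiv_compose)

lemma grad_app_compose:
  assumes "f \<in> holo D" "F \<in> holo_map E" "F ` E \<subseteq> D" "z \<in> E"
  shows "grad_app (f \<circ> F) z u = (\<Sum>k\<in>UNIV. dz k f (F z) * grad_app (\<lambda>z. F z $ k) z u)"
  by (simp add: has_cderiv_imp_grad_app[OF has_cderiv_compose[OF assms]])

lemma holo_map_continuous_on: "F \<in> holo_map D \<Longrightarrow> continuous_on D F"
  using continuous_on_vec_lambda[of D "\<lambda>k z. F z $ k"]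
  by (simp add: holo_map_def holo_continuous_on)

section \<open>Restriction to complex lines, Cauchy estimates and Taylor bounds\<close>

lemma holo_slice:
  assumes "f \<in> holo D" "z + \<zeta> *s v \<in> D"
  shows "((\<lambda>\<zeta>. f (z + \<zeta> *s v)) has_field_derivative grad_app f (z + \<zeta> *s v) v) (at \<zeta>)"
proof -
  have "((\<lambda>\<zeta>. z + \<zeta> *s v) has_derivative (\<lambda>\<zeta>. \<zeta> *s v)) (at \<zeta>)"
    by (auto intro!: derivative_eq_intros bounded_linear.has_derivative[OF bounded_linear_smult_vec])
  from diff_chain_at[OF this holo_has_derivative[OF assms]]
  show ?thesis
    by (simp add: has_field_derivative_def o_def grad_app_smult mult.commute[of _ "grad_app _ _ _"])
qed

lemma holo_slice_ball:
  assumes f: "f \<in> holo (ball z r)" and v: "norm v = 1"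
  shows "(\<lambda>\<zeta>. f (z + \<zeta> *s v)) holomorphic_on ball 0 r"
    and "cmod \<zeta> < r \<Longrightarrow> deriv (\<lambda>\<zeta>. f (z + \<zeta> *s v)) \<zeta> = grad_app f (z + \<zeta> *s v) v"
proof -
  have *: "((\<lambda>\<zeta>. f (z + \<zeta> *s v)) has_field_derivative grad_app f (z + \<zeta> *s v) v) (at \<zeta>)"
    if "cmod \<zeta> < r" for \<zeta>
    using that v by (intro holo_slice[OF f]) (simp add: dist_norm norm_smult_vec)
  show "(\<lambda>\<zeta>. f (z + \<zeta> *s v)) holomorphic_on ball 0 r"
    unfolding holomorphic_on_open[OF open_ball] using * by (metis dist_0_norm mem_ball)
  show "deriv (\<lambda>\<zeta>. f (z + \<zeta> *s v)) \<zeta> = grad_app f (z + \<zeta> *s v) v" if "cmod \<zeta> < r"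
    using *[OF that] by (rule DERIV_imp_deriv)
qed

text \<open>Covers u = 0 by an arbitrary unit vector, which spares the estimates along the direction
  of u a case distinction.\<close>

lemma unit_direction:
  obtains v :: "complex ^ 'n" where "norm v = 1" "u = of_real (norm u) *s v"
proof (cases "u = 0")
  case True
  have "norm (axis undefined 1 :: complex ^ 'n) = 1" by (simp add: norm_vec_def axis_def L2_set_def if_distrib[of norm] if_distrib[of "\<lambda>x. x ^ 2"] sum.delta cong: if_cong)
  with True show ?thesis by (intro that[of "axis undefined 1"]) (auto simp: vec_eq_iff)
next
  case False
  then show ?thesis
    by (intro that[of "u /\<^sub>R norm u"]) (auto simp: scaleR_eq_smult_vec[symmetric])
qed

text \<open>The radius \<open>r / 2\<close> of the circle avoids assuming continuity on the closed ball.\<close>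

lemma grad_app_bound:
  assumes f: "f \<in> holo (ball z r)" and r: "0 < r" and B: "\<And>w. w \<in> ball z r \<Longrightarrow> cmod (f w) \<le> B"
  shows "cmod (grad_app f z u) \<le> 2 * B / r * norm u"
proof -
  obtain v where v: "norm v = 1" "u = of_real (norm u) *s v"
    by (rule unit_direction)
  define h where "h \<zeta> = f (z + \<zeta> *s v)" for \<zeta>
  have hol: "h holomorphic_on ball 0 r" unfolding h_def by (rule holo_slice_ball[OF f v(1)])
  have "cmod ((deriv ^^ 1) h 0) \<le> fact 1 * B / (r/2) ^ 1"
  proof (rule Cauchy_inequality)
    show "h holomorphic_on ball 0 (r/2)"
      using r by (intro holomorphic_on_subset[OF hol]) auto
    show "continuous_on (cball 0 (r/2)) h"
      using r by (intro continuous_on_subset[OF holomorphic_on_imp_continuous_on[OF hol]]) auto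
    show "cmod (h x) \<le> B" if "cmod (0 - x) = r/2" for x
      unfolding h_def using that r v(1) by (intro B) (simp add: dist_norm norm_smult_vec)
  qed (use r in auto)
  then have "cmod (grad_app f z v) \<le> 2 * B / r"
    using holo_slice_ball(2)[OF f v(1), of 0] r by (simp add: h_def[abs_def] field_simps)
  then have "norm u * cmod (grad_app f z v) \<le> norm u * (2 * B / r)"
    by (intro mult_left_mono) auto
  then show ?thesis
    by (subst v(2), subst grad_app_smult) (simp add: norm_mult mult.commute)
qed

text \<open>Taylor's formula on the complex line through u. The constant depends on f only through
  its bound B, so the estimate is uniform over bounded families and passes to limits.\<close>

lemma holo_taylor:
  assumes f: "f \<in> holo (ball z r)" and r: "0 < r" and B: "\<And>w. w \<in> ball z r \<Longrightarrow> cmod (f w) \<le> B"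
    and u: "norm u \<le> r / 2"
  shows "cmod (f (z + u) - f z - grad_app f z u) \<le> 32 * B / r\<^sup>2 * (norm u)\<^sup>2"
proof -
  obtain v where v: "norm v = 1" "u = of_real (norm u) *s v"
    by (rule unit_direction)
  define h where "h \<zeta> = f (z + \<zeta> *s v)" for \<zeta>
  have hol: "h holomorphic_on ball 0 r" unfolding h_def by (rule holo_slice_ball[OF f v(1)])
  have hB: "cmod (h x) \<le> B" if "cmod x < r" for x
    unfolding h_def using that r v(1) by (intro B) (simp add: dist_norm norm_smult_vec)
  have in_ball: "x \<in> ball 0 r" if "cmod (\<xi> - x) \<le> r/4" "cmod \<xi> \<le> r/2" for x \<xi>
    using that r norm_triangle_sub[of x \<xi>] by (simp add: norm_minus_commute)
  have "cmod (((deriv ^^ 0) h) (of_real (norm u)) -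
      (\<Sum>i\<le>1. ((deriv ^^ i) h) 0 * (of_real (norm u) - 0) ^ i / fact i))
      \<le> (32 * B / r\<^sup>2) * cmod (of_real (norm u) - 0) ^ Suc 1 / fact 1"
  proof (rule complex_Taylor[where S="cball 0 (r/2)"])
    show "((deriv ^^ i) h has_field_derivative (deriv ^^ Suc i) h x) (at x within cball 0 (r/2))"
      if "x \<in> cball 0 (r/2)" for i x
    proof -
      have "(deriv ^^ i) h holomorphic_on ball 0 r"
        by (intro holomorphic_higher_deriv hol) auto
      moreover have "x \<in> ball 0 r" using that r by auto
      ultimately have "((deriv ^^ i) h has_field_derivative deriv ((deriv ^^ i) h) x) (at x)"
        by (intro holomorphic_derivI) auto
      then show ?thesis by (simp add: has_field_derivative_at_within)
    qed
    \<comment> \<open>Circles of radius r/4 about points of the disc of radius r/2 stay in the disc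
      of radius r, and Cauchy's inequality gives 2 B / (r/4)^2 = 32 B / r^2.\<close>
    show "cmod ((deriv ^^ Suc 1) h \<xi>) \<le> 32 * B / r\<^sup>2" if "\<xi> \<in> cball 0 (r/2)" for \<xi>
    proof -
      have "cmod ((deriv ^^ 2) h \<xi>) \<le> fact 2 * B / (r/4) ^ 2"
      proof (rule Cauchy_inequality)
        show "h holomorphic_on ball \<xi> (r/4)"
          by (intro holomorphic_on_subset[OF hol] subsetI in_ball[of \<xi>]) (use that in \<open>auto simp: dist_norm\<close>)
        show "continuous_on (cball \<xi> (r/4)) h"
          by (intro continuous_on_subset[OF holomorphic_on_imp_continuous_on[OF hol]] subsetI
              in_ball[of \<xi>]) (use that in \<open>auto simp: dist_norm\<close>)
        show "cmod (h x) \<le> B" if "cmod (\<xi> - x) = r/4" for x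
          using in_ball[of \<xi> x] that \<open>\<xi> \<in> cball 0 (r/2)\<close> by (intro hB) auto
      qed (use r in auto)
      then show ?thesis by (simp add: numeral_2_eq_2 power_divide field_simps)
    qed
  qed (use r u in auto)
  moreover have "h (of_real (norm u)) = f (z + u)"
    unfolding h_def using v(2) by simp
  moreover have "deriv h 0 * of_real (norm u) = grad_app f z u"
    using holo_slice_ball(2)[OF f v(1), of 0] r
    by (subst (2) v(2), subst grad_app_smult) (simp add: h_def[abs_def] mult.commute)
  moreover have "h 0 = f z" by (simp add: h_def)
  ultimately show ?thesis by (simp add: power2_eq_square diff_diff_eq)
qed

text \<open>A quadratic remainder is used as the certificate of differentiability because, unlike a
  little-o, it is preserved by limits.\<close>

lemma has_derivative_quadratic:
  fixes f :: "'a::real_normed_vector \<Rightarrow> 'b::real_normed_vector"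
  assumes L: "bounded_linear L" and r: "0 < r"
    and q: "\<And>u. norm u < r \<Longrightarrow> norm (f (z + u) - f z - L u) \<le> C * (norm u)\<^sup>2"
  shows "(f has_derivative L) (at z)"
  unfolding has_derivative_at
proof (intro conjI L)
  show "(\<lambda>h. norm (f (z + h) - f z - L h) / norm h) \<midarrow>0\<rightarrow> 0"
  proof (rule tendsto_sandwich[OF _ _ tendsto_const])
    have "eventually (\<lambda>h. h \<in> ball 0 r) (at (0::'a))"
      using r by (intro eventually_at_in_open') auto
    then show "eventually (\<lambda>h. norm (f (z + h) - f z - L h) / norm h \<le> C * norm h) (at 0)"
    proof eventually_elim
      case (elim h)
      then have "norm (f (z + h) - f z - L h) / norm h \<le> C * (norm h)\<^sup>2 / norm h"
        by (intro divide_right_mono q) auto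
      also have "C * (norm h)\<^sup>2 / norm h = C * norm h" by (simp add: power2_eq_square)
      finally show ?case .
    qed
    show "(\<lambda>h::'a. C * norm h) \<midarrow>0\<rightarrow> 0"
      by (auto intro!: tendsto_eq_intros)
  qed (auto intro!: always_eventually)
qed

lemma holo_lipschitz_at:
  assumes f: "f \<in> holo (ball z r)" and r: "0 < r" and B: "\<And>w. w \<in> ball z r \<Longrightarrow> cmod (f w) \<le> B"
    and u: "norm u \<le> r / 2"
  shows "cmod (f (z + u) - f z) \<le> 18 * B / r * norm u"
proof -
  have B0: "0 \<le> B" using B[of z] r by (meson centre_in_ball norm_ge_zero order_trans)
  have "cmod (f (z + u) - f z) \<le> cmod (f (z + u) - f z - grad_app f z u) + cmod (grad_app f z u)"
    using norm_triangle_ineq[of "f (z + u) - f z - grad_app f z u" "grad_app f z u"] by simp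
  also have "\<dots> \<le> 32 * B / r\<^sup>2 * (norm u)\<^sup>2 + 2 * B / r * norm u"
    by (intro add_mono holo_taylor grad_app_bound assms)
  \<comment> \<open>One factor \<open>norm u\<close> is at most r/2, which leaves 16 B / r; with the
    2 B / r of the gradient this makes 18.\<close>
  also have "32 * B / r\<^sup>2 * (norm u)\<^sup>2 \<le> 32 * B / r\<^sup>2 * (r / 2 * norm u)"
    using u B0 mult_right_mono[OF u norm_ge_zero[of u]]
    by (intro mult_left_mono) (auto simp: power2_eq_square)
  also have "32 * B / r\<^sup>2 * (r / 2 * norm u) + 2 * B / r * norm u = 18 * B / r * norm u"
    using r by (simp add: power2_eq_square field_simps)
  finally show ?thesis by simp
qed

section \<open>Locally uniform limits\<close>

lemma has_cderiv_limit:
  fixes f :: "nat \<Rightarrow> complex ^ 'n \<Rightarrow> complex"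
  assumes r: "0 < r" and f: "\<And>n. f n \<in> holo (ball z r)"
    and B: "\<And>n w. w \<in> ball z r \<Longrightarrow> cmod (f n w) \<le> B"
    and lim: "uniform_limit (ball z r) f g sequentially"
  obtains L where "has_cderiv g L z"
proof -
  \<comment> \<open>The Cauchy estimate for f m - f n shows that the gradients at z form a Cauchy
    sequence in each direction; their limit L is the candidate derivative.\<close>
  have "\<exists>l. (\<lambda>n. grad_app (f n) z u) \<longlonglongrightarrow> l" for u
    unfolding convergent_def[symmetric] Cauchy_convergent_iff[symmetric]
  proof (rule CauchyI)
    fix e :: real assume e: "0 < e"
    \<comment> \<open>Makes 2 d / r * \<open>norm u\<close> at most e / 2; the summand 1 keeps the
      quotient meaningful for u = 0.\<close>
    define d where "d = e * r / (4 * (norm u + 1))"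
    have d: "0 < d" unfolding d_def using e r by (intro divide_pos_pos mult_pos_pos) (auto intro: add_nonneg_pos)
    have "eventually (\<lambda>n. \<forall>x\<in>ball z r. dist (f n x) (g x) < d / 2) sequentially"
      using lim half_gt_zero[OF d] unfolding uniform_limit_iff by blast
    then obtain N where N: "\<And>n x. n \<ge> N \<Longrightarrow> x \<in> ball z r \<Longrightarrow> dist (f n x) (g x) < d / 2"
      unfolding eventually_sequentially by blast
    have "cmod (grad_app (f m) z u - grad_app (f n) z u) < e" if "m \<ge> N" "n \<ge> N" for m n
    proof -
      have "cmod (grad_app (\<lambda>w. f m w - f n w) z u) \<le> 2 * d / r * norm u"
      proof (rule grad_app_bound[OF holo_diff[OF f f] r])
        fix w assume w: "w \<in> ball z r"
        have "dist (f m w) (f n w) < d"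
          using N[OF that(1) w] N[OF that(2) w] dist_triangle_half_l by blast
        then show "cmod (f m w - f n w) \<le> d" by (simp add: dist_norm)
      qed
      also have "2 * d / r * norm u = e / 2 * (norm u / (norm u + 1))"
      proof -
        have "2 * (e * r / (4 * x)) / r * y = e / 2 * (y / x)" if "x \<noteq> 0" for x y
          using r that by (simp add: field_simps)
        moreover have "norm u + 1 \<noteq> 0" using norm_ge_zero[of u] by linarith
        ultimately show ?thesis unfolding d_def by blast
      qed
      also have "\<dots> \<le> e / 2 * 1"
        using e by (intro mult_left_mono) (auto simp: divide_le_eq add_nonneg_pos)
      also have "\<dots> < e" using e by simp
      finally show ?thesis
        using r by (subst (asm) grad_app_diff[OF f f]) auto
    qed
    then show "\<exists>N. \<forall>m\<ge>N. \<forall>n\<ge>N. cmod (grad_app (f m) z u - grad_app (f n) z u) < e" by blast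
  qed
  then obtain L where L: "\<And>u. (\<lambda>n. grad_app (f n) z u) \<longlonglongrightarrow> L u" by metis
  have Lsm: "L (c *s u) = c * L u" for c u
    using LIMSEQ_unique[OF L[of "c *s u"]] tendsto_mult_left[OF L[of u], of c]
    by (simp add: grad_app_smult)
  have Ladd: "L (u + v) = L u + L v" for u v
  proof (rule LIMSEQ_unique[OF L])
    show "(\<lambda>n. grad_app (f n) z (u + v)) \<longlonglongrightarrow> L u + L v"
      using tendsto_add[OF L[of u] L[of v]]
      by (simp add: grad_app_def algebra_simps sum.distrib)
  qed
  have bl: "bounded_linear L"
    by (intro linear_conv_bounded_linear[THEN iffD1] linearI Ladd)
       (simp add: scaleR_eq_smult_vec Lsm scaleR_conv_of_real)
  have glim: "(\<lambda>n. f n w) \<longlonglongrightarrow> g w" if "w \<in> ball z r" for w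
    using lim that by (rule tendsto_uniform_limitI)
  \<comment> \<open>All f n satisfy the same quadratic remainder bound, so g satisfies it with
    L.\<close>
  have "(g has_derivative L) (at z)"
  proof (rule has_derivative_quadratic[OF bl, of "r / 2" _ _ "32 * B / r\<^sup>2"])
    fix u :: "complex ^ 'n" assume u: "norm u < r / 2"
    have "(\<lambda>n. cmod (f n (z + u) - f n z - grad_app (f n) z u)) \<longlonglongrightarrow> cmod (g (z + u) - g z - L u)"
      using u r by (intro tendsto_intros glim L) (auto simp: dist_norm)
    then show "cmod (g (z + u) - g z - L u) \<le> 32 * B / r\<^sup>2 * (norm u)\<^sup>2"
      by (rule Lim_bounded) (use holo_taylor[OF f r B] u in auto)
  qed (use r in auto)
  then show ?thesis
    using Lsm that has_cderiv_def by blast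
qed

lemma holo_limit:
  assumes *: "\<And>z. z \<in> D \<Longrightarrow> \<exists>r>0. \<exists>B. (\<forall>n. f n \<in> holo (ball z r)) \<and>
      (\<forall>n. \<forall>w\<in>ball z r. cmod (f n w) \<le> B) \<and> uniform_limit (ball z r) f g sequentially"
  shows "g \<in> holo D"
  unfolding holo_iff
proof
  fix z assume z: "z \<in> D"
  obtain r B where r: "0 < r" "\<And>n. f n \<in> holo (ball z r)"
    "\<And>n w. w\<in>ball z r \<Longrightarrow> cmod (f n w) \<le> B" "uniform_limit (ball z r) f g sequentially"
    using *[OF z] by blast
  obtain L where "has_cderiv g L z"
    by (rule has_cderiv_limit[OF r])
  then show "has_cderiv g (grad_app g z) z" using has_cderiv_imp_grad_app by blast
qed

text \<open>Room for Cauchy estimates: the balls of radius r about the points of C stay in a single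
  compact set on which the functions are controlled.\<close>

lemma compact_thickening:
  fixes C :: "(complex ^ 'n) set"
  assumes "compact C" "C \<subseteq> D" "open D"
  obtains r C' where "0 < r" "compact C'" "C' \<subseteq> D" "C \<subseteq> C'" "\<And>z. z \<in> C \<Longrightarrow> cball z r \<subseteq> C'"
proof -
  obtain r where r: "0 < r" "(\<Union>x\<in>C. cball x r) \<subseteq> D"
    using compact_subset_open_imp_cball_epsilon_subset assms by metis
  show ?thesis
  proof (rule that[OF r(1) _ r(2)])
    show "compact (\<Union>x\<in>C. cball x r)"
      using compact_minkowski_sum_cball[OF assms(1)] by simp
  qed (use r in \<open>auto intro: less_imp_le\<close>)
qed

lemma norm_axis_vec: "norm (axis k 1 :: complex ^ 'n) = 1"
  by (simp add: norm_vec_def axis_def L2_set_def if_distrib[of norm] if_distrib[of "\<lambda>x. x ^ 2"] sum.delta cong: if_cong)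

text \<open>Cauchy's estimate for f n - g on the balls of a thickening of C. A difference below e r
  / 4 there makes the derivatives differ by at most e / 2.\<close>

lemma uniform_limit_dz:
  fixes g :: "complex ^ 'n \<Rightarrow> complex"
  assumes D: "open D" and f: "\<And>n. f n \<in> holo D" and g: "g \<in> holo D"
    and lim: "\<And>C. compact C \<Longrightarrow> C \<subseteq> D \<Longrightarrow> uniform_limit C f g sequentially"
    and C: "compact C" "C \<subseteq> D"
  shows "uniform_limit C (\<lambda>n. dz k (f n)) (dz k g) sequentially"
proof -
  obtain r C' where r: "0 < r" and C': "compact C'" "C' \<subseteq> D" "\<And>z. z \<in> C \<Longrightarrow> cball z r \<subseteq> C'"
    using compact_thickening[OF C D] by metis
  show ?thesis
    unfolding uniform_limit_iff
  proof (intro allI impI)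
    fix e :: real assume e: "0 < e"
    define d where "d = e * r / 4"
    have d: "0 < d" using e r by (simp add: d_def)
    from lim[OF C'(1,2)] d have "\<forall>\<^sub>F n in sequentially. \<forall>x\<in>C'. dist (f n x) (g x) < d"
      by (auto simp: uniform_limit_iff)
    then show "\<forall>\<^sub>F n in sequentially. \<forall>x\<in>C. dist (dz k (f n) x) (dz k g x) < e"
    proof (eventually_elim, intro ballI)
      fix n x assume *: "\<forall>x\<in>C'. dist (f n x) (g x) < d" and x: "x \<in> C"
      have sub: "ball x r \<subseteq> C'" using C'(3)[OF x] by auto
      have "cmod (grad_app (\<lambda>w. f n w - g w) x (axis k 1)) \<le> 2 * d / r * norm (axis k 1 :: complex ^ 'n)"
      proof (rule grad_app_bound[OF _ r])
        show "(\<lambda>w. f n w - g w) \<in> holo (ball x r)"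
          using sub C'(2) by (intro holo_subset[OF holo_diff[OF f g]]) auto
        show "cmod (f n w - g w) \<le> d" if "w \<in> ball x r" for w
          using * sub that by (fastforce simp: dist_norm)
      qed
      then have "cmod (dz k (f n) x - dz k g x) \<le> e / 2"
        using C x r by (subst (asm) grad_app_diff[OF f g]) (auto simp: grad_app_axis norm_axis_vec d_def)
      then show "dist (dz k (f n) x) (dz k g x) < e" using e by (simp add: dist_norm)
    qed
  qed
qed

section \<open>Partial derivatives as limits of difference quotients\<close>

lemma dz_quotient:
  fixes f :: "complex ^ 'n \<Rightarrow> complex"
  assumes f: "f \<in> holo (ball z r)" and r: "0 < r" and B: "\<And>w. w \<in> ball z r \<Longrightarrow> cmod (f w) \<le> B"
    and t: "0 < t" "t \<le> r / 2"
  shows "cmod ((f (z + of_real t *s axis k 1) - f z) / of_real t - dz k f z) \<le> 32 * B / r\<^sup>2 * t"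
proof -
  have "cmod (f (z + of_real t *s axis k 1) - f z - grad_app f z (of_real t *s axis k 1))
      \<le> 32 * B / r\<^sup>2 * (norm (of_real t *s axis k 1 :: complex ^ 'n))\<^sup>2"
    by (rule holo_taylor[OF f r B]) (use t in \<open>auto simp: norm_smult_vec norm_axis_vec\<close>)
  then have "cmod (f (z + of_real t *s axis k 1) - f z - of_real t * dz k f z) / t \<le> 32 * B / r\<^sup>2 * t\<^sup>2 / t"
    using t by (intro divide_right_mono)
      (auto simp: norm_smult_vec norm_axis_vec grad_app_smult grad_app_axis)
  moreover have "cmod ((f (z + of_real t *s axis k 1) - f z) / of_real t - dz k f z) =
      cmod (f (z + of_real t *s axis k 1) - f z - of_real t * dz k f z) / t"
  proof -
    have "(f (z + of_real t *s axis k 1) - f z) / of_real t - dz k f z =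
        (f (z + of_real t *s axis k 1) - f z - of_real t * dz k f z) / of_real t"
      using t by (simp add: field_simps)
    then show ?thesis using t by (simp add: norm_divide)
  qed
  ultimately show ?thesis using t by (simp add: power2_eq_square)
qed

lemma uniform_limit_le:
  assumes "\<And>n x. x \<in> S \<Longrightarrow> dist (f n x) (g x) \<le> a n" "a \<longlonglongrightarrow> (0::real)"
  shows "uniform_limit S f g sequentially"
  unfolding uniform_limit_iff
proof (intro allI impI)
  fix e :: real assume "0 < e"
  with assms(2) have "eventually (\<lambda>n. a n < e) sequentially" by (rule order_tendstoD)
  then show "\<forall>\<^sub>F n in sequentially. \<forall>x\<in>S. dist (f n x) (g x) < e"
    by eventually_elim (use assms(1) le_less_trans in blast)
qed

lemma has_cderiv_shift:
  assumes "has_cderiv f f' (z + a)"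
  shows "has_cderiv (\<lambda>w. f (w + a)) f' z"
proof -
  have "((\<lambda>w. w + a) has_derivative (\<lambda>x. x)) (at z)" by (auto intro!: derivative_eq_intros)
  from diff_chain_at[OF this, of f f'] assms show ?thesis
    by (simp add: has_cderiv_def o_def)
qed

lemma holo_shift: "f \<in> holo D \<Longrightarrow> (\<And>w. w \<in> E \<Longrightarrow> w + a \<in> D) \<Longrightarrow> (\<lambda>w. f (w + a)) \<in> holo E"
  by (rule holoI, rule has_cderiv_shift, rule holo_has_cderiv)

lemma LIMSEQ_quotient_steps: "(\<lambda>n. c * (r / (2 * (real n + 1)))) \<longlonglongrightarrow> 0"
proof -
  have "(\<lambda>n. c * r / 2 * inverse (real (Suc n))) \<longlonglongrightarrow> c * r / 2 * 0"
    by (intro tendsto_mult tendsto_const LIMSEQ_inverse_real_of_nat)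
  moreover have "c * r / 2 * inverse (real (Suc n)) = c * (r / (2 * (real n + 1)))" for n
    by (simp only: divide_inverse inverse_mult_distrib of_nat_Suc mult.assoc mult.left_commute add.commute)
  ultimately show ?thesis by (simp only: mult_zero_right)
qed

lemma holo_continuous_bound:
  assumes "f \<in> holo D" "compact C" "C \<subseteq> D"
  obtains B where "0 < B" "\<And>z. z \<in> C \<Longrightarrow> cmod (f z) \<le> B"
proof -
  have "compact (f ` C)"
    using assms by (intro compact_continuous_image continuous_on_subset[OF holo_continuous_on])
  then show ?thesis
    using compact_imp_bounded bounded_pos that by (metis image_eqI)
qed

text \<open>The difference quotients with steps tending to 0 are holomorphic, and by
  \<open>dz_quotient\<close> they converge at a rate that does not depend on the base point. So the
  partial derivative is a bounded, locally uniform limit of holomorphic functions.\<close>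

lemma holo_dz:
  fixes f :: "complex ^ 'n \<Rightarrow> complex"
  assumes D: "open D" and f: "f \<in> holo D"
  shows "dz k f \<in> holo D"
  unfolding holo_iff
proof
  fix z assume z: "z \<in> D"
  obtain r0 where r0: "0 < r0" "cball z r0 \<subseteq> D" using D z open_contains_cball by blast
  \<comment> \<open>Balls of radius r about points of \<open>ball z r\<close> then stay in
    \<open>cball z (2 * r)\<close>, where f is bounded by B.\<close>
  define r where "r = r0 / 2"
  have r: "0 < r" "cball z (2 * r) \<subseteq> D" using r0 by (auto simp: r_def)
  obtain B where B: "0 < B" "\<And>w. w \<in> cball z (2 * r) \<Longrightarrow> cmod (f w) \<le> B"
    using holo_continuous_bound[OF f compact_cball r(2)] by blast
  define t where "t n = r / (2 * (real n + 1))" for n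
  have t: "0 < t n" "t n \<le> r / 2" for n
    using r by (auto simp: t_def field_simps)
  define q where "q n w = (f (w + of_real (t n) *s axis k 1) - f w) / of_real (t n)" for n w
  have sub: "ball w r \<subseteq> cball z (2 * r)" if "w \<in> ball z r" for w
  proof
    fix x assume "x \<in> ball w r"
    then show "x \<in> cball z (2 * r)" using that dist_triangle[of z x w] by simp
  qed
  have q: "cmod (q n w - dz k f w) \<le> 32 * B / r\<^sup>2 * t n" if "w \<in> ball z r" for n w
    unfolding q_def using sub[OF that] r(2) by (intro dz_quotient r t holo_subset[OF f] B) auto
  have "dz k f \<in> holo (ball z r)"
  proof (rule holo_limit)
    fix w assume w: "w \<in> ball z r"
    obtain s where s: "0 < s" "ball w s \<subseteq> ball z r"
      using open_ball w by (metis open_contains_ball)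
    have "q n \<in> holo (ball z r)" for n
    proof -
      have "(\<lambda>w. f (w + of_real (t n) *s axis k 1) - f w) \<in> holo (ball z r)"
      proof (intro holo_diff holo_shift[OF f] holo_subset[OF f])
        fix v assume v: "v \<in> ball z r"
        have "v + of_real (t n) *s axis k 1 \<in> ball v r"
          using t[of n] r by (simp add: dist_norm norm_smult_vec norm_axis_vec)
        then show "v + of_real (t n) *s axis k 1 \<in> D" using sub[OF v] r by auto
      qed (use r in auto)
      from holo_mult[OF this holo_const[of "inverse (of_real (t n))"]] show ?thesis
        by (simp add: q_def[abs_def] divide_inverse)
    qed
    then have "q n \<in> holo (ball w s)" for n using s holo_subset by blast
    moreover have "cmod (q n v) \<le> 32 * B / r\<^sup>2 * r + 2 * B / r" if "v \<in> ball w s" for n v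
    proof -
      have v: "v \<in> ball z r" using that s by auto
      have "cmod (grad_app f v (axis k 1)) \<le> 2 * B / r * norm (axis k 1 :: complex ^ 'n)"
        using sub[OF v] r by (intro grad_app_bound holo_subset[OF f] B(2)) auto
      then have "cmod (dz k f v) \<le> 2 * B / r" by (simp add: grad_app_axis norm_axis_vec)
      moreover have "cmod (q n v - dz k f v) \<le> 32 * B / r\<^sup>2 * r"
        using q[OF v, of n] t[of n] B r
        by (elim order_trans) (intro mult_left_mono, auto)
      ultimately show ?thesis
        using norm_triangle_sub[of "q n v" "dz k f v"] by linarith
    qed
    moreover have "uniform_limit (ball w s) q (dz k f) sequentially"
    proof (rule uniform_limit_le)
      show "dist (q n x) (dz k f x) \<le> 32 * B / r\<^sup>2 * t n" if "x \<in> ball w s" for n x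
        using that s q by (auto simp: dist_norm)
      show "(\<lambda>n. 32 * B / r\<^sup>2 * t n) \<longlonglongrightarrow> 0"
        unfolding t_def by (rule LIMSEQ_quotient_steps)
    qed
    ultimately show "\<exists>s>0. \<exists>B. (\<forall>n. q n \<in> holo (ball w s)) \<and>
      (\<forall>n. \<forall>v\<in>ball w s. cmod (q n v) \<le> B) \<and> uniform_limit (ball w s) q (dz k f) sequentially"
      using s(1) by blast
  qed
  then show "has_cderiv (dz k f) (grad_app (dz k f) z) z"
    by (rule holo_has_cderiv) (use r in auto)
qed

section \<open>Normal families, by the theorem of Arzela and Ascoli and a diagonal sequence\<close>

lemma Montel_vec:
  fixes f :: "nat \<Rightarrow> complex ^ 'n \<Rightarrow> complex"
  assumes D: "open D" and f: "\<And>n. f n \<in> holo D"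
    and bdd: "\<And>C. compact C \<Longrightarrow> C \<subseteq> D \<Longrightarrow> \<exists>B. \<forall>n. \<forall>z\<in>C. cmod (f n z) \<le> B"
  obtains g r where "g \<in> holo D" "strict_mono (r :: nat \<Rightarrow> nat)"
    "\<And>C. compact C \<Longrightarrow> C \<subseteq> D \<Longrightarrow> uniform_limit C (\<lambda>n. f (r n)) g sequentially"
proof -
  obtain K where comK: "\<And>n. compact (K n)" and KS: "\<And>n::nat. K n \<subseteq> D"
    and subK: "\<And>X. compact X \<Longrightarrow> X \<subseteq> D \<Longrightarrow> \<exists>N. \<forall>n\<ge>N. X \<subseteq> K n"
    using open_Union_compact_subsets [OF D] by metis
  define P where "P i s \<longleftrightarrow> (\<exists>g. uniform_limit (K i) (\<lambda>n. f (s n)) g sequentially)" for i and s :: "nat \<Rightarrow> nat"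
  obtain k :: "nat \<Rightarrow> nat" where k: "strict_mono k" "\<And>i. P i (id \<circ> k)"
  proof (rule subsequence_diagonalization_lemma [where r=id and P=P])
    fix i and s :: "nat \<Rightarrow> nat"
    obtain B where B: "\<And>n z. z \<in> K i \<Longrightarrow> cmod (f n z) \<le> B" using bdd[OF comK KS] by blast
    obtain g q where g: "strict_mono (q :: nat \<Rightarrow> nat)"
      "\<And>e. 0 < e \<Longrightarrow> \<exists>N. \<forall>n x. n \<ge> N \<and> x \<in> K i \<longrightarrow> norm (f (s (q n)) x - g x) < e"
    proof (rule Arzela_Ascoli[of "K i" "\<lambda>n. f (s n)" B])
      fix z and e :: real assume z: "z \<in> K i" and e: "0 < e"
      obtain r where r: "0 < r" "cball z r \<subseteq> D"
        using z KS[of i] D by (meson open_contains_cball subsetD)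
      obtain M where M: "\<And>n w. w \<in> cball z r \<Longrightarrow> cmod (f n w) \<le> M"
        using bdd[OF compact_cball r(2)] by blast
      have M0: "0 \<le> M" using M[of z undefined] r by (meson centre_in_cball less_imp_le norm_ge_zero order_trans)
      \<comment> \<open>Equicontinuity from the Lipschitz constant 18 M / r; the added 1 makes the
        divisor positive also for M = 0.\<close>
      define d where "d = min (r / 2) (e / (18 * M / r + 1))"
      have pos: "0 < 18 * M / r + 1" using M0 r by (intro add_nonneg_pos) auto
      have d: "0 < d" using r e pos by (simp add: d_def)
      have "norm (f (s n) z - f (s n) y) < e" if y: "norm (z - y) < d" for n y
      proof -
        have "cmod (f (s n) (z + (y - z)) - f (s n) z) \<le> 18 * M / r * norm (y - z)"
          by (rule holo_lipschitz_at[OF holo_subset[OF f] r(1)])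
             (use r M y in \<open>auto simp: d_def norm_minus_commute\<close>)
        also have "\<dots> \<le> (18 * M / r + 1) * norm (y - z)"
          by (intro mult_right_mono) auto
        also have "\<dots> < (18 * M / r + 1) * (e / (18 * M / r + 1))"
          using y pos by (intro mult_strict_left_mono) (auto simp: d_def norm_minus_commute)
        also have "\<dots> = e" using pos by simp
        finally show ?thesis by (simp add: norm_minus_commute)
      qed
      then show "\<exists>d>0. \<forall>n y. y \<in> K i \<and> norm (z - y) < d \<longrightarrow> norm (f (s n) z - f (s n) y) < e"
        using d by blast
    qed (use comK B in auto)
    then have "uniform_limit (K i) (\<lambda>n. f (s (q n))) g sequentially"
      unfolding uniform_limit_iff eventually_sequentially dist_norm by blast
    then show "\<exists>q. strict_mono q \<and> P i (s \<circ> q)"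
      using g(1) unfolding P_def by auto
  next
    \<comment> \<open>The diagonal argument needs convergence on K i to survive when, from N on,
      each value of k2 is a value of k1 at an index at least as large.\<close>
    fix i N and s k1 k2 :: "nat \<Rightarrow> nat"
    assume 1: "P i (s \<circ> k1)" and 2: "\<And>j. N \<le> j \<Longrightarrow> \<exists>j'\<ge>j. k2 j = k1 j'"
    obtain g where g: "uniform_limit (K i) (\<lambda>n. f (s (k1 n))) g sequentially"
      using 1 by (auto simp: P_def)
    have "uniform_limit (K i) (\<lambda>n. f (s (k2 n))) g sequentially"
      unfolding uniform_limit_iff eventually_sequentially
    proof (intro allI impI)
      fix e :: real assume "0 < e"
      then obtain N' where N': "\<And>n x. n \<ge> N' \<Longrightarrow> x \<in> K i \<Longrightarrow> dist (f (s (k1 n)) x) (g x) < e"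
        using g unfolding uniform_limit_iff eventually_sequentially by blast
      have "\<forall>x\<in>K i. dist (f (s (k2 n)) x) (g x) < e" if "n \<ge> max N N'" for n
        using 2[of n] N' that by fastforce
      then show "\<exists>N. \<forall>n\<ge>N. \<forall>x\<in>K i. dist (f (s (k2 n)) x) (g x) < e" by blast
    qed
    then show "P i (s \<circ> k2)" unfolding P_def by auto
  qed blast
  then obtain G where G: "\<And>i. uniform_limit (K i) (\<lambda>n. f (k n)) (G i) sequentially"
    unfolding P_def by simp metis
  \<comment> \<open>Glues the limits G i on the sets of the exhaustion: each of them is the
    pointwise limit on its own set.\<close>
  define g where "g z = lim (\<lambda>n. f (k n) z)" for z
  have lim: "uniform_limit C (\<lambda>n. f (k n)) g sequentially" if C: "compact C" "C \<subseteq> D" for C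
  proof -
    obtain i where i: "C \<subseteq> K i" using subK[OF C] by blast
    then have u: "uniform_limit C (\<lambda>n. f (k n)) (G i) sequentially"
      using G uniform_limit_on_subset by blast
    moreover have "g z = G i z" if "z \<in> C" for z
      using tendsto_uniform_limitI[OF u that] by (simp add: g_def limI)
    ultimately show ?thesis by (simp cong: uniform_limit_cong')
  qed
  have "g \<in> holo D"
  proof (rule holo_limit[of D "\<lambda>n. f (k n)"])
    fix z assume "z \<in> D"
    then obtain r where r: "0 < r" "cball z r \<subseteq> D" using D open_contains_cball by blast
    then have sub: "ball z r \<subseteq> cball z r" "ball z r \<subseteq> D" by auto
    obtain M where "\<And>n w. w \<in> cball z r \<Longrightarrow> cmod (f n w) \<le> M"
      using bdd[OF compact_cball r(2)] by blast
    then show "\<exists>r>0. \<exists>B. (\<forall>n. f (k n) \<in> holo (ball z r)) \<and>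
      (\<forall>n. \<forall>w\<in>ball z r. cmod (f (k n) w) \<le> B) \<and>
      uniform_limit (ball z r) (\<lambda>n. f (k n)) g sequentially"
      using r sub holo_subset[OF f sub(2)] uniform_limit_on_subset[OF lim[OF compact_cball r(2)] sub(1)]
      by blast
  qed
  with k(1) lim show ?thesis using that by blast
qed

subsection \<open>Square-integrable holomorphic functions\<close>

text \<open>Both measures are translation invariant and agree on balls about the origin; a Fubini argument
  as in the uniqueness of Haar measure then shows that they coincide.\<close>

lemma lborel_distr_isometry:
  fixes T S :: "'a::euclidean_space \<Rightarrow> 'a"
  assumes T: "linear T" "\<And>x. norm (T x) = norm x" and S: "\<And>x. T (S x) = x"
  shows "distr lborel borel T = lborel"
proof (rule measure_eqI)
  show "sets (distr lborel borel T) = sets lborel" by simp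
  fix A :: "'a set" assume "A \<in> sets (distr lborel borel T)"
  then have A[measurable]: "A \<in> sets borel" by simp
  have [measurable]: "T \<in> borel_measurable borel"
    using T(1) by (intro borel_measurable_continuous_onI linear_continuous_on) (simp add: linear_conv_bounded_linear)
  have tr: "(\<integral>\<^sup>+x. g (x + c) \<partial>lborel) = (\<integral>\<^sup>+x. g x \<partial>lborel)"
    if [measurable]: "g \<in> borel_measurable borel" for g :: "'a \<Rightarrow> ennreal" and c
    by (subst (2) lborel_distr_plus[of c, symmetric]) (simp add: nn_integral_distr add.commute)
  define c where "c = emeasure lborel (ball (0::'a) 1)"
  define B where "B = ball (0::'a) 1"
  have [measurable]: "B \<in> sets borel" by (simp add: B_def)
  have c: "emeasure lborel (ball x 1) = c" for x :: 'a
    by (simp add: c_def emeasure_ball)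
  have c0: "c \<noteq> 0" "c \<noteq> \<infinity>"
    using unit_ball_vol_pos[of "real DIM('a)"] by (simp_all add: c_def emeasure_ball less_le)
  have "c * emeasure lborel A = (\<integral>\<^sup>+y. indicator B y * (\<integral>\<^sup>+x. indicator A x \<partial>lborel) \<partial>lborel)"
    by (subst nn_integral_multc) (auto simp: c_def B_def[symmetric])
  also have "\<dots> = (\<integral>\<^sup>+y. indicator B y * (\<integral>\<^sup>+x. indicator A (x + T y) \<partial>lborel) \<partial>lborel)"
    by (subst tr[of "indicator A"]) auto
  also have "\<dots> = (\<integral>\<^sup>+y. (\<integral>\<^sup>+x. indicator B y * indicator A (x + T y) \<partial>lborel) \<partial>lborel)"
    by (simp add: nn_integral_cmult)
  also have "\<dots> = (\<integral>\<^sup>+x. (\<integral>\<^sup>+y. indicator B y * indicator A (x + T y) \<partial>lborel) \<partial>lborel)"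
    by (rule lborel_pair.Fubini') measurable
  also have "\<dots> = (\<integral>\<^sup>+x. (\<integral>\<^sup>+y. indicator B (y - S x) * indicator A (T y) \<partial>lborel) \<partial>lborel)"
  proof (rule nn_integral_cong)
    fix x
    show "(\<integral>\<^sup>+y. indicator B y * indicator A (x + T y) \<partial>lborel) =
        (\<integral>\<^sup>+y. indicator B (y - S x) * indicator A (T y) \<partial>lborel :: ennreal)"
      using tr[of "\<lambda>y. indicator B (y - S x) * indicator A (T y)" "S x"]
      by (simp add: linear_add[OF T(1)] S add.commute)
  qed
  also have "\<dots> = (\<integral>\<^sup>+x. (\<integral>\<^sup>+y. indicator (ball (T y) 1) x * indicator A (T y) \<partial>lborel) \<partial>lborel)"
  proof -
    \<comment> \<open>T (y - S x) = T y - x: the ball about the origin becomes, as a condition on x,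
      the unit ball about T y, which again has measure c. What is left of the double integral is c
      times the measure of the preimage of A.\<close>
    have "norm (y - S x) = norm (T y - x)" for x y
      by (metis S T linear_diff)
    then have "indicator B (y - S x) = (indicator (ball (T y) 1) x :: ennreal)" for x y
      by (simp add: B_def indicator_def dist_norm norm_minus_commute[of "S x" y])
    then show ?thesis by simp
  qed
  also have "\<dots> = (\<integral>\<^sup>+y. (\<integral>\<^sup>+x. indicator (ball (T y) 1) x * indicator A (T y) \<partial>lborel) \<partial>lborel)"
  proof (rule lborel_pair.Fubini')
    have "(\<lambda>(y, x). indicator {..<1} (dist (T y) x) * indicator A (T y) :: ennreal) \<in> borel_measurable (lborel \<Otimes>\<^sub>M lborel)"
      by measurable
    then show "(\<lambda>(y, x). indicator (ball (T y) 1) x * indicator A (T y) :: ennreal) \<in> borel_measurable (lborel \<Otimes>\<^sub>M lborel)"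
      by (simp add: indicator_def)
  qed
  also have "\<dots> = (\<integral>\<^sup>+y. c * indicator A (T y) \<partial>lborel)"
  proof (rule nn_integral_cong)
    fix y
    have "(indicator (ball (T y) 1) :: 'a \<Rightarrow> ennreal) \<in> borel_measurable lborel"
      by (rule borel_measurable_indicator) simp
    then show "(\<integral>\<^sup>+x. indicator (ball (T y) 1) x * indicator A (T y) \<partial>lborel) = c * indicator A (T y)"
      by (subst nn_integral_multc) (simp_all add: c)
  qed
  also have "\<dots> = c * (\<integral>\<^sup>+y. indicator A (T y) \<partial>lborel)"
    by (simp add: nn_integral_cmult)
  also have "(\<integral>\<^sup>+y. indicator A (T y) \<partial>lborel) = (\<integral>\<^sup>+y. indicator A y \<partial>distr lborel borel T)"
    by (subst nn_integral_distr) auto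
  also have "\<dots> = emeasure (distr lborel borel T) A"
    by simp
  finally show "emeasure (distr lborel borel T) A = emeasure lborel A"
    using c0 by (simp add: ennreal_mult_cancel_left)
qed

section \<open>Mean values over circles and balls\<close>

lemma mean_value_circle:
  assumes f: "f \<in> holo U" and U: "cball z r \<subseteq> U" and v: "norm v \<le> r"
  shows "((\<lambda>t. f (z + exp (2 * of_real pi * \<i> * of_real t) *s v)) has_integral f z) {0..1}"
proof -
  \<comment> \<open>The radius is carried by v and Cauchy's formula is used on the unit circle, so
    every point w of a ball about 0, the centre included, can serve as v.\<close>
  define h where "h \<zeta> = f (z + \<zeta> *s v)" for \<zeta>
  have h: "(h has_field_derivative grad_app f (z + \<zeta> *s v) v) (at \<zeta>)" if "cmod \<zeta> \<le> 1" for \<zeta>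
  proof -
    have "cmod \<zeta> * norm v \<le> 1 * r" using that v by (intro mult_mono) auto
    then have "z + \<zeta> *s v \<in> U" using U by (auto simp: dist_norm norm_smult_vec)
    then show ?thesis unfolding h_def by (rule holo_slice[OF f])
  qed
  have "h holomorphic_on cball 0 1"
    unfolding holomorphic_on_def field_differentiable_def
    using h has_field_derivative_at_within by (metis mem_cball_0)
  then have "((\<lambda>u. h u / (u - 0)) has_contour_integral (2 * of_real pi * \<i> * h 0)) (circlepath 0 1)"
    by (rule Cauchy_integral_circlepath_simple) auto
  then have "((\<lambda>t. h (circlepath 0 1 t) / (circlepath 0 1 t - 0) *
      vector_derivative (circlepath 0 1) (at t within {0..1})) has_integral (2 * of_real pi * \<i> * h 0)) {0..1}"
    by (simp add: has_contour_integral_def)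
  then have "((\<lambda>t. 2 * of_real pi * \<i> * h (exp (2 * of_real pi * \<i> * of_real t))) has_integral
      (2 * of_real pi * \<i> * h 0)) {0..1}"
  proof (rule has_integral_eq[rotated])
    fix t :: real assume t: "t \<in> {0..1}"
    have vd: "vector_derivative (circlepath 0 1) (at t within {0..1}) =
        2 * of_real pi * \<i> * exp (2 * of_real pi * \<i> * of_real t)"
      using vector_derivative_circlepath01[of t 0 1] t by simp
    show "h (circlepath 0 1 t) / (circlepath 0 1 t - 0) *
        vector_derivative (circlepath 0 1) (at t within {0..1}) =
        2 * of_real pi * \<i> * h (exp (2 * of_real pi * \<i> * of_real t))"
      unfolding vd by (simp add: circlepath)
  qed
  from has_integral_mult_right[OF this, of "1 / (2 * of_real pi * \<i>)"]
  show ?thesis by (simp add: h_def)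
qed

text \<open>Average over the rotations w \<mapsto> \<open>e t *s w\<close>, which preserve Lebesgue
  measure, and apply Fubini to G. Integrating over t first gives f z at each w by the mean value on
  circles; integrating over w first gives J for each t.\<close>

lemma mean_value_ball:
  fixes f :: "complex ^ 'n \<Rightarrow> complex"
  assumes f: "f \<in> holo U" and U: "cball z r \<subseteq> U"
  shows "f z * of_real (measure lborel (cball z r)) = (LINT w:cball z r|lborel. f w)"
proof -
  define e where "e t = exp (2 * of_real pi * \<i> * of_real t)" for t :: real
  have ne: "cmod (e t) = 1" for t by (simp add: e_def)
  define G where "G t w = indicator ({0..1} \<times> cball 0 r) (t, w) *\<^sub>R f (z + e t *s w)" for t :: real and w :: "complex ^ 'n"
  define J where "J = (\<integral>w. indicator (cball 0 r) w *\<^sub>R f (z + w) \<partial>lborel)"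
  have fc: "continuous_on U f" by (rule holo_continuous_on[OF f])
  have "continuous_on ({0..1::real} \<times> cball 0 r) (\<lambda>p. f (z + e (fst p) *s snd p))"
  proof (rule continuous_on_compose2[OF fc])
    have "continuous_on X (\<lambda>p. \<chi> k. z $ k + e (fst p) * snd p $ k)" for X :: "(real \<times> (complex ^ 'n)) set"
      unfolding e_def by (intro continuous_intros)
    moreover have eq: "(\<lambda>p. z + e (fst p) *s snd p) = (\<lambda>p. \<chi> k. z $ k + e (fst p) * snd p $ k)"
      by (auto simp: vec_eq_iff)
    ultimately show "continuous_on ({0..1} \<times> cball 0 r) (\<lambda>p. z + e (fst p) *s snd p)"
      unfolding eq by blast
    show "(\<lambda>p. z + e (fst p) *s snd p) ` ({0..1} \<times> cball 0 r) \<subseteq> U"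
      using U by (auto simp: dist_norm norm_smult_vec ne)
  qed
  then have "integrable lborel (\<lambda>p. indicator ({0..1} \<times> cball 0 r) p *\<^sub>R f (z + e (fst p) *s snd p))"
    by (intro borel_integrable_compact compact_Times compact_Icc compact_cball)
  then have "integrable (lborel \<Otimes>\<^sub>M lborel) (case_prod G)"
    by (simp add: G_def[abs_def] lborel_prod split_beta')
  then have "(\<integral>w. (\<integral>t. G t w \<partial>lborel) \<partial>lborel) = (\<integral>t. (\<integral>w. G t w \<partial>lborel) \<partial>lborel)"
    by (rule lborel_pair.Fubini_integral)
  moreover have "(\<integral>t. G t w \<partial>lborel) = indicator (cball 0 r) w *\<^sub>R f z" for w
  proof (cases "w \<in> cball 0 r")
    case True
    then have w: "norm w \<le> r" by simp
    have "continuous_on {0..1} (\<lambda>t. f (z + e t *s w))"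
    proof (rule continuous_on_compose2[OF fc])
      have "continuous_on {0..1} (\<lambda>t. \<chi> k. z $ k + e t * w $ k)"
        unfolding e_def by (intro continuous_intros)
      moreover have eq: "(\<lambda>t. z + e t *s w) = (\<lambda>t. \<chi> k. z $ k + e t * w $ k)"
        by (auto simp: vec_eq_iff)
      ultimately show "continuous_on {0..1} (\<lambda>t. z + e t *s w)" unfolding eq by blast
      show "(\<lambda>t. z + e t *s w) ` {0..1} \<subseteq> U"
        using U w by (auto simp: dist_norm norm_smult_vec ne)
    qed
    then have "set_integrable lborel {0..1} (\<lambda>t. f (z + e t *s w))"
      unfolding set_integrable_def by (intro borel_integrable_compact compact_Icc)
    then have "(LINT t:{0..1}|lborel. f (z + e t *s w)) = integral {0..1} (\<lambda>t. f (z + e t *s w))"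
      by (rule set_borel_integral_eq_integral(2))
    also have "\<dots> = f z"
      unfolding e_def by (rule integral_unique[OF mean_value_circle[OF f U w]])
    finally show ?thesis using True
      by (simp add: G_def set_lebesgue_integral_def indicator_times)
  qed (simp add: G_def indicator_times)
  moreover have "(\<integral>w. G t w \<partial>lborel) = indicator {0..1} t *\<^sub>R J" for t
  proof -
    have rot: "distr lborel borel (\<lambda>w. e t *s w) = (lborel :: (complex ^ 'n) measure)"
    proof (rule lborel_distr_isometry)
      show "linear (\<lambda>w. e t *s w)" using bounded_linear_smult_vec_right bounded_linear.linear by blast
      show "e t *s (inverse (e t) *s x) = x" for x
        by (simp add: vec_eq_iff e_def)
    qed (simp add: norm_smult_vec ne)
    have rm: "(\<lambda>w. e t *s w) \<in> borel_measurable (lborel :: (complex ^ 'n) measure)"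
      using borel_measurable_continuous_onI[OF linear_continuous_on[OF bounded_linear_smult_vec_right]] by simp
    have "continuous_on (cball 0 r) (\<lambda>w. f (z + w))"
      by (intro continuous_on_compose2[OF fc] continuous_intros) (use U in \<open>auto simp: dist_norm\<close>)
    then have hm: "(\<lambda>w. indicator (cball 0 r) w *\<^sub>R f (z + w)) \<in> borel_measurable borel"
      by (intro borel_measurable_continuous_on_indicator) auto
    have "J = (\<integral>w. indicator (cball 0 r) (e t *s w) *\<^sub>R f (z + e t *s w) \<partial>lborel)"
      using integral_distr[OF rm hm] unfolding rot J_def .
    also have "\<dots> = (\<integral>w. indicator (cball 0 r) w *\<^sub>R f (z + e t *s w) \<partial>lborel)"
      by (intro Bochner_Integration.integral_cong) (auto simp: indicator_def norm_smult_vec ne)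
    finally have J: "(\<integral>w. indicator (cball 0 r) w *\<^sub>R f (z + e t *s w) \<partial>lborel) = J" ..
    show ?thesis
      by (simp add: G_def indicator_times J flip: scaleR_scaleR)
  qed
  ultimately have "(\<integral>w. indicator (cball 0 r) w *\<^sub>R f z \<partial>(lborel :: (complex ^ 'n) measure)) =
      (\<integral>t. indicator {0..1::real} t *\<^sub>R J \<partial>lborel)"
    by simp
  then have *: "of_real (measure lborel (cball (0 :: complex ^ 'n) r)) * f z = J"
    by (simp add: scaleR_conv_of_real)
  have "continuous_on (cball z r) f" by (rule continuous_on_subset[OF fc U])
  then have hm: "(\<lambda>w. indicator (cball z r) w *\<^sub>R f w) \<in> borel_measurable borel"
    by (intro borel_measurable_continuous_on_indicator) auto
  have pm: "(+) z \<in> borel_measurable lborel" by simp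
  have "(LINT w:cball z r|lborel. f w) = (\<integral>w. indicator (cball z r) (z + w) *\<^sub>R f (z + w) \<partial>lborel)"
    using integral_distr[OF pm hm] unfolding lborel_distr_plus set_lebesgue_integral_def .
  also have "\<dots> = J"
    by (simp add: J_def indicator_def dist_norm)
  finally show ?thesis
    \<comment> \<open>A ball of negative radius is empty and both sides are 0; otherwise its volume
      does not depend on the centre.\<close>
    using * by (cases "0 \<le> r") (simp_all add: mult.commute measure_def emeasure_cball)
qed

text \<open>The mean value property is applied to the holomorphic function f^2, whose modulus is the
  integrand on the right.\<close>

lemma holo_power2_le_integral:
  fixes f :: "complex ^ 'n \<Rightarrow> complex"
  assumes f: "f \<in> holo D" and D: "cball z r \<subseteq> D" "open D"
    and int: "set_integrable lborel D (\<lambda>z. (cmod (f z))\<^sup>2)"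
  shows "measure lborel (cball z r) * (cmod (f z))\<^sup>2 \<le> (LINT w:D|lborel. (cmod (f w))\<^sup>2)"
proof -
  have f2: "(\<lambda>w. f w * f w) \<in> holo D" by (intro holo_mult f)
  have "measure lborel (cball z r) * (cmod (f z))\<^sup>2 = cmod (LINT w:cball z r|lborel. f w * f w)"
    by (subst mean_value_ball[OF f2 D(1), symmetric]) (simp add: norm_mult power2_eq_square mult.commute)
  also have "\<dots> \<le> (LINT w:cball z r|lborel. cmod (f w * f w))"
    unfolding set_lebesgue_integral_def
    by (rule order_trans[OF integral_norm_bound]) (simp add: norm_mult)
  also have "\<dots> = (LINT w:cball z r|lborel. (cmod (f w))\<^sup>2)"
    by (simp add: norm_mult power2_eq_square)
  also have "\<dots> \<le> (LINT w:D|lborel. (cmod (f w))\<^sup>2)"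
    unfolding set_lebesgue_integral_def
  proof (rule integral_mono)
    show "integrable lborel (\<lambda>w. indicator (cball z r) w *\<^sub>R (cmod (f w))\<^sup>2)"
      using set_integrable_subset[OF int _ D(1)] by (simp add: set_integrable_def)
  qed (use int D(1) in \<open>auto simp: set_integrable_def indicator_def\<close>)
  finally show ?thesis .
qed

section \<open>The Bergman space and its norm\<close>

definition ip :: "(complex ^ 'n) set \<Rightarrow> (complex ^ 'n \<Rightarrow> complex) \<Rightarrow> (complex ^ 'n \<Rightarrow> complex) \<Rightarrow> complex" where
  "ip D f g = (LINT z:D|lborel. f z * cnj (g z))"

definition norm2 :: "(complex ^ 'n) set \<Rightarrow> (complex ^ 'n \<Rightarrow> complex) \<Rightarrow> real" where
  "norm2 D f = (LINT z:D|lborel. (cmod (f z))\<^sup>2)"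

lemma norm2_nonneg: "0 \<le> norm2 D f"
  unfolding norm2_def set_lebesgue_integral_def by (rule Bochner_Integration.integral_nonneg) simp

lemma bergman_spaceD:
  assumes "f \<in> bergman_space D"
  shows "f \<in> holo D" "set_integrable lborel D (\<lambda>z. (cmod (f z))\<^sup>2)"
  using assms by (auto simp: bergman_space_def)

lemma set_borel_measurable_continuous_open:
  "open D \<Longrightarrow> continuous_on D f \<Longrightarrow> set_borel_measurable lborel D (f :: _ \<Rightarrow> _::real_normed_vector)"
  unfolding set_borel_measurable_def using borel_measurable_continuous_on_indicator[of D f] by simp

context
  fixes D :: "(complex ^ 'n) set"
  assumes opn: "open D" and bdd: "bounded D"
begin

lemma bounded_holo_mult_bergman:
  assumes g: "g \<in> bergman_space D" and f: "f \<in> holo D" "\<And>z. z \<in> D \<Longrightarrow> cmod (f z) \<le> M"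
  shows "(\<lambda>z. f z * g z) \<in> bergman_space D" "norm2 D (\<lambda>z. f z * g z) \<le> M\<^sup>2 * norm2 D g"
proof -
  have h: "(\<lambda>z. f z * g z) \<in> holo D" using f g by (auto dest: bergman_spaceD)
  have le: "(cmod (f z * g z))\<^sup>2 \<le> M\<^sup>2 * (cmod (g z))\<^sup>2" if "z \<in> D" for z
    using f(2)[OF that] by (auto simp: norm_mult power_mult_distrib intro!: mult_right_mono power_mono)
  have i: "set_integrable lborel D (\<lambda>z. M\<^sup>2 * (cmod (g z))\<^sup>2)"
    using bergman_spaceD(2)[OF g] by simp
  then have i': "set_integrable lborel D (\<lambda>z. (cmod (f z * g z))\<^sup>2)"
  proof (rule set_integrable_bound)
    show "set_borel_measurable lborel D (\<lambda>z. (cmod (f z * g z))\<^sup>2)"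
      by (intro set_borel_measurable_continuous_open opn continuous_intros holo_continuous_on f
          bergman_spaceD(1)[OF g])
    show "AE z in lborel. z \<in> D \<longrightarrow> norm ((cmod (f z * g z))\<^sup>2) \<le> norm (M\<^sup>2 * (cmod (g z))\<^sup>2)"
      using le by auto
  qed
  with h show "(\<lambda>z. f z * g z) \<in> bergman_space D" by (simp add: bergman_space_def)
  have "norm2 D (\<lambda>z. f z * g z) \<le> (LINT z:D|lborel. M\<^sup>2 * (cmod (g z))\<^sup>2)"
    unfolding norm2_def by (rule set_integral_mono[OF i' i le])
  then show "norm2 D (\<lambda>z. f z * g z) \<le> M\<^sup>2 * norm2 D g" by (simp add: norm2_def)
qed

text \<open>A bounded D has finite volume. The constant 1 makes the minimum problem in
  \<open>bergman_representer\<close> nonempty and forces the kernel to be positive on the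
  diagonal.\<close>

lemma bergman_const: "(\<lambda>_. c) \<in> bergman_space D"
proof -
  have "D \<in> lmeasurable" using opn bdd by (simp add: lmeasurable_open)
  then have "emeasure lborel D < \<infinity>" using opn by (simp add: fmeasurable_def emeasure_completion)
  then have "set_integrable lborel D (\<lambda>_. (cmod c)\<^sup>2)"
    using opn by (simp add: set_integrable_def)
  then show ?thesis by (auto simp: bergman_space_def)
qed

lemma bergman_cmult: "f \<in> bergman_space D \<Longrightarrow> (\<lambda>z. c * f z) \<in> bergman_space D"
  by (rule bounded_holo_mult_bergman[where M="cmod c"]) auto

lemma bergman_add:
  assumes f: "f \<in> bergman_space D" and g: "g \<in> bergman_space D"
  shows "(\<lambda>z. f z + g z) \<in> bergman_space D"
proof -
  have "set_integrable lborel D (\<lambda>z. 2 * (cmod (f z))\<^sup>2 + 2 * (cmod (g z))\<^sup>2)"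
    using bergman_spaceD(2)[OF f] bergman_spaceD(2)[OF g] by (intro set_integral_add) auto
  then have "set_integrable lborel D (\<lambda>z. (cmod (f z + g z))\<^sup>2)"
  proof (rule set_integrable_bound)
    show "set_borel_measurable lborel D (\<lambda>z. (cmod (f z + g z))\<^sup>2)"
      by (intro set_borel_measurable_continuous_open opn continuous_intros holo_continuous_on
          bergman_spaceD(1) f g)
    have "(cmod (a + b))\<^sup>2 \<le> 2 * (cmod a)\<^sup>2 + 2 * (cmod b)\<^sup>2" for a b
    proof -
      have "(cmod (a + b))\<^sup>2 \<le> (cmod a + cmod b)\<^sup>2" by (intro power_mono norm_triangle_ineq) auto
      also have "\<dots> \<le> 2 * (cmod a)\<^sup>2 + 2 * (cmod b)\<^sup>2"
        using zero_le_power2[of "cmod a - cmod b"] by (simp add: power2_eq_square algebra_simps)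
      finally show ?thesis .
    qed
    then show "AE z in lborel. z \<in> D \<longrightarrow> norm ((cmod (f z + g z))\<^sup>2) \<le>
        norm (2 * (cmod (f z))\<^sup>2 + 2 * (cmod (g z))\<^sup>2)"
      by (intro AE_I2 impI) simp
  qed
  then show ?thesis using f g by (auto simp: bergman_space_def)
qed

lemma ip_integrable:
  assumes f: "f \<in> bergman_space D" and g: "g \<in> bergman_space D"
  shows "set_integrable lborel D (\<lambda>z. f z * cnj (g z))"
proof -
  have "set_integrable lborel D (\<lambda>z. (cmod (f z))\<^sup>2 + (cmod (g z))\<^sup>2)"
    using bergman_spaceD(2)[OF f] bergman_spaceD(2)[OF g] by (intro set_integral_add) auto
  then show ?thesis
  proof (rule set_integrable_bound)
    show "set_borel_measurable lborel D (\<lambda>z. f z * cnj (g z))"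
      by (intro set_borel_measurable_continuous_open opn continuous_intros holo_continuous_on
          bergman_spaceD(1) f g)
    have "x * y \<le> x\<^sup>2 + y\<^sup>2" if "0 \<le> x" "0 \<le> y" for x y :: real
      using sum_squares_bound[of x y] mult_nonneg_nonneg[OF that] by linarith
    then show "AE z in lborel. z \<in> D \<longrightarrow> norm (f z * cnj (g z)) \<le> norm ((cmod (f z))\<^sup>2 + (cmod (g z))\<^sup>2)"
      by (intro AE_I2 impI) (simp add: norm_mult)
  qed
qed

lemma ip_add:
  "f \<in> bergman_space D \<Longrightarrow> g \<in> bergman_space D \<Longrightarrow> h \<in> bergman_space D \<Longrightarrow>
    ip D (\<lambda>z. f z + g z) h = ip D f h + ip D g h"
  unfolding ip_def by (simp add: ring_distribs set_integral_add ip_integrable)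

lemma ip_cmult: "ip D (\<lambda>z. c * f z) g = c * ip D f g"
  by (simp add: ip_def mult.assoc)

lemma ip_cnj: "ip D g f = cnj (ip D f g)"
proof -
  have "ip D g f = (\<integral>z. cnj (indicator D z *\<^sub>R (f z * cnj (g z))) \<partial>lborel)"
    by (simp add: ip_def set_lebesgue_integral_def mult.commute)
  also have "\<dots> = cnj (ip D f g)"
    unfolding ip_def set_lebesgue_integral_def by (rule Bochner_Integration.integral_cnj)
  finally show ?thesis .
qed

lemma ip_self: "ip D f f = of_real (norm2 D f)"
proof -
  have "ip D f f = (\<integral>z. of_real (indicator D z * (cmod (f z))\<^sup>2) \<partial>lborel)"
    unfolding ip_def set_lebesgue_integral_def
    unfolding of_real_mult complex_norm_square by (simp only: scaleR_conv_of_real)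
  then show ?thesis
    unfolding integral_complex_of_real norm2_def set_lebesgue_integral_def real_scaleR_def .
qed

lemma norm2_add_cmult:
  assumes f: "f \<in> bergman_space D" and g: "g \<in> bergman_space D"
  shows "norm2 D (\<lambda>z. f z + c * g z) = norm2 D f + 2 * Re (cnj c * ip D f g) + (cmod c)\<^sup>2 * norm2 D g"
proof -
  let ?cg = "\<lambda>z. c * g z"
  have cg: "?cg \<in> bergman_space D" by (rule bergman_cmult[OF g])
  have fcg: "(\<lambda>z. f z + ?cg z) \<in> bergman_space D" by (rule bergman_add[OF f cg])
  have "ip D (\<lambda>z. f z + ?cg z) (\<lambda>z. f z + ?cg z) =
      ip D f (\<lambda>z. f z + ?cg z) + ip D ?cg (\<lambda>z. f z + ?cg z)"
    by (rule ip_add[OF f cg fcg])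
  also have "ip D f (\<lambda>z. f z + ?cg z) = cnj (ip D f f + c * ip D g f)"
    by (subst ip_cnj, subst ip_add[OF f cg f], subst ip_cmult) simp
  also have "ip D ?cg (\<lambda>z. f z + ?cg z) = cnj (ip D f ?cg + ip D ?cg ?cg)"
    by (subst ip_cnj, subst ip_add[OF f cg cg]) simp
  also have "ip D f ?cg = cnj (c * ip D g f)"
    by (subst ip_cnj, subst ip_cmult) simp
  also have "ip D ?cg ?cg = c * cnj (c * ip D g g)"
    by (subst ip_cmult, subst ip_cnj, subst ip_cmult) simp
  also have "ip D g f = cnj (ip D f g)" by (rule ip_cnj)
  finally have "of_real (norm2 D (\<lambda>z. f z + c * g z)) =
      cnj (of_real (norm2 D f) + c * cnj (ip D f g)) +
      cnj (cnj (c * cnj (ip D f g)) + c * cnj (c * of_real (norm2 D g)))"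
    by (simp add: ip_self)
  then have "Re (of_real (norm2 D (\<lambda>z. f z + c * g z))) = Re (
      cnj (of_real (norm2 D f) + c * cnj (ip D f g)) +
      cnj (cnj (c * cnj (ip D f g)) + c * cnj (c * of_real (norm2 D g))))"
    by (rule arg_cong)
  then show ?thesis
    by (simp add: cmod_power2) (simp add: power2_eq_square algebra_simps)
qed

text \<open>B is the inverse volume of a ball whose radius fits into D at all points of C. These
  bounds are what makes norm bounded sequences normal.\<close>

lemma bergman_eval_bound:
  assumes C: "compact C" "C \<subseteq> D"
  obtains B where "0 < B" "\<And>f z. f \<in> bergman_space D \<Longrightarrow> z \<in> C \<Longrightarrow> (cmod (f z))\<^sup>2 \<le> B * norm2 D f"
proof -
  obtain r C' where r: "0 < r" "C' \<subseteq> D" "\<And>z. z \<in> C \<Longrightarrow> cball z r \<subseteq> C'"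
    using compact_thickening[OF C opn] by metis
  define V where "V = measure lborel (cball (0 :: complex ^ 'n) r)"
  have V: "V = measure lborel (cball z r)" for z :: "complex ^ 'n"
    using r(1) by (simp add: V_def measure_def emeasure_cball)
  have V0: "0 < V"
    using r(1) by (auto simp: V_def measure_def emeasure_cball)
  show ?thesis
  proof
    fix f z assume f: "f \<in> bergman_space D" and z: "z \<in> C"
    have "V * (cmod (f z))\<^sup>2 \<le> norm2 D f"
      unfolding V[of z] norm2_def
      by (rule holo_power2_le_integral) (use f r z opn in \<open>auto dest: bergman_spaceD\<close>)
    then show "(cmod (f z))\<^sup>2 \<le> 1 / V * norm2 D f" using V0 by (simp add: field_simps)
  qed (use V0 in simp)
qed

text \<open>Lower semicontinuity of the norm under pointwise convergence. It keeps the locally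
  uniform limit of a minimising sequence in the space and minimal.\<close>

lemma norm2_Fatou:
  assumes f: "\<And>n. f n \<in> bergman_space D" and g: "g \<in> holo D"
    and lim: "\<And>z. z \<in> D \<Longrightarrow> (\<lambda>n. f n z) \<longlonglongrightarrow> g z"
    and m: "(\<lambda>n. norm2 D (f n)) \<longlonglongrightarrow> m"
  shows "g \<in> bergman_space D" "norm2 D g \<le> m"
proof -
  define u where "u h z = indicator D z * (cmod (h z))\<^sup>2" for h :: "complex ^ 'n \<Rightarrow> complex" and z
  have mu: "u h \<in> borel_measurable lborel" if "h \<in> holo D" for h
    using set_borel_measurable_continuous_open[OF opn, of "\<lambda>z. (cmod (h z))\<^sup>2"] holo_continuous_on[OF that]
    by (simp add: u_def[abs_def] set_borel_measurable_def continuous_intros)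
  have N: "(\<integral>\<^sup>+z. ennreal (u (f n) z) \<partial>lborel) = ennreal (norm2 D (f n))" for n
    unfolding norm2_def set_lebesgue_integral_def u_def
    using bergman_spaceD(2)[OF f[of n]] by (subst nn_integral_eq_integral) (auto simp: set_integrable_def)
  have "(\<lambda>n. ennreal (u (f n) z)) \<longlonglongrightarrow> ennreal (u g z)" for z
    unfolding u_def by (cases "z \<in> D") (auto intro!: tendsto_ennrealI tendsto_intros lim)
  then have "(\<integral>\<^sup>+z. ennreal (u g z) \<partial>lborel) = (\<integral>\<^sup>+z. liminf (\<lambda>n. ennreal (u (f n) z)) \<partial>lborel)"
    by (intro nn_integral_cong lim_imp_Liminf[symmetric]) auto
  also have "\<dots> \<le> liminf (\<lambda>n. \<integral>\<^sup>+z. ennreal (u (f n) z) \<partial>lborel)"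
    by (intro nn_integral_liminf) (use mu bergman_spaceD(1)[OF f] in auto)
  also have "\<dots> = ennreal m"
    unfolding N by (intro lim_imp_Liminf tendsto_ennrealI m) simp
  finally have le: "(\<integral>\<^sup>+z. ennreal (u g z) \<partial>lborel) \<le> ennreal m" .
  have int: "integrable lborel (u g)"
    using le by (intro integrableI_nonneg mu g) (auto simp: u_def top_unique less_top[symmetric])
  then show "g \<in> bergman_space D"
    using g int[unfolded u_def[abs_def]] by (simp add: bergman_space_def set_integrable_def)
  have "ennreal (norm2 D g) \<le> ennreal m"
    using le int by (subst (asm) nn_integral_eq_integral)
      (auto simp: u_def[abs_def] norm2_def set_lebesgue_integral_def)
  moreover have "0 \<le> m" by (rule LIMSEQ_le_const[OF m]) (auto simp: norm2_nonneg)
  ultimately show "norm2 D g \<le> m" by (simp add: ennreal_le_iff)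
qed

text \<open>The representing function of evaluation at \<open>w\<close> is a multiple of the function of least norm among
  those with value \<open>1\<close> at \<open>w\<close>.\<close>

lemma bergman_representer:
  assumes w: "w \<in> D"
  obtains k where "k \<in> bergman_space D" "\<And>f. f \<in> bergman_space D \<Longrightarrow> f w = ip D f k"
proof -
  define S where "S = {f \<in> bergman_space D. f w = 1}"
  define m where "m = Inf (norm2 D ` S)"
  have ne: "norm2 D ` S \<noteq> {}" using bergman_const[of 1] by (auto simp: S_def)
  have bb: "bdd_below (norm2 D ` S)" by (rule bdd_belowI2[of _ 0]) (rule norm2_nonneg)
  have m_le: "m \<le> norm2 D f" if "f \<in> S" for f
    unfolding m_def by (rule cInf_lower) (use that bb in auto)
  \<comment> \<open>A minimising sequence. The evaluation bounds make it normal, and its limit still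
    takes the value 1 at w.\<close>
  have "\<exists>f\<in>S. norm2 D f < m + 1 / (real n + 1)" for n
    using cInf_lessD[OF ne, of "m + 1 / (real n + 1)"] by (auto simp: m_def)
  then obtain f where f: "\<And>n. f n \<in> S" "\<And>n. norm2 D (f n) < m + 1 / (real n + 1)" by metis
  then have fA: "f n \<in> bergman_space D" and fw: "f n w = 1" for n by (auto simp: S_def)
  have bd: "\<exists>B. \<forall>n. \<forall>z\<in>C. cmod (f n z) \<le> B" if C: "compact C" "C \<subseteq> D" for C
  proof -
    obtain B where B: "0 < B" "\<And>f z. f \<in> bergman_space D \<Longrightarrow> z \<in> C \<Longrightarrow> (cmod (f z))\<^sup>2 \<le> B * norm2 D f"
      using bergman_eval_bound[OF C] by blast
    have "cmod (f n z) \<le> sqrt (B * (m + 1))" if "z \<in> C" for n z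
    proof (rule real_le_rsqrt)
      have "1 / (real n + 1) \<le> 1" by simp
      then have "norm2 D (f n) \<le> m + 1" using f(2)[of n] by linarith
      then show "(cmod (f n z))\<^sup>2 \<le> B * (m + 1)"
        using B(2)[OF fA[of n] that] mult_left_mono[of "norm2 D (f n)" "m + 1" B] B(1) by linarith
    qed
    then show ?thesis by blast
  qed
  obtain g r where g: "g \<in> holo D" "strict_mono (r :: nat \<Rightarrow> nat)"
    "\<And>C. compact C \<Longrightarrow> C \<subseteq> D \<Longrightarrow> uniform_limit C (\<lambda>n. f (r n)) g sequentially"
    using Montel_vec[OF opn bergman_spaceD(1)[OF fA] bd] by metis
  have lim: "(\<lambda>n. f (r n) z) \<longlonglongrightarrow> g z" if "z \<in> D" for z
    using tendsto_uniform_limitI[OF g(3)[of "{z}"], of z] that by simp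
  have gw: "g w = 1"
    using LIMSEQ_unique[OF lim[OF w]] fw by simp
  have "(\<lambda>n. norm2 D (f n)) \<longlonglongrightarrow> m"
  proof (rule tendsto_sandwich[OF _ _ tendsto_const])
    show "(\<lambda>n. m + 1 / (real n + 1)) \<longlonglongrightarrow> m"
      using tendsto_add[OF tendsto_const LIMSEQ_inverse_real_of_nat, of m] by (simp add: inverse_eq_divide add.commute)
  qed (use f m_le in \<open>auto intro!: always_eventually less_imp_le\<close>)
  from norm2_Fatou[OF fA g(1) lim LIMSEQ_subseq_LIMSEQ[OF this g(2), unfolded o_def]]
  have gA: "g \<in> bergman_space D" and gm: "norm2 D g \<le> m" by auto
  then have gm: "norm2 D g = m" using m_le[of g] gw by (simp add: S_def)
  have m0: "0 < m"
  proof -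
    obtain B where "0 < B" "(cmod (g w))\<^sup>2 \<le> B * norm2 D g"
      using bergman_eval_bound[of "{w}"] w gA by (metis compact_sing empty_subsetI insert_subset singletonI)
    then have "1 \<le> B * m" using gw gm by simp
    then show ?thesis using \<open>0 < B\<close> by (metis less_le_trans zero_less_mult_pos zero_less_one)
  qed
  have orth: "ip D h g = 0" if h: "h \<in> bergman_space D" "h w = 0" for h
  proof (rule ccontr)
    assume a: "ip D h g \<noteq> 0"
    \<comment> \<open>First variation: g + c h is still in S, and its squared norm exceeds that of g
      by t * \<open>\<bar><h,g>\<bar>^2\<close> * (t * \<open>norm2 D h\<close> - 2), which is
      negative as soon as t * \<open>norm2 D h\<close> < 1.\<close>
    define t where "t = 1 / (norm2 D h + 1)"
    have t: "0 < t" "t * norm2 D h < 1"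
      using norm2_nonneg[of D h] by (auto simp: t_def divide_simps)
    define c where "c = - of_real t * cnj (ip D h g)"
    have "(\<lambda>z. g z + c * h z) \<in> S"
      using gw h gA by (auto simp: S_def intro!: bergman_add bergman_cmult)
    then have "m \<le> norm2 D g + 2 * Re (cnj c * ip D g h) + (cmod c)\<^sup>2 * norm2 D h"
      using m_le norm2_add_cmult[OF gA h(1)] by metis
    moreover have "cnj c * ip D g h = of_real (- t * (cmod (ip D h g))\<^sup>2)"
      unfolding ip_cnj[of g h] c_def of_real_mult complex_norm_square by (simp add: mult_ac)
    then have "Re (cnj c * ip D g h) = - t * (cmod (ip D h g))\<^sup>2" by simp
    moreover have "(cmod c)\<^sup>2 = t * (t * (cmod (ip D h g))\<^sup>2)"
      using t by (simp add: c_def norm_mult power2_eq_square)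
    ultimately have "0 \<le> t * (cmod (ip D h g))\<^sup>2 * (t * norm2 D h - 2)"
      using gm by (simp add: algebra_simps)
    moreover have "0 < t * (cmod (ip D h g))\<^sup>2" using t a by simp
    ultimately show False using t(2) by (simp add: zero_le_mult_iff)
  qed
  show ?thesis
  proof
    \<comment> \<open>Every f is f(w) g plus a function vanishing at w, and the latter is orthogonal
      to g. Hence <f,g> = m f(w), and g / m represents the evaluation.\<close>
    show "(\<lambda>z. of_real (1 / m) * g z) \<in> bergman_space D" by (rule bergman_cmult[OF gA])
    fix f assume f: "f \<in> bergman_space D"
    have h: "(\<lambda>z. f z + - f w * g z) \<in> bergman_space D" by (intro bergman_add bergman_cmult f gA)
    have "0 = ip D (\<lambda>z. f z + - f w * g z) g"
      by (rule orth[OF h, symmetric]) (simp add: gw)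
    also have "\<dots> = ip D f g - f w * of_real m"
      by (subst ip_add[OF f bergman_cmult[OF gA] gA], subst ip_cmult) (simp add: ip_self gm)
    finally have "f w = of_real (1 / m) * ip D f g" using m0 by (simp add: field_simps)
    also have "\<dots> = ip D f (\<lambda>z. of_real (1 / m) * g z)"
      by (subst (2) ip_cnj, subst ip_cmult, subst ip_cnj) simp
    finally show "f w = ip D f (\<lambda>z. of_real (1 / m) * g z)" .
  qed
qed

section \<open>The Bergman kernel\<close>

lemma
  assumes w: "w \<in> D"
  shows bergman_kernel_in: "(\<lambda>z. bergman_kernel D z w) \<in> bergman_space D"
    and bergman_kernel_repr: "f \<in> bergman_space D \<Longrightarrow> f w = ip D f (\<lambda>z. bergman_kernel D z w)"
proof -
  \<comment> \<open>The choice operator selects the whole kernel at once, so the representing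
    functions for the single points are first collected into one function of w.\<close>
  have "\<exists>k. k \<in> bergman_space D \<and> (\<forall>f\<in>bergman_space D. f w = ip D f k)" if "w \<in> D" for w
    using bergman_representer[OF that] by metis
  then obtain k where "\<And>w. w \<in> D \<Longrightarrow> k w \<in> bergman_space D \<and> (\<forall>f\<in>bergman_space D. f w = ip D f (k w))"
    by metis
  then have "\<forall>w\<in>D. (\<lambda>z. k w z) \<in> bergman_space D \<and>
     (\<forall>f\<in>bergman_space D. f w = (LINT z:D|lborel. f z * cnj (k w z)))"
    by (simp add: ip_def)
  then have "\<exists>K. \<forall>w\<in>D. (\<lambda>z. K z w) \<in> bergman_space D \<and>
     (\<forall>f\<in>bergman_space D. f w = (LINT z:D|lborel. f z * cnj (K z w)))"
    by (intro exI[of _ "\<lambda>z w. k w z"]) simp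
  from someI_ex[OF this]
  have "\<forall>w\<in>D. (\<lambda>z. bergman_kernel D z w) \<in> bergman_space D \<and>
     (\<forall>f\<in>bergman_space D. f w = ip D f (\<lambda>z. bergman_kernel D z w))"
    unfolding bergman_kernel_def ip_def .
  then show "(\<lambda>z. bergman_kernel D z w) \<in> bergman_space D"
    "f \<in> bergman_space D \<Longrightarrow> f w = ip D f (\<lambda>z. bergman_kernel D z w)" using w by auto
qed

lemma bergman_kernel_cnj: "z \<in> D \<Longrightarrow> w \<in> D \<Longrightarrow> bergman_kernel D z w = cnj (bergman_kernel D w z)"
  using bergman_kernel_repr[of z "\<lambda>z. bergman_kernel D z w"] bergman_kernel_repr[of w "\<lambda>w. bergman_kernel D w z"]
    bergman_kernel_in ip_cnj by metis

lemma bergman_kernel_diag: "w \<in> D \<Longrightarrow> bergman_kernel D w w = of_real (norm2 D (\<lambda>z. bergman_kernel D z w))"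
  using bergman_kernel_repr[of w "\<lambda>z. bergman_kernel D z w"] bergman_kernel_in ip_self by metis

lemma bergman_kernel_diag_Re: "w \<in> D \<Longrightarrow> bergman_kernel D w w = of_real (Re (bergman_kernel D w w))"
  by (subst bergman_kernel_diag, assumption, subst bergman_kernel_diag) auto

lemma bergman_kernel_pos:
  assumes w: "w \<in> D"
  shows "0 < Re (bergman_kernel D w w)"
proof (rule ccontr)
  assume "\<not> 0 < Re (bergman_kernel D w w)"
  then have 0: "norm2 D (\<lambda>z. bergman_kernel D z w) = 0"
    using norm2_nonneg[of D "\<lambda>z. bergman_kernel D z w"] bergman_kernel_diag[OF w] by simp
  \<comment> \<open>The kernel function would have norm 0 although its inner product with 1 is 1.
    The squared norm of 1 + c K(.,w) would then be affine in c, and it is negative at this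
    c.\<close>
  define c where "c = - (norm2 D (\<lambda>_. 1) + 1)"
  have "0 \<le> norm2 D (\<lambda>z. 1 + of_real c * bergman_kernel D z w)" by (rule norm2_nonneg)
  also have "\<dots> = norm2 D (\<lambda>_. 1) + 2 * c"
    by (subst norm2_add_cmult[OF bergman_const bergman_kernel_in[OF w]],
        subst bergman_kernel_repr[OF w bergman_const, symmetric]) (simp add: 0)
  finally show False using norm2_nonneg[of D "\<lambda>_. 1"] by (simp add: c_def)
qed

text \<open>Cauchy-Schwarz for h(w) = <h, K(.,w)>, obtained from the norm of h + c K(.,w) at the
  minimising c.\<close>

lemma bergman_eval_le_kernel:
  assumes w: "w \<in> D" and h: "h \<in> bergman_space D"
  shows "(cmod (h w))\<^sup>2 \<le> norm2 D h * Re (bergman_kernel D w w)"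
proof -
  let ?\<kappa> = "Re (bergman_kernel D w w)"
  have \<kappa>: "0 < ?\<kappa>" by (rule bergman_kernel_pos[OF w])
  define c where "c = - h w / of_real ?\<kappa>"
  have "norm2 D (\<lambda>z. bergman_kernel D z w) = ?\<kappa>" using bergman_kernel_diag[OF w] by simp
  then have "0 \<le> norm2 D h + 2 * Re (cnj c * h w) + (cmod c)\<^sup>2 * ?\<kappa>"
    using norm2_nonneg[of D "\<lambda>z. h z + c * bergman_kernel D z w"]
      norm2_add_cmult[OF h bergman_kernel_in[OF w], of c] bergman_kernel_repr[OF w h] by simp
  also have "cnj c * h w = - of_real ((cmod (h w))\<^sup>2 / ?\<kappa>)"
    unfolding of_real_divide complex_norm_square by (simp add: c_def mult.commute)
  also have "(cmod c)\<^sup>2 * ?\<kappa> = (cmod (h w))\<^sup>2 / ?\<kappa>"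
    using \<kappa> by (simp add: c_def norm_divide power_divide power2_eq_square)
  finally show ?thesis using \<kappa> by (simp add: field_simps)
qed

text \<open>The evaluation bound is applied twice to the kernel functions: K(w,w)^2 \<le> B K(w,w)
  gives K(w,w) \<le> B, and then \<open>\<bar>K(z,w)\<bar>^2\<close> \<le> B K(w,w) \<le>
  B^2.\<close>

lemma bergman_kernel_bounded:
  assumes C: "compact C" "C \<subseteq> D"
  obtains B where "\<And>z w. z \<in> C \<Longrightarrow> w \<in> C \<Longrightarrow> cmod (bergman_kernel D z w) \<le> B"
proof -
  obtain B where B: "0 < B" "\<And>f z. f \<in> bergman_space D \<Longrightarrow> z \<in> C \<Longrightarrow> (cmod (f z))\<^sup>2 \<le> B * norm2 D f"
    using bergman_eval_bound[OF C] by blast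
  have "cmod (bergman_kernel D z w) \<le> B" if zw: "z \<in> C" "w \<in> C" for z w
  proof -
    have w: "w \<in> D" using zw C by auto
    have kw: "norm2 D (\<lambda>z. bergman_kernel D z w) = Re (bergman_kernel D w w)" using bergman_kernel_diag[OF w] by simp
    have "cmod (bergman_kernel D w w) = Re (bergman_kernel D w w)"
      by (subst bergman_kernel_diag_Re[OF w]) (use bergman_kernel_pos[OF w] in simp)
    then have "(Re (bergman_kernel D w w))\<^sup>2 \<le> B * Re (bergman_kernel D w w)"
      using B(2)[OF bergman_kernel_in[OF w] zw(2)] kw by simp
    then have "Re (bergman_kernel D w w) \<le> B"
      using bergman_kernel_pos[OF w] by (simp add: power2_eq_square)
    then have "B * Re (bergman_kernel D w w) \<le> B * B" using B(1) by (intro mult_left_mono) auto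
    then have "(cmod (bergman_kernel D z w))\<^sup>2 \<le> B * B"
      using B(2)[OF bergman_kernel_in[OF w] zw(1)] unfolding kw by (rule order_trans[rotated])
    then have "(cmod (bergman_kernel D z w))\<^sup>2 \<le> B\<^sup>2" by (simp only: power2_eq_square)
    then show ?thesis by (rule power2_le_imp_le) (use B(1) in simp)
  qed
  then show ?thesis by (rule that)
qed

end

subsection \<open>Sesquiholomorphic kernels\<close>

text \<open>Holomorphic in the first and antiholomorphic in the second variable. The joint bound on
  compact sets makes Cauchy estimates in one variable uniform in the other; with it, joint
  differentiability can be derived from separate holomorphy.\<close>

definition sesqui :: "(complex ^ 'n) set \<Rightarrow> (complex ^ 'n \<Rightarrow> complex ^ 'n \<Rightarrow> complex) set" where
  "sesqui D = {\<Phi>. (\<forall>w\<in>D. (\<lambda>z. \<Phi> z w) \<in> holo D) \<and> (\<forall>z\<in>D. (\<lambda>w. cnj (\<Phi> z w)) \<in> holo D) \<and>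
     (\<forall>C. compact C \<longrightarrow> C \<subseteq> D \<longrightarrow> (\<exists>B. \<forall>z\<in>C. \<forall>w\<in>C. cmod (\<Phi> z w) \<le> B))}"

definition adj :: "('a \<Rightarrow> 'a \<Rightarrow> complex) \<Rightarrow> 'a \<Rightarrow> 'a \<Rightarrow> complex" where
  "adj \<Phi> z w = cnj (\<Phi> w z)"

definition D1 :: "'n \<Rightarrow> (complex ^ 'n \<Rightarrow> complex ^ 'n \<Rightarrow> complex) \<Rightarrow> complex ^ 'n \<Rightarrow> complex ^ 'n \<Rightarrow> complex" where
  "D1 j \<Phi> z w = dz j (\<lambda>z. \<Phi> z w) z"

text \<open>The derivative with respect to the conjugate of the second variable. Writing it through
  \<open>adj\<close>, which exchanges the variables, reduces its properties to those of
  \<open>D1\<close>.\<close>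

definition D2 :: "'n \<Rightarrow> (complex ^ 'n \<Rightarrow> complex ^ 'n \<Rightarrow> complex) \<Rightarrow> complex ^ 'n \<Rightarrow> complex ^ 'n \<Rightarrow> complex" where
  "D2 k \<Phi> = adj (D1 k (adj \<Phi>))"

lemma D2_eq: "D2 k \<Phi> z w = cnj (dz k (\<lambda>x. cnj (\<Phi> z x)) w)"
  by (simp add: D2_def D1_def adj_def)

lemma sesquiD:
  assumes "\<Phi> \<in> sesqui D"
  shows "w \<in> D \<Longrightarrow> (\<lambda>z. \<Phi> z w) \<in> holo D" "z \<in> D \<Longrightarrow> (\<lambda>w. cnj (\<Phi> z w)) \<in> holo D"
  using assms by (auto simp: sesqui_def)

lemma sesqui_bounded:
  assumes "\<Phi> \<in> sesqui D" "compact C" "C \<subseteq> D"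
  obtains B where "0 < B" "\<And>z w. z \<in> C \<Longrightarrow> w \<in> C \<Longrightarrow> cmod (\<Phi> z w) \<le> B"
proof -
  have "\<forall>C. compact C \<longrightarrow> C \<subseteq> D \<longrightarrow> (\<exists>B. \<forall>z\<in>C. \<forall>w\<in>C. cmod (\<Phi> z w) \<le> B)"
    using assms(1) by (simp add: sesqui_def)
  from this[rule_format, OF assms(2,3)] obtain B where
    "\<And>z w. z \<in> C \<Longrightarrow> w \<in> C \<Longrightarrow> cmod (\<Phi> z w) \<le> B" by blast
  then show ?thesis by (intro that[of "max B 1"]) (auto simp: le_max_iff_disj)
qed

lemma sesqui_adj:
  assumes \<Phi>: "\<Phi> \<in> sesqui D"
  shows "adj \<Phi> \<in> sesqui D"
  unfolding sesqui_def
proof (intro CollectI conjI ballI allI impI)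
  show "(\<lambda>z. adj \<Phi> z w) \<in> holo D" if "w \<in> D" for w
    using sesquiD(2)[OF \<Phi> that] by (simp add: adj_def)
  show "(\<lambda>w. cnj (adj \<Phi> z w)) \<in> holo D" if "z \<in> D" for z
    using sesquiD(1)[OF \<Phi> that] by (simp add: adj_def)
  fix C assume "compact C" "C \<subseteq> D"
  from sesqui_bounded[OF \<Phi> this] show "\<exists>B. \<forall>z\<in>C. \<forall>w\<in>C. cmod (adj \<Phi> z w) \<le> B"
    unfolding adj_def complex_mod_cnj by metis
qed

lemma sesqui_diff:
  assumes \<Phi>: "\<Phi> \<in> sesqui D" and \<Psi>: "\<Psi> \<in> sesqui D"
  shows "(\<lambda>z w. \<Phi> z w - \<Psi> z w) \<in> sesqui D"
  unfolding sesqui_def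
proof (intro CollectI conjI ballI allI impI)
  show "(\<lambda>z. \<Phi> z w - \<Psi> z w) \<in> holo D" if "w \<in> D" for w
    by (intro holo_diff sesquiD(1)[OF \<Phi> that] sesquiD(1)[OF \<Psi> that])
  show "(\<lambda>w. cnj (\<Phi> z w - \<Psi> z w)) \<in> holo D" if "z \<in> D" for z
    using holo_diff[OF sesquiD(2)[OF \<Phi> that] sesquiD(2)[OF \<Psi> that]] by simp
  fix C assume C: "compact C" "C \<subseteq> D"
  obtain B1 where "0 < B1" and B1: "\<And>z w. z \<in> C \<Longrightarrow> w \<in> C \<Longrightarrow> cmod (\<Phi> z w) \<le> B1"
    by (rule sesqui_bounded[OF \<Phi> C]) blast
  obtain B2 where "0 < B2" and B2: "\<And>z w. z \<in> C \<Longrightarrow> w \<in> C \<Longrightarrow> cmod (\<Psi> z w) \<le> B2"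
    by (rule sesqui_bounded[OF \<Psi> C]) blast
  have "cmod (\<Phi> z w - \<Psi> z w) \<le> B1 + B2" if "z \<in> C" "w \<in> C" for z w
    using norm_triangle_ineq4[of "\<Phi> z w" "\<Psi> z w"] B1[OF that] B2[OF that] by linarith
  then show "\<exists>B. \<forall>z\<in>C. \<forall>w\<in>C. cmod (\<Phi> z w - \<Psi> z w) \<le> B" by blast
qed

lemma sesqui_rank_one:
  assumes k: "k \<in> holo D"
  shows "(\<lambda>z w. k z * cnj (k w)) \<in> sesqui D"
  unfolding sesqui_def
proof (intro CollectI conjI ballI allI impI)
  show "(\<lambda>z. k z * cnj (k w)) \<in> holo D" for w by (intro holo_mult holo_const k)
  show "(\<lambda>w. cnj (k z * cnj (k w))) \<in> holo D" for z using holo_mult[OF holo_const k] by simp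
  fix C assume C: "compact C" "C \<subseteq> D"
  obtain B where B: "0 < B" "\<And>z. z \<in> C \<Longrightarrow> cmod (k z) \<le> B"
    using holo_continuous_bound[OF k C] by blast
  have "cmod (k z * cnj (k w)) \<le> B * B" if "z \<in> C" "w \<in> C" for z w
    using that B by (auto simp: norm_mult intro!: mult_mono)
  then show "\<exists>B. \<forall>z\<in>C. \<forall>w\<in>C. cmod (k z * cnj (k w)) \<le> B" by blast
qed

lemma dz_bound:
  fixes f :: "complex ^ 'n \<Rightarrow> complex"
  assumes "f \<in> holo (ball z r)" "0 < r" "\<And>w. w \<in> ball z r \<Longrightarrow> cmod (f w) \<le> B"
  shows "cmod (dz j f z) \<le> 2 * B / r"
  using grad_app_bound[OF assms, of "axis j 1"] by (simp add: grad_app_axis norm_axis_vec)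

text \<open>The new point is the behaviour in the second variable: the difference quotients in z are
  antiholomorphic in w, and the rate in \<open>dz_quotient\<close> is uniform in w.\<close>

lemma sesqui_D1:
  fixes D :: "(complex ^ 'n) set"
  assumes D: "open D" and \<Phi>: "\<Phi> \<in> sesqui D"
  shows "D1 j \<Phi> \<in> sesqui D"
  unfolding sesqui_def
proof (intro CollectI conjI ballI allI impI)
  show "(\<lambda>z. D1 j \<Phi> z w) \<in> holo D" if "w \<in> D" for w
    using holo_dz[OF D sesquiD(1)[OF \<Phi> that]] by (simp add: D1_def[abs_def])
next
  fix z assume z: "z \<in> D"
  obtain r where r: "0 < r" "cball z r \<subseteq> D" using D z open_contains_cball by blast
  define t where "t n = r / (2 * (real n + 1))" for n
  have t: "0 < t n" "t n \<le> r / 2" for n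
    using r by (auto simp: t_def field_simps)
  define q where "q n w = (\<Phi> (z + of_real (t n) *s axis j 1) w - \<Phi> z w) / of_real (t n)" for n w
  have zt: "z + of_real (t n) *s axis j 1 \<in> D" for n
    using r t[of n] by (auto simp: dist_norm norm_smult_vec norm_axis_vec intro!: subsetD[OF r(2)])
  show "(\<lambda>w. cnj (D1 j \<Phi> z w)) \<in> holo D"
  proof (rule holo_limit[of D "\<lambda>n w. cnj (q n w)"])
    fix w assume w: "w \<in> D"
    obtain s where s: "0 < s" "cball w s \<subseteq> D" using D w open_contains_cball by blast
    \<comment> \<open>\<open>sesqui_bounded\<close> concerns both arguments in the same compact set,
      hence the union of the two balls.\<close>
    obtain B where B: "0 < B"
      "\<And>x y. x \<in> cball z r \<union> cball w s \<Longrightarrow> y \<in> cball z r \<union> cball w s \<Longrightarrow> cmod (\<Phi> x y) \<le> B"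
      using sesqui_bounded[OF \<Phi>, of "cball z r \<union> cball w s"] r s by (metis compact_Un compact_cball le_sup_iff)
    have hz: "(\<lambda>x. \<Phi> x y) \<in> holo (ball z r)" if "y \<in> ball w s" for y
      by (rule holo_subset[OF sesquiD(1)[OF \<Phi>]]) (use that r s in auto)
    have q: "cmod (q n y - D1 j \<Phi> z y) \<le> 32 * B / r\<^sup>2 * t n" if y: "y \<in> ball w s" for n y
      unfolding q_def D1_def by (rule dz_quotient[OF hz[OF y] r(1)]) (use y B t in auto)
    have "(\<lambda>y. cnj (q n y)) \<in> holo (ball w s)" for n
    proof -
      have "(\<lambda>y. (cnj (\<Phi> (z + of_real (t n) *s axis j 1) y) - cnj (\<Phi> z y)) * inverse (of_real (t n))) \<in> holo D"
        by (intro holo_mult holo_diff holo_const sesquiD(2)[OF \<Phi>] z zt)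
      then show ?thesis using s holo_subset[of _ D "ball w s"]
        by (simp add: q_def divide_inverse) (meson ball_subset_cball holo_subset order_trans)
    qed
    moreover have "cmod (cnj (q n y)) \<le> 32 * B / r\<^sup>2 * r + 2 * B / r" if y: "y \<in> ball w s" for n y
    proof -
      have "cmod (D1 j \<Phi> z y) \<le> 2 * B / r"
        unfolding D1_def by (rule dz_bound[OF hz[OF y] r(1)]) (use y B in auto)
      moreover have "cmod (q n y - D1 j \<Phi> z y) \<le> 32 * B / r\<^sup>2 * r"
        using q[OF y, of n] t[of n] B r
        by (elim order_trans) (intro mult_left_mono, auto)
      ultimately show ?thesis
        using norm_triangle_sub[of "q n y" "D1 j \<Phi> z y"] by simp
    qed
    moreover have "uniform_limit (ball w s) (\<lambda>n y. cnj (q n y)) (\<lambda>y. cnj (D1 j \<Phi> z y)) sequentially"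
    proof (rule uniform_limit_le)
      show "dist (cnj (q n y)) (cnj (D1 j \<Phi> z y)) \<le> 32 * B / r\<^sup>2 * t n" if "y \<in> ball w s" for n y
        using q[OF that] by (simp add: dist_norm flip: complex_cnj_diff)
      show "(\<lambda>n. 32 * B / r\<^sup>2 * t n) \<longlonglongrightarrow> 0"
        unfolding t_def by (rule LIMSEQ_quotient_steps)
    qed
    ultimately show "\<exists>s>0. \<exists>B. (\<forall>n. (\<lambda>y. cnj (q n y)) \<in> holo (ball w s)) \<and>
      (\<forall>n. \<forall>y\<in>ball w s. cmod (cnj (q n y)) \<le> B) \<and>
      uniform_limit (ball w s) (\<lambda>n y. cnj (q n y)) (\<lambda>y. cnj (D1 j \<Phi> z y)) sequentially"
      using s(1) by blast
  qed
next
  fix C assume C: "compact C" "C \<subseteq> D"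
  obtain r C' where r: "0 < r" "compact C'" "C' \<subseteq> D" "C \<subseteq> C'" "\<And>z. z \<in> C \<Longrightarrow> cball z r \<subseteq> C'"
    using compact_thickening[OF C D] by metis
  obtain B where "0 < B" and B: "\<And>z w. z \<in> C' \<Longrightarrow> w \<in> C' \<Longrightarrow> cmod (\<Phi> z w) \<le> B"
    by (rule sesqui_bounded[OF \<Phi> r(2,3)]) blast
  have "cmod (D1 j \<Phi> z w) \<le> 2 * B / r" if zw: "z \<in> C" "w \<in> C" for z w
  proof -
    have sub: "ball z r \<subseteq> C'" using r(5)[OF zw(1)] by auto
    show ?thesis unfolding D1_def
    proof (rule dz_bound[OF holo_subset[OF sesquiD(1)[OF \<Phi>]] r(1)])
      show "w \<in> D" "ball z r \<subseteq> D" using sub zw C r by auto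
      show "cmod (\<Phi> x w) \<le> B" if "x \<in> ball z r" for x
        using that sub zw r(4) B by blast
    qed
  qed
  then show "\<exists>B. \<forall>z\<in>C. \<forall>w\<in>C. cmod (D1 j \<Phi> z w) \<le> B" by blast
qed

lemma sesqui_D2: "open D \<Longrightarrow> \<Phi> \<in> sesqui D \<Longrightarrow> D2 k \<Phi> \<in> sesqui D"
  unfolding D2_def by (intro sesqui_adj sesqui_D1)

section \<open>Derivatives along the diagonal\<close>

lemma sesqui_diag_has_derivative:
  fixes D :: "(complex ^ 'n) set"
  assumes D: "open D" and \<Phi>: "\<Phi> \<in> sesqui D" and w: "w \<in> D"
  shows "((\<lambda>w. \<Phi> w w) has_derivative
    (\<lambda>v. (\<Sum>j\<in>UNIV. D1 j \<Phi> w w * v $ j) + (\<Sum>k\<in>UNIV. D2 k \<Phi> w w * cnj (v $ k)))) (at w)"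
proof -
  define G1 where "G1 y = grad_app (\<lambda>z. \<Phi> z y) w" for y
  define G2 where "G2 = grad_app (\<lambda>x. cnj (\<Phi> w x)) w"
  obtain r0 where r0: "0 < r0" "cball w r0 \<subseteq> D" using D w open_contains_cball by blast
  define r where "r = r0 / 2"
  have r: "0 < r" "cball w r \<subseteq> cball w (2 * r)" "cball w (2 * r) \<subseteq> D" using r0 by (auto simp: r_def)
  obtain B where B: "0 < B" and B': "\<And>x y. x \<in> cball w (2*r) \<Longrightarrow> y \<in> cball w (2*r) \<Longrightarrow> cmod (\<Phi> x y) \<le> B"
    by (rule sesqui_bounded[OF \<Phi> compact_cball r(3)]) blast
  have b: "ball w r \<subseteq> cball w (2 * r)" using r by auto
  have h1: "(\<lambda>z. \<Phi> z y) \<in> holo (ball w r)" if "y \<in> cball w (2 * r)" for y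
    by (rule holo_subset[OF sesquiD(1)[OF \<Phi>]]) (use that r b in auto)
  have h2: "(\<lambda>y. cnj (\<Phi> z y)) \<in> holo (ball w r)" if "z \<in> cball w (2 * r)" for z
    by (rule holo_subset[OF sesquiD(2)[OF \<Phi>]]) (use that r b in auto)
  have "((\<lambda>w. \<Phi> w w) has_derivative (\<lambda>v. G1 w v + cnj (G2 v))) (at w)"
  proof (rule has_derivative_quadratic[of _ "r / 2" _ _ "100 * B / r\<^sup>2"])
    have "bounded_linear (G1 w)" "bounded_linear G2"
      unfolding G1_def G2_def
      using holo_has_derivative[OF sesquiD(1)[OF \<Phi> w] w] holo_has_derivative[OF sesquiD(2)[OF \<Phi> w] w]
      by (auto dest: has_derivative_bounded_linear)
    then show "bounded_linear (\<lambda>v. G1 w v + cnj (G2 v))"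
      by (intro bounded_linear_add bounded_linear_compose[OF bounded_linear_cnj])
    fix v :: "complex ^ 'n" assume v: "norm v < r / 2"
    have wv: "w + v \<in> cball w (2 * r)" using v r by (auto simp: dist_norm)
    have ww: "w \<in> cball w (2 * r)" using r by auto
    \<comment> \<open>Move the first variable with the second frozen at w + v, then the second with
      the first frozen at w. Estimate 3 brings the gradient back from w + v to w in the second
      argument.\<close>
    have 1: "cmod (\<Phi> (w + v) (w + v) - \<Phi> w (w + v) - G1 (w + v) v) \<le> 32 * B / r\<^sup>2 * (norm v)\<^sup>2"
      unfolding G1_def by (rule holo_taylor[OF h1[OF wv] r(1)]) (use v b wv B' in auto)
    have "cmod (cnj (\<Phi> w (w + v)) - cnj (\<Phi> w w) - G2 v) \<le> 32 * B / r\<^sup>2 * (norm v)\<^sup>2"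
      unfolding G2_def by (rule holo_taylor[OF h2[OF ww] r(1)]) (use v b ww B' in auto)
    then have 2: "cmod (\<Phi> w (w + v) - \<Phi> w w - cnj (G2 v)) \<le> 32 * B / r\<^sup>2 * (norm v)\<^sup>2"
      by (subst (asm) complex_mod_cnj[symmetric]) simp
    \<comment> \<open>Cauchy's estimate for the difference of two slices, which is at most 18 B / r
      * \<open>norm v\<close> by the Lipschitz bound in the second variable. This contributes 36,
      and 32 + 32 + 36 = 100.\<close>
    have "cmod (grad_app (\<lambda>z. \<Phi> z (w + v) - \<Phi> z w) w v) \<le> 2 * (18 * B / r * norm v) / r * norm v"
    proof (rule grad_app_bound[OF holo_diff[OF h1[OF wv] h1[OF ww]] r(1)])
      fix z assume z: "z \<in> ball w r"
      then have z': "z \<in> cball w (2 * r)" using b by auto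
      have "cmod (cnj (\<Phi> z (w + v)) - cnj (\<Phi> z w)) \<le> 18 * B / r * norm v"
        by (rule holo_lipschitz_at[OF h2[OF z'] r(1)]) (use v b z' B' in auto)
      then show "cmod (\<Phi> z (w + v) - \<Phi> z w) \<le> 18 * B / r * norm v"
        by (metis complex_cnj_diff complex_mod_cnj)
    qed
    then have 3: "cmod (G1 (w + v) v - G1 w v) \<le> 36 * B / r\<^sup>2 * (norm v)\<^sup>2"
      using r by (subst (asm) grad_app_diff[OF h1[OF wv] h1[OF ww]])
        (auto simp: G1_def power2_eq_square field_simps)
    have "\<Phi> (w + v) (w + v) - \<Phi> w w - (G1 w v + cnj (G2 v)) =
        (\<Phi> (w + v) (w + v) - \<Phi> w (w + v) - G1 (w + v) v) + (\<Phi> w (w + v) - \<Phi> w w - cnj (G2 v)) +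
        (G1 (w + v) v - G1 w v)" by simp
    also have "cmod \<dots> \<le> 32 * B / r\<^sup>2 * (norm v)\<^sup>2 + 32 * B / r\<^sup>2 * (norm v)\<^sup>2 + 36 * B / r\<^sup>2 * (norm v)\<^sup>2"
      by (intro order_trans[OF norm_triangle_ineq] add_mono 1 2 3)
    also have "\<dots> = 100 * B / r\<^sup>2 * (norm v)\<^sup>2" using r by (simp add: field_simps)
    finally show "cmod (\<Phi> (w + v) (w + v) - \<Phi> w w - (G1 w v + cnj (G2 v))) \<le> 100 * B / r\<^sup>2 * (norm v)\<^sup>2" .
  qed (use r in auto)
  moreover have "(\<lambda>v. G1 w v + cnj (G2 v)) =
      (\<lambda>v. (\<Sum>j\<in>UNIV. D1 j \<Phi> w w * v $ j) + (\<Sum>k\<in>UNIV. D2 k \<Phi> w w * cnj (v $ k)))"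
    by (simp add: G1_def G2_def grad_app_def D1_def D2_eq)
  ultimately show ?thesis by simp
qed

lemma sum_axis: "(\<Sum>j\<in>UNIV. f j * (axis i c :: complex ^ 'n) $ j) = f i * c"
  by (simp add: axis_def if_distrib sum.delta' cong: if_cong)

lemma sum_axis_cnj: "(\<Sum>j\<in>UNIV. f j * cnj ((axis i c :: complex ^ 'n) $ j)) = f i * cnj c"
  by (simp add: axis_def if_distrib sum.delta' cong: if_cong)

text \<open>\<open>dzbar\<close> annihilates the complex linear part of the derivative and keeps the
  antilinear one.\<close>

lemma dzbar_diag:
  assumes "open D" "\<Phi> \<in> sesqui D" "w \<in> D"
  shows "dzbar j (\<lambda>w. \<Phi> w w) w = D2 j \<Phi> w w"
  unfolding dz_eq[OF sesqui_diag_has_derivative[OF assms]] sum_axis sum_axis_cnj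
  by (simp add: algebra_simps)

definition hermitian_on :: "'a set \<Rightarrow> ('a \<Rightarrow> 'a \<Rightarrow> complex) \<Rightarrow> bool" where
  "hermitian_on D \<Phi> \<longleftrightarrow> (\<forall>z\<in>D. \<forall>w\<in>D. \<Phi> z w = cnj (\<Phi> w z))"

lemma hermitian_D2:
  assumes D: "open D" and h: "hermitian_on D \<Phi>" and zw: "z \<in> D" "w \<in> D"
  shows "D2 k \<Phi> z w = cnj (D1 k \<Phi> w z)"
proof -
  have "dz k (\<lambda>x. cnj (\<Phi> z x)) w = dz k (\<lambda>x. \<Phi> x z) w"
    by (rule dz_cong_open[OF D zw(2)]) (use h zw(1) in \<open>unfold hermitian_on_def, metis\<close>)
  then show ?thesis by (simp add: D2_eq D1_def)
qed

text \<open>Were c negative, f' would be negative just to the right of 0, and by the mean value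
  theorem f would drop below f 0.\<close>

lemma second_derivative_nonneg_at_min:
  fixes f :: "real \<Rightarrow> real"
  assumes d: "0 < d" and f: "\<And>t. \<bar>t\<bar> < d \<Longrightarrow> (f has_real_derivative f' t) (at t)"
    and f': "(f' has_real_derivative c) (at 0)" and min: "\<And>t. \<bar>t\<bar> < d \<Longrightarrow> f 0 \<le> f t"
  shows "0 \<le> c"
proof (rule ccontr)
  assume "\<not> 0 \<le> c"
  moreover have "f' 0 = 0"
    using DERIV_local_min[OF f d] min d by (simp add: abs_minus_commute)
  ultimately obtain e where e: "0 < e" "\<And>h. 0 < h \<Longrightarrow> h < e \<Longrightarrow> f' h < 0"
    using DERIV_neg_dec_right[OF f'] by auto
  define t where "t = min (d / 2) (e / 2)"
  have t: "0 < t" "t < d" "t < e" using d e by (auto simp: t_def)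
  obtain x where x: "0 < x" "x < t" "f t - f 0 = (t - 0) * f' x"
    using MVT2[OF t(1), of f f'] f t by (metis abs_of_nonneg le_less_trans)
  have "f t - f 0 < 0" unfolding x(3) using e(2)[of x] x t by (simp add: mult_pos_neg)
  then show False using min[of t] t by simp
qed

text \<open>The second derivative in direction \<open>v\<close> is the Levi form plus a part that changes sign under
  \<open>v \<mapsto> \<i> v\<close>.\<close>

lemma levi_nonneg_at_min:
  fixes D :: "(complex ^ 'n) set"
  assumes D: "open D" and \<Phi>: "\<Phi> \<in> sesqui D" and h: "hermitian_on D \<Phi>"
    and nn: "\<And>w. w \<in> D \<Longrightarrow> 0 \<le> Re (\<Phi> w w)" and z: "z \<in> D" and 0: "Re (\<Phi> z z) = 0"
  shows "0 \<le> Re (\<Sum>j\<in>UNIV. \<Sum>k\<in>UNIV. D1 j (D2 k \<Phi>) z z * u $ j * cnj (u $ k))"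
proof -
  define A where "A v = (\<Sum>k\<in>UNIV. (\<Sum>j\<in>UNIV. D1 j (D2 k \<Phi>) z z * v $ j) * cnj (v $ k))" for v
  define T where "T v = (\<Sum>k\<in>UNIV. (\<Sum>j\<in>UNIV. D2 j (D2 k \<Phi>) z z * cnj (v $ j)) * cnj (v $ k))" for v
  have *: "0 \<le> 2 * Re (A v + T v)" for v
  proof -
    obtain r where r: "0 < r" "cball z r \<subseteq> D" using D z open_contains_cball by blast
    \<comment> \<open>Keeps the segment z + t v in D; the 1 admits v = 0.\<close>
    define d where "d = r / (norm v + 1)"
    have nv: "0 < norm v + 1" using norm_ge_zero[of v] by linarith
    have d: "0 < d" using r nv by (simp add: d_def)
    have inD: "z + t *\<^sub>R v \<in> D" if "\<bar>t\<bar> < d" for t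
    proof -
      have "\<bar>t\<bar> * norm v \<le> d * (norm v + 1)" using that d by (intro mult_mono) auto
      also have "\<dots> = r" using nv by (simp add: d_def)
      finally show ?thesis using r(2) by (auto simp: dist_norm)
    qed
    have line: "((\<lambda>t::real. z + t *\<^sub>R v) has_derivative (\<lambda>t. t *\<^sub>R v)) (at t)" for t
      by (auto intro!: derivative_eq_intros)
    have along: "((\<lambda>t::real. \<Psi> (z + t *\<^sub>R v) (z + t *\<^sub>R v)) has_vector_derivative
        (\<Sum>j\<in>UNIV. D1 j \<Psi> (z + t *\<^sub>R v) (z + t *\<^sub>R v) * v $ j) +
        (\<Sum>k\<in>UNIV. D2 k \<Psi> (z + t *\<^sub>R v) (z + t *\<^sub>R v) * cnj (v $ k))) (at t)"
      if "\<Psi> \<in> sesqui D" "\<bar>t\<bar> < d" for \<Psi> t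
    proof -
      from diff_chain_at[OF line sesqui_diag_has_derivative[OF D that(1) inD[OF that(2)]]]
      show ?thesis
        by (simp add: has_vector_derivative_def o_def scaleR_sum_right scaleR_add_right)
    qed
    define f where "f t = Re (\<Phi> (z + t *\<^sub>R v) (z + t *\<^sub>R v))" for t
    \<comment> \<open>Hermitian symmetry makes the holomorphic part of the derivative the conjugate
      of the antiholomorphic part, so twice the real part of the latter suffices.\<close>
    define f' where "f' t = 2 * Re (\<Sum>k\<in>UNIV. D2 k \<Phi> (z + t *\<^sub>R v) (z + t *\<^sub>R v) * cnj (v $ k))" for t
    show ?thesis
    proof (rule second_derivative_nonneg_at_min[OF d])
      show "(f has_real_derivative f' t) (at t)" if t: "\<bar>t\<bar> < d" for t
      proof -
        have "(\<Sum>j\<in>UNIV. D1 j \<Phi> (z + t *\<^sub>R v) (z + t *\<^sub>R v) * v $ j) =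
            cnj (\<Sum>k\<in>UNIV. D2 k \<Phi> (z + t *\<^sub>R v) (z + t *\<^sub>R v) * cnj (v $ k))"
          by (simp add: hermitian_D2[OF D h inD[OF t] inD[OF t]])
        then have "f' t = Re ((\<Sum>j\<in>UNIV. D1 j \<Phi> (z + t *\<^sub>R v) (z + t *\<^sub>R v) * v $ j) +
            (\<Sum>k\<in>UNIV. D2 k \<Phi> (z + t *\<^sub>R v) (z + t *\<^sub>R v) * cnj (v $ k)))"
          by (simp only: f'_def plus_complex.simps complex_cnj) simp
        then show ?thesis
          using bounded_linear.has_vector_derivative[OF bounded_linear_Re along[OF \<Phi> t]]
          by (simp add: f_def[abs_def] has_real_derivative_iff_has_vector_derivative)
      qed
      have "((\<lambda>t. \<Sum>k\<in>UNIV. D2 k \<Phi> (z + t *\<^sub>R v) (z + t *\<^sub>R v) * cnj (v $ k)) has_vector_derivative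
          (\<Sum>k\<in>UNIV. ((\<Sum>j\<in>UNIV. D1 j (D2 k \<Phi>) (z + 0 *\<^sub>R v) (z + 0 *\<^sub>R v) * v $ j) +
        (\<Sum>j\<in>UNIV. D2 j (D2 k \<Phi>) (z + 0 *\<^sub>R v) (z + 0 *\<^sub>R v) * cnj (v $ j))) * cnj (v $ k))) (at 0)"
        by (intro has_vector_derivative_sum has_vector_derivative_mult_left along sesqui_D2 D \<Phi>)
           (use d in auto)
      from bounded_linear.has_vector_derivative[OF bounded_linear_Re this]
      show "(f' has_real_derivative 2 * Re (A v + T v)) (at 0)"
        unfolding f'_def A_def T_def has_real_derivative_iff_has_vector_derivative
        by (intro has_vector_derivative_mult_right) (simp add: distrib_right sum.distrib)
      show "f 0 \<le> f t" if "\<bar>t\<bar> < d" for t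
        using nn[OF inD[OF that]] 0 by (simp add: f_def)
    qed
  qed
  have "A (\<i> *s u) = A u" "T (\<i> *s u) = - T u"
    by (simp_all add: A_def T_def sum_distrib_left sum_distrib_right sum_negf mult_ac)
  then have "0 \<le> Re (A u)" using *[of u] *[of "\<i> *s u"] by simp
  also have "A u = (\<Sum>j\<in>UNIV. \<Sum>k\<in>UNIV. D1 j (D2 k \<Phi>) z z * u $ j * cnj (u $ k))"
    unfolding A_def sum_distrib_right by (rule sum.swap)
  finally show ?thesis .
qed

subsection \<open>Weighted composition operators\<close>

lemma Q_le_sum:
  fixes f :: "complex ^ 'n \<Rightarrow> complex"
  assumes "finite I" and c: "\<And>i. i \<in> I \<Longrightarrow> 0 \<le> c i"
    and le: "\<And>u. cmod (grad_app f z u) \<le> (\<Sum>i\<in>I. c i * cmod (grad_app (g i) z u))"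
  shows "Q D f z \<le> (\<Sum>i\<in>I. ennreal (c i) * Q D (g i) z)"
  unfolding Q_def[of D f]
proof (rule SUP_least)
  fix u :: "complex ^ 'n" assume u: "u \<in> UNIV - {0}"
  define s where "s = sqrt (Re (bergman_metric D z u u))"
  show "ennreal (cmod (grad_app f z u) / sqrt (Re (bergman_metric D z u u))) \<le>
      (\<Sum>i\<in>I. ennreal (c i) * Q D (g i) z)"
  proof (cases "s > 0")
    case True
    have "cmod (grad_app f z u) / s \<le> (\<Sum>i\<in>I. c i * (cmod (grad_app (g i) z u) / s))"
      using divide_right_mono[OF le[of u], of s] True by (simp add: sum_divide_distrib)
    then have "ennreal (cmod (grad_app f z u) / s) \<le> ennreal (\<Sum>i\<in>I. c i * (cmod (grad_app (g i) z u) / s))"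
      by (rule ennreal_leI)
    also have "\<dots> = (\<Sum>i\<in>I. ennreal (c i * (cmod (grad_app (g i) z u) / s)))"
      using c True by (intro sum_ennreal[symmetric] mult_nonneg_nonneg) auto
    also have "\<dots> = (\<Sum>i\<in>I. ennreal (c i) * ennreal (cmod (grad_app (g i) z u) / s))"
      using c by (intro sum.cong ennreal_mult') auto
    also have "\<dots> \<le> (\<Sum>i\<in>I. ennreal (c i) * Q D (g i) z)"
      unfolding Q_def s_def by (intro sum_mono mult_left_mono SUP_upper u) auto
    finally show ?thesis by (simp add: s_def)
  next
    \<comment> \<open>The root is odd and division by 0 gives 0, so in a direction where the metric
      is not positive the quotient is at most 0 and becomes 0 in \<open>ennreal\<close>.\<close>
    case False
    then have "ennreal (cmod (grad_app f z u) / s) = 0"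
      by (intro ennreal_neg divide_nonneg_nonpos) auto
    then show ?thesis by (simp add: s_def)
  qed
qed

lemma Q_le_add:
  assumes "0 \<le> a" "0 \<le> b"
    and "\<And>u. cmod (grad_app f z u) \<le> a * cmod (grad_app g z u) + b * cmod (grad_app h z u)"
  shows "Q D f z \<le> ennreal a * Q D g z + ennreal b * Q D h z"
  using Q_le_sum[of "UNIV :: bool set" "\<lambda>i. if i then a else b" f z "\<lambda>i. if i then g else h" D] assms
  by (simp add: UNIV_bool add.commute)

lemma Q_cmult:
  assumes "f \<in> holo D" "z \<in> D"
  shows "Q D (\<lambda>w. c * f w) z = ennreal (cmod c) * Q D f z"
  unfolding Q_def
  by (simp add: grad_app_cmult[OF assms] norm_mult SUP_mult_left_ennreal ennreal_mult'[symmetric])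

lemma holo_self_mapD:
  assumes "\<phi> \<in> holo_self_map D"
  shows "\<phi> \<in> holo_map D" "\<phi> ` D \<subseteq> D" "z \<in> D \<Longrightarrow> \<phi> z \<in> D"
  using assms by (auto simp: holo_self_map_def)

lemma weighted_comp_eq: "weighted_comp \<psi> \<phi> f = (\<lambda>z. \<psi> z * (f \<circ> \<phi>) z)"
  by (simp add: weighted_comp_def)

text \<open>The bound a concerns the single value f(\<phi>(z)), so that it can be small over a
  compact set on which f is small and a global bound elsewhere.\<close>

lemma Q_weighted_comp:
  assumes f: "f \<in> holo D" and \<phi>: "\<phi> \<in> holo_self_map D" and \<psi>: "\<psi> \<in> holo D" and z: "z \<in> D"
    and a: "cmod (f (\<phi> z)) \<le> a"
  shows "Q D (weighted_comp \<psi> \<phi> f) z \<le>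
    ennreal a * Q D \<psi> z + ennreal (cmod (\<psi> z)) * Q D (f \<circ> \<phi>) z"
proof (rule Q_le_add)
  show "0 \<le> a" using a norm_ge_zero order_trans by blast
  fix u
  have "cmod (grad_app (weighted_comp \<psi> \<phi> f) z u) =
      cmod (\<psi> z * grad_app (f \<circ> \<phi>) z u + grad_app \<psi> z u * f (\<phi> z))"
    unfolding weighted_comp_eq
    by (subst grad_app_mult[OF \<psi> holo_compose[OF f holo_self_mapD(1,2)[OF \<phi>]] z]) simp
  also have "\<dots> \<le> cmod (\<psi> z) * cmod (grad_app (f \<circ> \<phi>) z u) + cmod (grad_app \<psi> z u) * cmod (f (\<phi> z))"
    by (metis norm_mult norm_triangle_ineq)
  also have "\<dots> \<le> cmod (\<psi> z) * cmod (grad_app (f \<circ> \<phi>) z u) + cmod (grad_app \<psi> z u) * a"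
    by (intro add_left_mono mult_left_mono a) auto
  finally show "cmod (grad_app (weighted_comp \<psi> \<phi> f) z u) \<le>
      a * cmod (grad_app \<psi> z u) + cmod (\<psi> z) * cmod (grad_app (f \<circ> \<phi>) z u)"
    by (simp add: algebra_simps)
qed auto

text \<open>The chain rule separates f from \<phi>: f enters through its partial derivatives at
  \<phi>(z) only, and the remaining factors do not depend on f.\<close>

lemma Q_compose_le:
  assumes f: "f \<in> holo D" and \<phi>: "\<phi> \<in> holo_self_map D" and z: "z \<in> D"
    and b: "\<And>k. cmod (dz k f (\<phi> z)) \<le> b"
  shows "Q D (f \<circ> \<phi>) z \<le> (\<Sum>k\<in>UNIV. ennreal b * Q D (\<lambda>w. \<phi> w $ k) z)"
proof (rule Q_le_sum)
  show "0 \<le> b" using b norm_ge_zero order_trans by blast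
  fix u
  show "cmod (grad_app (f \<circ> \<phi>) z u) \<le> (\<Sum>k\<in>UNIV. b * cmod (grad_app (\<lambda>w. \<phi> w $ k) z u))"
    unfolding grad_app_compose[OF f holo_self_mapD(1,2)[OF \<phi>] z]
    by (rule sum_norm_le) (auto simp: norm_mult intro!: mult_right_mono b)
qed auto

lemma Q_compose_theta:
  assumes f: "f \<in> holo D" and \<phi>: "\<phi> \<in> holo_self_map D" and z: "z \<in> D"
    and M: "0 < M" "\<And>w. w \<in> D \<Longrightarrow> cmod (f w) \<le> M"
  shows "Q D (f \<circ> \<phi>) z \<le> ennreal M * theta D \<phi> z"
proof -
  define g where "g w = of_real (1 / M) * f w" for w
  have g: "g \<in> holo D" unfolding g_def by (intro holo_mult f holo_const)
  have g1: "cmod (g w) \<le> 1" if "w \<in> D" for w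
    using M that by (simp add: g_def norm_divide)
  have "bounded (g ` D)" using g1 by (auto simp: bounded_iff)
  moreover have "sup_norm D g \<le> 1" unfolding sup_norm_def
    by (rule cSUP_least) (use z g1 in auto)
  ultimately have "g \<in> {f \<in> H_infty D. sup_norm D f \<le> 1}" using g by (simp add: H_infty_def)
  then have "Q D (g \<circ> \<phi>) z \<le> theta D \<phi> z" unfolding theta_def by (rule SUP_upper)
  moreover have "Q D (f \<circ> \<phi>) z = ennreal M * Q D (g \<circ> \<phi>) z"
  proof -
    have "f \<circ> \<phi> = (\<lambda>w. of_real M * (g \<circ> \<phi>) w)" using M by (auto simp: g_def)
    then show ?thesis
      using Q_cmult[OF holo_compose[OF g holo_self_mapD(1,2)[OF \<phi>]] z, of "of_real M"] M by simp
  qed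
  ultimately show ?thesis by (simp add: mult_left_mono)
qed

lemma Q_le_bloch_seminorm: "z \<in> D \<Longrightarrow> Q D f z \<le> bloch_seminorm D f"
  unfolding bloch_seminorm_def by (rule SUP_upper)

lemma cmod_le_sup_norm:
  assumes "f \<in> H_infty D" "z \<in> D"
  shows "cmod (f z) \<le> sup_norm D f"
proof -
  have "bdd_above ((\<lambda>z. cmod (f z)) ` D)"
    using assms(1) by (auto simp: H_infty_def bounded_iff bdd_above_def)
  then show ?thesis unfolding sup_norm_def using assms(2) by (intro cSUP_upper)
qed

lemma coord_in_H_infty:
  assumes "bounded D"
  shows "(\<lambda>z. z $ k) \<in> H_infty D"
  using assms bounded_linear_image[OF _ bounded_linear_vec_nth] unfolding H_infty_def by blast

text \<open>The operator acting on the coordinate functions bounds the weighted derivative of \<open>\<phi>\<close>. This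
  controls \<open>W\<close> where \<open>\<phi>\<close> stays in a compact set although \<open>\<psi>\<close> may be unbounded there.\<close>

lemma weight_Q_coord_le:
  assumes \<phi>: "\<phi> \<in> holo_self_map D" and \<psi>: "\<psi> \<in> holo D" and z: "z \<in> D"
    and R: "\<And>w. w \<in> D \<Longrightarrow> norm w \<le> R"
  shows "ennreal (cmod (\<psi> z)) * Q D (\<lambda>w. \<phi> w $ k) z \<le>
    bloch_seminorm D (weighted_comp \<psi> \<phi> (\<lambda>w. w $ k)) + ennreal R * bloch_seminorm D \<psi>"
proof -
  let ?p = "\<lambda>w. \<phi> w $ k"
  have p: "?p \<in> holo D" using holo_self_mapD(1)[OF \<phi>] by (simp add: holo_map_def)
  have "Q D (\<lambda>w. \<psi> z * ?p w) z \<le> ennreal 1 * Q D (weighted_comp \<psi> \<phi> (\<lambda>w. w $ k)) z + ennreal R * Q D \<psi> z"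
  proof (rule Q_le_add)
    fix u
    \<comment> \<open>The product rule for \<psi> \<phi>\<open>\<^sub>k\<close>, solved for the term
      in which \<phi>\<open>\<^sub>k\<close> is differentiated.\<close>
    have "grad_app (\<lambda>w. \<psi> z * ?p w) z u =
        grad_app (weighted_comp \<psi> \<phi> (\<lambda>w. w $ k)) z u - grad_app \<psi> z u * ?p z"
      unfolding weighted_comp_def
      by (simp add: grad_app_mult[OF \<psi> p z] grad_app_cmult[OF p z])
    then have "cmod (grad_app (\<lambda>w. \<psi> z * ?p w) z u) \<le>
        cmod (grad_app (weighted_comp \<psi> \<phi> (\<lambda>w. w $ k)) z u) + cmod (grad_app \<psi> z u) * cmod (?p z)"
      by (metis norm_mult norm_triangle_ineq4)
    also have "\<dots> \<le> cmod (grad_app (weighted_comp \<psi> \<phi> (\<lambda>w. w $ k)) z u) + cmod (grad_app \<psi> z u) * R"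
      by (intro add_left_mono mult_left_mono
          order_trans[OF Finite_Cartesian_Product.norm_nth_le R[OF holo_self_mapD(3)[OF \<phi> z]]]) auto
    finally show "cmod (grad_app (\<lambda>w. \<psi> z * ?p w) z u) \<le>
        1 * cmod (grad_app (weighted_comp \<psi> \<phi> (\<lambda>w. w $ k)) z u) + R * cmod (grad_app \<psi> z u)"
      by (simp add: mult.commute)
  qed (use R[OF z] norm_ge_zero order_trans in \<open>auto, blast\<close>)
  then show ?thesis
    unfolding Q_cmult[OF p z]
    by (elim order_trans) (auto intro!: add_mono mult_left_mono Q_le_bloch_seminorm z)
qed

lemma vanishes_alongE:
  assumes "vanishes_along D \<phi> F" "0 < e"
  obtains C where "compact C" "C \<subseteq> D" "\<And>z. z \<in> D \<Longrightarrow> \<phi> z \<notin> C \<Longrightarrow> F z < ennreal e"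
  using assms(1)[unfolded vanishes_along_def, rule_format, OF assms(2)] that by blast

lemma vanishes_towardsE:
  assumes "vanishes_towards D S F" "0 < e"
  obtains \<delta> where "0 < \<delta>" "\<And>z w. z \<in> D \<Longrightarrow> w \<in> S \<Longrightarrow> dist z w < \<delta> \<Longrightarrow> F z < ennreal e"
  using assms(1)[unfolded vanishes_towards_def, rule_format, OF assms(2)] that by blast

text \<open>The target Y is left open in order to serve both parts. That the operator maps into Y
  enters twice: it makes the images of the coordinate functions Bloch functions, and it puts the
  limit, which is the image of a bounded function g, into Y.\<close>

lemma compact_operator_weighted_comp:
  fixes D :: "(complex ^ 'n) set"
  assumes D: "open D" "bounded D" "0 \<in> D" and \<phi>: "\<phi> \<in> holo_self_map D" and \<psi>: "\<psi> \<in> bloch D"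
    and Y: "Y \<subseteq> bloch D" and W: "weighted_comp \<psi> \<phi> \<in> H_infty D \<rightarrow> Y"
    and v1: "vanishes_along D \<phi> (Q D \<psi>)"
    and v2: "vanishes_along D \<phi> (\<lambda>z. ennreal (cmod (\<psi> z)) * theta D \<phi> z)"
  shows "compact_operator (H_infty D) (sup_norm D) Y (bloch_norm D) (weighted_comp \<psi> \<phi>)"
proof -
  let ?W = "weighted_comp \<psi> \<phi>"
  have \<psi>h: "\<psi> \<in> holo D" using \<psi> by (simp add: bloch_def)
  obtain R where R: "\<And>w. w \<in> D \<Longrightarrow> norm w \<le> R" using D(2) by (auto simp: bounded_iff)
  define L where "L k = bloch_seminorm D (?W (\<lambda>w. w $ k)) + ennreal R * bloch_seminorm D \<psi>" for k
  \<comment> \<open>A finite bound, uniform in z, for Q(\<psi>) plus the sum of all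
    \<bar>\<psi>\<bar> Q(\<phi>\<open>\<^sub>k\<close>).\<close>
  define S where "S = bloch_seminorm D \<psi> + (\<Sum>k\<in>UNIV. L k)"
  have "L k < \<infinity>" for k
    using coord_in_H_infty[OF D(2), of k] W Y \<psi> unfolding L_def bloch_def
    by (auto simp: ennreal_mult_less_top Pi_def)
  then have "S < \<infinity>" using \<psi> by (simp add: S_def bloch_def)
  then obtain \<sigma> where \<sigma>: "S = ennreal \<sigma>" "0 \<le> \<sigma>" by (cases S) auto

  have rel: "relatively_compact_in Y (bloch_norm D) (?W ` A)"
    if A: "A \<subseteq> H_infty D" and M0: "\<And>f. f \<in> A \<Longrightarrow> sup_norm D f \<le> M0" for A M0
    unfolding relatively_compact_in_def
  proof (intro conjI allI impI)
    show "?W ` A \<subseteq> Y" using A W by auto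
    fix a :: "nat \<Rightarrow> complex ^ 'n \<Rightarrow> complex" assume "range a \<subseteq> ?W ` A"
    then have "\<forall>i. \<exists>f\<in>A. a i = ?W f" by blast
    then obtain f where f: "\<And>i. f i \<in> A" "\<And>i. a i = ?W (f i)" by metis
    define M where "M = max M0 1"
    have M: "0 < M" by (simp add: M_def)
    have fH: "f i \<in> H_infty D" for i using f A by auto
    then have fh: "f i \<in> holo D" for i by (simp add: H_infty_def)
    have fM: "cmod (f i z) \<le> M" if "z \<in> D" for i z
      using cmod_le_sup_norm[OF fH that, of i] M0[OF f(1), of i] by (simp add: M_def)
    have "\<exists>B. \<forall>n. \<forall>z\<in>C. cmod (f n z) \<le> B" if "C \<subseteq> D" for C using fM that by blast
    then obtain g r where g: "g \<in> holo D" "strict_mono (r :: nat \<Rightarrow> nat)"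
      "\<And>C. compact C \<Longrightarrow> C \<subseteq> D \<Longrightarrow> uniform_limit C (\<lambda>n. f (r n)) g sequentially"
      using Montel_vec[of D f, OF D(1) fh] by metis
    have lim: "(\<lambda>n. f (r n) z) \<longlonglongrightarrow> g z" if "z \<in> D" for z
      using tendsto_uniform_limitI[OF g(3)[of "{z}"], of z] that by simp
    have gM: "cmod (g z) \<le> M" if "z \<in> D" for z
      by (rule Lim_bounded[OF tendsto_norm[OF lim[OF that]]]) (use fM that in auto)
    have gH: "g \<in> H_infty D" using g gM by (auto simp: H_infty_def bounded_iff)
    define d where "d i z = f (r i) z - g z" for i z
    have dh: "d i \<in> holo D" for i unfolding d_def by (intro holo_diff fh g)
    have dM: "cmod (d i z) \<le> 2 * M" if "z \<in> D" for i z
      using norm_triangle_ineq4[of "f (r i) z" "g z"] fM[OF that, of "r i"] gM[OF that] by (simp add: d_def)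
    have Wd: "(\<lambda>z. a (r i) z - ?W g z) = ?W (d i)" for i
      by (auto simp: f weighted_comp_def d_def algebra_simps)
    have small: "\<exists>N. \<forall>i\<ge>N. bloch_seminorm D (?W (d i)) \<le> ennreal e" if e: "0 < e" for e :: real
    proof -
      \<comment> \<open>Off the compact set the estimate will be 2 M (\<eta> + \<eta>) = e, where 2
        M bounds the differences d; over it, \<eta>' \<sigma> \<le> e.\<close>
      define \<eta> where "\<eta> = e / (4 * M)"
      define \<eta>' where "\<eta>' = e / (\<sigma> + 1)"
      have \<eta>: "0 < \<eta>" "0 < \<eta>'" using e M \<sigma> by (auto simp: \<eta>_def \<eta>'_def)
      obtain C1 where C1: "compact C1" "C1 \<subseteq> D" "\<And>z. z \<in> D \<Longrightarrow> \<phi> z \<notin> C1 \<Longrightarrow> Q D \<psi> z < ennreal \<eta>"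
        using vanishes_alongE[OF v1 \<eta>(1)] by blast
      obtain C2 where C2: "compact C2" "C2 \<subseteq> D"
        "\<And>z. z \<in> D \<Longrightarrow> \<phi> z \<notin> C2 \<Longrightarrow> ennreal (cmod (\<psi> z)) * theta D \<phi> z < ennreal \<eta>"
        using vanishes_alongE[OF v2 \<eta>(1)] by blast
      define C where "C = C1 \<union> C2"
      have C: "compact C" "C \<subseteq> D" using C1 C2 by (auto simp: C_def)
      have ev1: "\<forall>\<^sub>F i in sequentially. \<forall>z\<in>C. dist (f (r i) z) (g z) < \<eta>'"
        using g(3)[OF C] \<eta> unfolding uniform_limit_iff by blast
      have ev2: "\<forall>\<^sub>F i in sequentially. \<forall>k. \<forall>z\<in>C. dist (dz k (f (r i)) z) (dz k g z) < \<eta>'"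
        using uniform_limit_dz[OF D(1) fh g(1,3) C] \<eta>
        unfolding uniform_limit_iff by (intro eventually_all_finite) blast
      from ev1 ev2 have "\<forall>\<^sub>F i in sequentially. bloch_seminorm D (?W (d i)) \<le> ennreal e"
      proof eventually_elim
        case (elim i)
        show ?case unfolding bloch_seminorm_def
        proof (rule SUP_least)
          fix z assume z: "z \<in> D"
          have \<phi>z: "\<phi> z \<in> D" using holo_self_mapD(3)[OF \<phi> z] .
          show "Q D (?W (d i)) z \<le> ennreal e"
          proof (cases "\<phi> z \<in> C")
            case True
            have "dz k (d i) (\<phi> z) = dz k (f (r i)) (\<phi> z) - dz k g (\<phi> z)" for k
              using grad_app_diff[OF fh g(1) \<phi>z] unfolding d_def grad_app_axis[symmetric] by blast
            then have dzd: "cmod (dz k (d i) (\<phi> z)) \<le> \<eta>'" for k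
              using elim(2) True by (auto simp: dist_norm intro: less_imp_le)
            have "Q D (?W (d i)) z \<le> ennreal \<eta>' * Q D \<psi> z + ennreal (cmod (\<psi> z)) * Q D (d i \<circ> \<phi>) z"
              by (rule Q_weighted_comp[OF dh \<phi> \<psi>h z])
                 (use elim(1) True in \<open>auto simp: d_def dist_norm intro: less_imp_le\<close>)
            also have "\<dots> \<le> ennreal \<eta>' * Q D \<psi> z +
                ennreal (cmod (\<psi> z)) * (\<Sum>k\<in>UNIV. ennreal \<eta>' * Q D (\<lambda>w. \<phi> w $ k) z)"
              by (intro add_left_mono mult_left_mono Q_compose_le[OF dh \<phi> z dzd]) auto
            also have "\<dots> = ennreal \<eta>' * (Q D \<psi> z +
                (\<Sum>k\<in>UNIV. ennreal (cmod (\<psi> z)) * Q D (\<lambda>w. \<phi> w $ k) z))"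
              by (simp add: distrib_left sum_distrib_left mult_ac)
            also have "\<dots> \<le> ennreal \<eta>' * S"
              unfolding S_def L_def
              by (intro mult_left_mono add_mono sum_mono Q_le_bloch_seminorm weight_Q_coord_le \<phi> \<psi>h z R) auto
            also have "\<dots> = ennreal (\<eta>' * \<sigma>)" using \<sigma> \<eta> by (simp add: ennreal_mult')
            also have "\<dots> \<le> ennreal e"
              using e \<sigma> by (intro ennreal_leI) (simp add: \<eta>'_def divide_le_eq)
            finally show ?thesis .
          next
            case False
            have q1: "Q D \<psi> z \<le> ennreal \<eta>" "ennreal (cmod (\<psi> z)) * theta D \<phi> z \<le> ennreal \<eta>"
              using False C1(3)[OF z] C2(3)[OF z] by (auto simp: C_def intro: less_imp_le)
            have "Q D (?W (d i)) z \<le> ennreal (2 * M) * Q D \<psi> z + ennreal (cmod (\<psi> z)) * Q D (d i \<circ> \<phi>) z"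
              by (rule Q_weighted_comp[OF dh \<phi> \<psi>h z dM[OF \<phi>z]])
            also have "\<dots> \<le> ennreal (2 * M) * Q D \<psi> z + ennreal (cmod (\<psi> z)) * (ennreal (2 * M) * theta D \<phi> z)"
              by (intro add_left_mono mult_left_mono Q_compose_theta[OF dh \<phi> z] dM) (use M in auto)
            also have "\<dots> = ennreal (2 * M) * (Q D \<psi> z + ennreal (cmod (\<psi> z)) * theta D \<phi> z)"
              by (simp add: distrib_left mult_ac)
            also have "\<dots> \<le> ennreal (2 * M) * (ennreal \<eta> + ennreal \<eta>)"
              by (intro mult_left_mono add_mono q1) auto
            also have "\<dots> = ennreal (2 * M * (\<eta> + \<eta>))"
              using M \<eta> by (subst ennreal_mult', simp, subst ennreal_plus) auto
            also have "2 * M * (\<eta> + \<eta>) = e" using M by (simp add: \<eta>_def)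
            finally show ?thesis .
          qed
        qed
      qed
      then show ?thesis by (simp add: eventually_sequentially)
    qed
    have "(\<lambda>i. cmod (?W (d i) 0) + enn2real (bloch_seminorm D (?W (d i)))) \<longlonglongrightarrow> 0 + 0"
    proof (rule tendsto_add)
      have "(\<lambda>i. \<psi> 0 * (f (r i) (\<phi> 0) - g (\<phi> 0))) \<longlonglongrightarrow> \<psi> 0 * (g (\<phi> 0) - g (\<phi> 0))"
        by (intro tendsto_intros lim holo_self_mapD(3)[OF \<phi> D(3)])
      then show "(\<lambda>i. cmod (?W (d i) 0)) \<longlonglongrightarrow> 0"
        by (simp add: weighted_comp_def d_def tendsto_norm_zero)
      show "(\<lambda>i. enn2real (bloch_seminorm D (?W (d i)))) \<longlonglongrightarrow> 0"
      proof (rule LIMSEQ_I)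
        fix e :: real assume e: "0 < e"
        then obtain N where N: "\<And>i. i \<ge> N \<Longrightarrow> bloch_seminorm D (?W (d i)) \<le> ennreal (e / 2)"
          using small[of "e / 2"] by auto
        have "norm (enn2real (bloch_seminorm D (?W (d i))) - 0) < e" if "i \<ge> N" for i
          using enn2real_leI[OF _ N[OF that]] e by (simp add: enn2real_nonneg)
        then show "\<exists>N. \<forall>i\<ge>N. norm (enn2real (bloch_seminorm D (?W (d i))) - 0) < e" by blast
      qed
    qed
    then have "(\<lambda>i. bloch_norm D (\<lambda>z. a (r i) z - ?W g z)) \<longlonglongrightarrow> 0"
      unfolding Wd by (simp add: bloch_norm_def)
    then show "\<exists>g\<in>Y. \<exists>r::nat \<Rightarrow> nat. strict_mono r \<and> (\<lambda>i. bloch_norm D (\<lambda>z. a (r i) z - g z)) \<longlonglongrightarrow> 0"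
      using g(2) gH W by blast
  qed
  show ?thesis unfolding compact_operator_def
  proof (intro conjI allI impI ballI W)
    show "?W (\<lambda>z. c * f z + g z) = (\<lambda>z. c * ?W f z + ?W g z)" for f g c
      by (simp add: weighted_comp_def algebra_simps fun_eq_iff)
  qed (use rel in blast)
qed

text \<open>The distance condition keeps points of the closure off the frontier, so D may be
  replaced by its closure, and the set is closed.\<close>

lemma compact_inner_part:
  fixes D :: "(complex ^ 'n) set"
  assumes D: "open D" "bounded D" and \<delta>: "0 < \<delta>"
  shows "compact {z \<in> D. \<forall>w\<in>frontier D. \<delta> \<le> dist z w}"
proof -
  have "{z \<in> D. \<forall>w\<in>frontier D. \<delta> \<le> dist z w} = closure D \<inter> (\<Inter>w\<in>frontier D. {z. \<delta> \<le> dist z w})"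
  proof (intro equalityI subsetI)
    fix z assume z: "z \<in> closure D \<inter> (\<Inter>w\<in>frontier D. {z. \<delta> \<le> dist z w})"
    then have "z \<notin> frontier D" using \<delta> by force
    then have "z \<in> D" using z D by (auto simp: frontier_def interior_open)
    then show "z \<in> {z \<in> D. \<forall>w\<in>frontier D. \<delta> \<le> dist z w}" using z by auto
  qed (use closure_subset in auto)
  moreover have "closed (\<Inter>w\<in>frontier D. {z. \<delta> \<le> dist z w})"
    by (intro closed_INT ballI closed_Collect_le continuous_intros)
  ultimately show ?thesis using D by (simp add: compact_Int_closed)
qed

text \<open>The compact set is the image under \<phi> of an inner part of D: if \<phi>(z) lies
  outside this image, then z lies outside the inner part, hence near the frontier.\<close>

lemma vanishes_towards_imp_along:
  fixes D :: "(complex ^ 'n) set"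
  assumes D: "open D" "bounded D" and \<phi>: "\<phi> \<in> holo_self_map D"
    and v: "vanishes_towards D (frontier D) F"
  shows "vanishes_along D \<phi> F"
  unfolding vanishes_along_def
proof (intro allI impI)
  fix e :: real assume "0 < e"
  then obtain \<delta> where \<delta>: "0 < \<delta>" "\<And>z w. z \<in> D \<Longrightarrow> w \<in> frontier D \<Longrightarrow> dist z w < \<delta> \<Longrightarrow> F z < ennreal e"
    using vanishes_towardsE[OF v] by blast
  define P where "P = {z \<in> D. \<forall>w\<in>frontier D. \<delta> \<le> dist z w}"
  have P: "compact P" "P \<subseteq> D" using compact_inner_part[OF D \<delta>(1)] by (auto simp: P_def)
  then have "continuous_on P \<phi>"
    using holo_map_continuous_on[OF holo_self_mapD(1)[OF \<phi>]] continuous_on_subset by blast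
  then have "compact (\<phi> ` P)" using P compact_continuous_image by blast
  moreover have "\<phi> ` P \<subseteq> D" using P holo_self_mapD(2)[OF \<phi>] by blast
  moreover have "F z < ennreal e" if z: "z \<in> D" "\<phi> z \<notin> \<phi> ` P" for z
  proof -
    have "z \<notin> P" using z(2) by blast
    then obtain w where "w \<in> frontier D" "dist z w < \<delta>" using z(1) by (auto simp: P_def not_le)
    then show ?thesis by (rule \<delta>(2)[OF z(1)])
  qed
  ultimately show "\<exists>C. compact C \<and> C \<subseteq> D \<and> (\<forall>z\<in>D. \<phi> z \<notin> C \<longrightarrow> F z < ennreal e)" by blast
qed

subsection \<open>Comparison of the Bergman metric with bounded functions\<close>

lemma bergman_kernel_hermitian:
  "open D \<Longrightarrow> bounded D \<Longrightarrow> hermitian_on D (bergman_kernel D)"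
  unfolding hermitian_on_def by (intro ballI bergman_kernel_cnj)

lemma bergman_kernel_sesqui:
  assumes D: "open D" "bounded D"
  shows "bergman_kernel D \<in> sesqui D"
  unfolding sesqui_def
proof (intro CollectI conjI ballI allI impI)
  show h: "(\<lambda>z. bergman_kernel D z w) \<in> holo D" if "w \<in> D" for w
    by (rule bergman_spaceD(1)[OF bergman_kernel_in[OF D that]])
  show "(\<lambda>w. cnj (bergman_kernel D z w)) \<in> holo D" if z: "z \<in> D" for z
    unfolding holo_iff
  proof
    fix w assume w: "w \<in> D"
    have "has_cderiv (\<lambda>w. bergman_kernel D w z) (grad_app (\<lambda>w. bergman_kernel D w z) w) w"
      by (rule holo_has_cderiv[OF h[OF z] w])
    \<comment> \<open>The symmetry of the kernel is known on D only, so the derivative is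
      transported within this open set.\<close>
    then have "has_cderiv (\<lambda>w. cnj (bergman_kernel D z w)) (grad_app (\<lambda>w. bergman_kernel D w z) w) w"
      unfolding has_cderiv_def
      by (elim conjE, intro conjI, elim has_derivative_transform_within_open[OF _ D(1) w])
         (use bergman_kernel_cnj[OF D _ z] in auto)
    then show "has_cderiv (\<lambda>w. cnj (bergman_kernel D z w)) (grad_app (\<lambda>w. cnj (bergman_kernel D z w)) w) w"
      using has_cderiv_imp_grad_app by metis
  qed
  fix C assume "compact C" "C \<subseteq> D"
  from bergman_kernel_bounded[OF D this]
  show "\<exists>B. \<forall>z\<in>C. \<forall>w\<in>C. cmod (bergman_kernel D z w) \<le> B" by metis
qed

section \<open>The Bergman metric in terms of derivatives of the kernel\<close>

lemma dzbar_log_bergman_kernel: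
  fixes D :: "(complex ^ 'n) set"
  assumes D: "open D" "bounded D" and w: "w \<in> D"
  shows "dzbar k (\<lambda>w. of_real (ln (Re (bergman_kernel D w w)))) w =
    D2 k (bergman_kernel D) w w / bergman_kernel D w w"
proof -
  let ?K = "bergman_kernel D"
  note S = bergman_kernel_sesqui[OF D]
  define L where "L v = (\<Sum>j\<in>UNIV. D1 j ?K w w * v $ j) + (\<Sum>k\<in>UNIV. D2 k ?K w w * cnj (v $ k))" for v
  have L: "((\<lambda>w. ?K w w) has_derivative L) (at w)"
    unfolding L_def by (rule sesqui_diag_has_derivative[OF D(1) S w])
  \<comment> \<open>By hermitian symmetry L takes real values, so the derivative of the real
    logarithm, read as a complex number, is L / K.\<close>
  have "cnj (L v) = L v" for v
    by (simp add: L_def hermitian_D2[OF D(1) bergman_kernel_hermitian[OF D] w w])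
  then have real: "of_real (Re (L v)) = L v" for v
    by (simp add: complex_eq_iff)
  have "((\<lambda>w. Re (?K w w)) has_derivative (\<lambda>v. Re (L v))) (at w)"
    by (rule bounded_linear.has_derivative[OF bounded_linear_Re L])
  from has_derivative_ln[OF bergman_kernel_pos[OF D w] this]
  have "((\<lambda>w. ln (Re (?K w w))) has_derivative (\<lambda>v. Re (L v) * inverse (Re (?K w w)))) (at w)" .
  from bounded_linear.has_derivative[OF bounded_linear_of_real this]
  have "((\<lambda>w. of_real (ln (Re (?K w w)))) has_derivative
      (\<lambda>v. of_real (Re (L v) * inverse (Re (?K w w))) :: complex)) (at w)" .
  moreover have "of_real (Re (L v) * inverse (Re (?K w w))) = L v * inverse (?K w w)" for v
    unfolding of_real_mult of_real_inverse real bergman_kernel_diag_Re[OF D w, symmetric] ..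
  ultimately have dl: "((\<lambda>w. of_real (ln (Re (?K w w)))) has_derivative (\<lambda>v. L v * inverse (?K w w))) (at w)"
    by simp
  have "D2 k ?K w w = (L (axis k 1) + \<i> * L (axis k \<i>)) / 2"
    unfolding dzbar_diag[OF D(1) S w, symmetric] by (rule dz_eq(2)[OF L])
  moreover have "(x * inverse c + \<i> * (y * inverse c)) / 2 = (x + \<i> * y) / 2 / c" for x y c :: complex
    by (cases "c = 0") (auto simp: field_simps)
  ultimately show ?thesis
    unfolding dz_eq(2)[OF dl] by metis
qed

text \<open>The quotient rule for the function in \<open>dzbar_log_bergman_kernel\<close>. In this
  form a lower bound for the Levi form of K becomes one for the metric.\<close>

lemma bergman_metric_eq:
  fixes D :: "(complex ^ 'n) set"
  assumes D: "open D" "bounded D" and z: "z \<in> D"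
  defines "K \<equiv> bergman_kernel D"
  shows "bergman_metric D z u u = 1 / 2 * ((\<Sum>j\<in>UNIV. \<Sum>k\<in>UNIV. D1 j (D2 k K) z z * u $ j * cnj (u $ k)) * K z z -
    (\<Sum>j\<in>UNIV. D1 j K z z * u $ j) * cnj (\<Sum>j\<in>UNIV. D1 j K z z * u $ j)) / (K z z)\<^sup>2"
proof -
  have S: "K \<in> sesqui D" unfolding K_def by (rule bergman_kernel_sesqui[OF D])
  have K0: "K z z \<noteq> 0" using bergman_kernel_pos[OF D z] by (auto simp: K_def)
  have dd: "dz j (dzbar k (\<lambda>w. of_real (ln (Re (K w w))))) z =
      (D1 j (D2 k K) z z * K z z - D2 k K z z * D1 j K z z) / (K z z)\<^sup>2" for j k
  proof -
    have "dz j (dzbar k (\<lambda>w. of_real (ln (Re (K w w))))) z = dz j (\<lambda>w. D2 k K w w / K w w) z"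
      by (rule dz_cong_open[OF D(1) z]) (simp add: K_def dzbar_log_bergman_kernel[OF D])
    also have "\<dots> = (D1 j (D2 k K) z z * K z z - D2 k K z z * D1 j K z z) / (K z z)\<^sup>2"
      unfolding dz_eq(1)[OF has_derivative_divide'[OF
          sesqui_diag_has_derivative[OF D(1) sesqui_D2[OF D(1) S] z]
          sesqui_diag_has_derivative[OF D(1) S z] K0]] sum_axis sum_axis_cnj
      using K0 by (simp add: power2_eq_square divide_simps) (simp add: algebra_simps)
    finally show ?thesis .
  qed
  have c: "D2 k K z z = cnj (D1 k K z z)" for k
    unfolding K_def by (rule hermitian_D2[OF D(1) bergman_kernel_hermitian[OF D] z z])
  have "(\<Sum>j\<in>UNIV. \<Sum>k\<in>UNIV. D2 k K z z * D1 j K z z * u $ j * cnj (u $ k)) =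
      (\<Sum>j\<in>UNIV. D1 j K z z * u $ j) * cnj (\<Sum>j\<in>UNIV. D1 j K z z * u $ j)"
    by (simp add: c sum_product mult_ac)
  moreover have "(\<Sum>j\<in>UNIV. \<Sum>k\<in>UNIV. (D1 j (D2 k K) z z * K z z - D2 k K z z * D1 j K z z) / (K z z)\<^sup>2 * u $ j * cnj (u $ k)) =
      ((\<Sum>j\<in>UNIV. \<Sum>k\<in>UNIV. D1 j (D2 k K) z z * u $ j * cnj (u $ k)) * K z z -
       (\<Sum>j\<in>UNIV. \<Sum>k\<in>UNIV. D2 k K z z * D1 j K z z * u $ j * cnj (u $ k))) / (K z z)\<^sup>2"
    unfolding sum_distrib_right sum_subtractf[symmetric] sum_divide_distrib
    by (intro sum.cong refl) (simp add: divide_inverse algebra_simps)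
  ultimately show ?thesis
    unfolding bergman_metric_def K_def[symmetric] dd by simp
qed

lemma dz_diff:
  "f \<in> holo D \<Longrightarrow> g \<in> holo D \<Longrightarrow> z \<in> D \<Longrightarrow> dz j (\<lambda>z. f z - g z) z = dz j f z - dz j g z"
  using grad_app_diff[of f D g z "axis j 1"] by (simp add: grad_app_axis)

lemma dz_cmult: "f \<in> holo D \<Longrightarrow> z \<in> D \<Longrightarrow> dz j (\<lambda>z. c * f z) z = c * dz j f z"
  using grad_app_cmult[of f D z c "axis j 1"] by (simp add: grad_app_axis)

lemma D1_D2_diff:
  assumes D: "open D" and \<Phi>: "\<Phi> \<in> sesqui D" and \<Psi>: "\<Psi> \<in> sesqui D" and z: "z \<in> D"
  shows "D1 j (D2 k (\<lambda>z w. \<Phi> z w - \<Psi> z w)) z z = D1 j (D2 k \<Phi>) z z - D1 j (D2 k \<Psi>) z z"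
proof -
  have "D2 k (\<lambda>z w. \<Phi> z w - \<Psi> z w) x z = D2 k \<Phi> x z - D2 k \<Psi> x z" if x: "x \<in> D" for x
    using dz_diff[OF sesquiD(2)[OF \<Phi> x] sesquiD(2)[OF \<Psi> x] z] by (simp add: D2_eq)
  then have "D1 j (D2 k (\<lambda>z w. \<Phi> z w - \<Psi> z w)) z z = dz j (\<lambda>x. D2 k \<Phi> x z - D2 k \<Psi> x z) z"
    unfolding D1_def by (rule dz_cong_open[OF D z])
  then show ?thesis
    unfolding D1_def
    by (subst (asm) dz_diff[OF sesquiD(1)[OF sesqui_D2[OF D \<Phi>] z] sesquiD(1)[OF sesqui_D2[OF D \<Psi>] z] z])
qed

lemma D1_D2_rank_one:
  assumes k: "f \<in> holo D" and z: "z \<in> D"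
  shows "D1 j (D2 k (\<lambda>z w. f z * cnj (f w))) z z = dz j f z * cnj (dz k f z)"
proof -
  have "D2 k (\<lambda>z w. f z * cnj (f w)) x z = cnj (dz k f z) * f x" for x
    using dz_cmult[OF k z] by (simp add: D2_eq)
  then show ?thesis
    unfolding D1_def by (simp add: dz_cmult[OF k z])
qed

lemma levi_rank_one:
  "(\<Sum>j\<in>UNIV. \<Sum>k\<in>UNIV. dz j f z * cnj (dz k f z) * u $ j * cnj (u $ k)) =
    of_real ((cmod (grad_app f z u))\<^sup>2)"
  unfolding complex_norm_square grad_app_def by (simp add: sum_product mult_ac)

text \<open>The contribution of k to the Levi form at z is exactly the term subtracted in
  \<open>bergman_metric_eq\<close>, so the metric is bounded below by the contribution of h = f k /
  M alone. As f(z) = 0, the gradient of h at z is k(z) / M times that of f, and k(z)^2 = K(z,z)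
  cancels. The factor 2 undoes the 1/2 in the metric.\<close>

lemma bergman_metric_lower_bound_zero:
  fixes D :: "(complex ^ 'n) set"
  assumes D: "open D" "bounded D" and z: "z \<in> D"
    and f: "f \<in> holo D" and M: "0 < M" "\<And>w. w \<in> D \<Longrightarrow> cmod (f w) \<le> M" and fz: "f z = 0"
  shows "(cmod (grad_app f z u))\<^sup>2 \<le> 2 * M\<^sup>2 * Re (bergman_metric D z u u)"
proof -
  let ?K = "bergman_kernel D"
  define \<kappa> where "\<kappa> = Re (?K z z)"
  have \<kappa>: "0 < \<kappa>" "?K z z = of_real \<kappa>"
    using bergman_kernel_pos[OF D z] bergman_kernel_diag_Re[OF D z] by (auto simp: \<kappa>_def)
  have K2: "norm2 D (\<lambda>x. ?K x z) = \<kappa>"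
    using bergman_kernel_diag[OF D z] \<kappa> by simp
  note KA = bergman_kernel_in[OF D z]
  note KH = bergman_spaceD(1)[OF KA]
  define k where "k x = of_real (1 / sqrt \<kappa>) * ?K x z" for x
  define h where "h x = of_real (1 / M) * (f x * k x)" for x
  have kA: "k \<in> bergman_space D" unfolding k_def[abs_def] by (rule bergman_cmult[OF D KA])
  have fkA: "(\<lambda>x. f x * k x) \<in> bergman_space D"
    by (rule bounded_holo_mult_bergman(1)[OF D kA f M(2)])
  have hA: "h \<in> bergman_space D" unfolding h_def[abs_def] by (rule bergman_cmult[OF D fkA])
  have nc: "norm2 D (\<lambda>x. c * g x) = (cmod c)\<^sup>2 * norm2 D g" for c g
    by (simp add: norm2_def norm_mult power_mult_distrib)
  have k1: "norm2 D k = 1"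
    using \<kappa> unfolding k_def[abs_def] nc K2 by (simp add: norm_divide power_divide)
  have h1: "norm2 D h \<le> 1"
  proof -
    have "norm2 D (\<lambda>x. f x * k x) \<le> M\<^sup>2"
      using bounded_holo_mult_bergman(2)[OF D kA f M(2)] k1 by simp
    then show ?thesis using M(1) unfolding h_def[abs_def] nc
      by (simp add: norm_divide power_divide divide_le_eq)
  qed
  have hk: "ip D h k = 0"
  proof -
    have "ip D h (\<lambda>x. ?K x z) = 0"
      using bergman_kernel_repr[OF D z hA] fz by (simp add: h_def)
    moreover have "ip D h k = cnj (of_real (1 / sqrt \<kappa>) * ip D (\<lambda>x. ?K x z) h)"
      unfolding k_def[abs_def] by (subst ip_cnj[OF D], subst ip_cmult[OF D]) simp
    ultimately show ?thesis using ip_cnj[OF D, of "\<lambda>x. ?K x z" h] by simp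
  qed
  have diag: "(cmod (k w))\<^sup>2 + (cmod (h w))\<^sup>2 \<le> Re (?K w w)" if w: "w \<in> D" for w
  proof -
    define T where "T = (cmod (k w))\<^sup>2 + (cmod (h w))\<^sup>2"
    \<comment> \<open>The combination for which Cauchy-Schwarz gives the most: g(w) = T, while
      orthogonality and \<open>norm2 D h\<close> \<le> 1 make its squared norm at most T, so T^2
      \<le> T K(w,w).\<close>
    define g where "g x = cnj (h w) * h x + cnj (k w) * k x" for x
    have gA: "g \<in> bergman_space D"
      unfolding g_def[abs_def] by (intro bergman_add bergman_cmult D hA kA)
    have "g w = of_real T"
      unfolding g_def T_def of_real_add complex_norm_square by (simp add: mult.commute)
    then have "T\<^sup>2 \<le> norm2 D g * Re (?K w w)"
      using bergman_eval_le_kernel[OF D w gA] by simp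
    also have "norm2 D g = (cmod (h w))\<^sup>2 * norm2 D h + (cmod (k w))\<^sup>2"
      unfolding g_def[abs_def]
      by (subst norm2_add_cmult[OF D bergman_cmult[OF D hA] kA])
         (simp add: ip_cmult[OF D] hk nc k1)
    also have "\<dots> \<le> T"
      using h1 mult_left_mono[OF h1, of "(cmod (h w))\<^sup>2"] by (simp add: T_def)
    finally have "T * T \<le> T * Re (?K w w)"
      using bergman_kernel_pos[OF D w] by (simp add: power2_eq_square mult_right_mono)
    moreover have "0 \<le> T" by (simp add: T_def)
    ultimately show ?thesis
      using bergman_kernel_pos[OF D w] unfolding T_def[symmetric]
      by (cases "T = 0") auto
  qed
  have kH: "k \<in> holo D" and hH: "h \<in> holo D" using kA hA by (auto dest: bergman_spaceD)
  \<comment> \<open>Its diagonal is nonnegative by \<open>diag\<close> and vanishes at z, where k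
    accounts for all of K(z,z) and h is 0.\<close>
  define E where "E x y = ?K x y - k x * cnj (k y) - h x * cnj (h y)" for x y
  note S = bergman_kernel_sesqui[OF D]
  have S1: "(\<lambda>x y. ?K x y - k x * cnj (k y)) \<in> sesqui D"
    by (intro sesqui_diff S sesqui_rank_one kH)
  have ES: "E \<in> sesqui D"
    unfolding E_def[abs_def] by (intro sesqui_diff[OF S1] sesqui_rank_one hH)
  have Eherm: "hermitian_on D E"
    unfolding hermitian_on_def E_def
  proof (intro ballI)
    fix x y assume "x \<in> D" "y \<in> D"
    then have "cnj (?K y x) = ?K x y" by (rule bergman_kernel_cnj[OF D, symmetric])
    then show "?K x y - k x * cnj (k y) - h x * cnj (h y) =
        cnj (?K y x - k y * cnj (k x) - h y * cnj (h x))"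
      by (simp add: mult.commute)
  qed
  have Ediag: "Re (E w w) = Re (?K w w) - (cmod (k w))\<^sup>2 - (cmod (h w))\<^sup>2" for w
    unfolding E_def complex_norm_square[symmetric] by simp
  have kz: "k z = of_real (sqrt \<kappa>)"
    using \<kappa> by (simp add: k_def real_div_sqrt flip: of_real_divide of_real_mult)
  have "0 \<le> Re (\<Sum>i\<in>UNIV. \<Sum>l\<in>UNIV. D1 i (D2 l E) z z * u $ i * cnj (u $ l))"
  proof (rule levi_nonneg_at_min[OF D(1) ES Eherm _ z])
    show "0 \<le> Re (E w w)" if "w \<in> D" for w
      using diag[OF that] by (simp add: Ediag)
    show "Re (E z z) = 0"
      using \<kappa> fz by (simp add: Ediag kz h_def)
  qed
  also have "(\<Sum>i\<in>UNIV. \<Sum>l\<in>UNIV. D1 i (D2 l E) z z * u $ i * cnj (u $ l)) =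
      (\<Sum>i\<in>UNIV. \<Sum>l\<in>UNIV. D1 i (D2 l ?K) z z * u $ i * cnj (u $ l)) -
      of_real ((cmod (grad_app k z u))\<^sup>2) - of_real ((cmod (grad_app h z u))\<^sup>2)"
    unfolding E_def[abs_def] D1_D2_diff[OF D(1) S1 sesqui_rank_one[OF hH] z]
      D1_D2_diff[OF D(1) S sesqui_rank_one[OF kH] z] D1_D2_rank_one[OF kH z] D1_D2_rank_one[OF hH z]
      levi_rank_one[symmetric]
    by (simp add: left_diff_distrib sum_subtractf)
  finally have A: "(cmod (grad_app k z u))\<^sup>2 + (cmod (grad_app h z u))\<^sup>2 \<le>
      Re (\<Sum>i\<in>UNIV. \<Sum>l\<in>UNIV. D1 i (D2 l ?K) z z * u $ i * cnj (u $ l))" (is "_ \<le> Re ?A")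
    by simp
  define p where "p = (\<Sum>j\<in>UNIV. D1 j ?K z z * u $ j)"
  have gk: "(cmod (grad_app k z u))\<^sup>2 = (cmod p)\<^sup>2 / \<kappa>"
    unfolding k_def[abs_def] grad_app_cmult[OF KH z]
    using \<kappa> by (simp add: p_def grad_app_def D1_def norm_mult norm_divide power_mult_distrib power_divide)
  have gh: "(cmod (grad_app h z u))\<^sup>2 = (cmod (grad_app f z u))\<^sup>2 * \<kappa> / M\<^sup>2"
    unfolding h_def[abs_def] grad_app_cmult[OF bergman_spaceD(1)[OF fkA] z] grad_app_mult[OF f kH z] fz kz
    using \<kappa> M by (simp add: norm_mult norm_divide power_mult_distrib power_divide)
  have "bergman_metric D z u u = 1 / 2 * (?A * of_real \<kappa> - p * cnj p) / (of_real \<kappa>)\<^sup>2"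
    using bergman_metric_eq[OF D z, of u] unfolding \<kappa>(2) p_def[symmetric] .
  also have "\<dots> = (?A * of_real \<kappa> - of_real ((cmod p)\<^sup>2)) / of_real (2 * \<kappa>\<^sup>2)"
    unfolding complex_norm_square by simp
  finally have "Re (bergman_metric D z u u) = (Re ?A * \<kappa> - (cmod p)\<^sup>2) / (2 * \<kappa>\<^sup>2)"
    by (simp only: Re_divide_of_real) simp
  then have "2 * M\<^sup>2 * Re (bergman_metric D z u u) = M\<^sup>2 * (Re ?A * \<kappa> - (cmod p)\<^sup>2) / \<kappa>\<^sup>2"
    by simp
  also have "\<dots> \<ge> M\<^sup>2 * (((cmod p)\<^sup>2 / \<kappa> + (cmod (grad_app f z u))\<^sup>2 * \<kappa> / M\<^sup>2) * \<kappa> - (cmod p)\<^sup>2) / \<kappa>\<^sup>2"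
    using \<kappa> A unfolding gk gh by (intro divide_right_mono mult_left_mono diff_right_mono mult_right_mono) auto
  also have "M\<^sup>2 * (((cmod p)\<^sup>2 / \<kappa> + (cmod (grad_app f z u))\<^sup>2 * \<kappa> / M\<^sup>2) * \<kappa> - (cmod p)\<^sup>2) / \<kappa>\<^sup>2 =
      (cmod (grad_app f z u))\<^sup>2"
    using \<kappa> M by (simp add: field_simps power2_eq_square)
  finally show ?thesis .
qed

text \<open>Subtracting f(z) makes the function vanish at z and at most doubles its bound. The
  previous lemma then gives the factor 2 (2 M)^2 = 8 M^2, which is at most (3 M)^2.\<close>

lemma Q_le_sup:
  fixes D :: "(complex ^ 'n) set"
  assumes D: "open D" "bounded D" and z: "z \<in> D"
    and f: "f \<in> holo D" and M: "0 < M" "\<And>w. w \<in> D \<Longrightarrow> cmod (f w) \<le> M"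
  shows "Q D f z \<le> ennreal (3 * M)"
  unfolding Q_def
proof (rule SUP_least)
  fix u :: "complex ^ 'n"
  define s where "s = sqrt (Re (bergman_metric D z u u))"
  define g where "g w = f w - f z" for w
  have g: "g \<in> holo D" unfolding g_def[abs_def] by (intro holo_diff f holo_const)
  have "grad_app g z u = grad_app f z u"
    using grad_app_diff[OF f holo_const z] has_cderiv_imp_grad_app[OF has_cderiv_const[of "f z" z]]
    by (simp add: g_def[abs_def])
  moreover have "(cmod (grad_app g z u))\<^sup>2 \<le> 2 * (2 * M)\<^sup>2 * Re (bergman_metric D z u u)"
  proof (rule bergman_metric_lower_bound_zero[OF D z g])
    show "cmod (g w) \<le> 2 * M" if "w \<in> D" for w
      using norm_triangle_ineq4[of "f w" "f z"] M(2)[OF that] M(2)[OF z] by (simp add: g_def)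
  qed (use M in \<open>auto simp: g_def\<close>)
  ultimately have le: "(cmod (grad_app f z u))\<^sup>2 \<le> 8 * M\<^sup>2 * Re (bergman_metric D z u u)"
    by (simp add: power_mult_distrib)
  have "cmod (grad_app f z u) / s \<le> 3 * M"
  proof (cases "s > 0")
    case True
    then have s2: "Re (bergman_metric D z u u) = s\<^sup>2" by (simp add: s_def)
    have "(cmod (grad_app f z u))\<^sup>2 \<le> (3 * M * s)\<^sup>2"
      using le unfolding s2 power_mult_distrib
      by (rule order_trans) (intro mult_right_mono, auto)
    then have "cmod (grad_app f z u) \<le> 3 * M * s"
      by (rule power2_le_imp_le) (use M True in auto)
    then show ?thesis using True by (simp add: divide_le_eq)
  next
    case False
    then have "cmod (grad_app f z u) / s \<le> 0" by (simp add: divide_nonneg_nonpos)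
    then show ?thesis using M by linarith
  qed
  then show "ennreal (cmod (grad_app f z u) / sqrt (Re (bergman_metric D z u u))) \<le> ennreal (3 * M)"
    unfolding s_def by (rule ennreal_leI)
qed

subsection \<open>Mapping into the little Bloch space\<close>

text \<open>The maximum principle in one variable on the slice of D by a complex line through z. The
  parameter set S is open and bounded, and the line carries its frontier into the frontier of
  D.\<close>

lemma max_modulus_frontier:
  fixes D :: "(complex ^ 'n) set"
  assumes D: "bounded D" and f: "f \<in> disc_algebra D" and z: "z \<in> D" "open D"
    and B: "\<And>w. w \<in> frontier D \<Longrightarrow> cmod (f w) \<le> B"
  shows "cmod (f z) \<le> B"
proof -
  define v where "v = (axis undefined 1 :: complex ^ 'n)"
  have v: "norm v = 1" by (simp add: v_def norm_axis_vec)
  define p where "p \<zeta> = z + \<zeta> *s v" for \<zeta>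
  define S where "S = p -` D"
  have cp: "continuous_on X p" for X
    unfolding p_def
    by (intro continuous_intros linear_continuous_on bounded_linear_smult_vec)
  have oS: "open S" unfolding S_def by (intro open_vimage z cp)
  have clS: "p ` closure S \<subseteq> closure D"
    by (rule image_closure_subset[OF cp]) (use closure_subset in \<open>auto simp: S_def\<close>)
  have frS: "p \<zeta> \<in> frontier D" if "\<zeta> \<in> frontier S" for \<zeta>
    using that clS oS z by (auto simp: frontier_def interior_open S_def)
  have "cmod ((f \<circ> p) 0) \<le> B"
  proof (rule maximum_modulus_frontier[of "f \<circ> p" S])
    show "f \<circ> p holomorphic_on interior S"
      unfolding interior_open[OF oS] holomorphic_on_open[OF oS]
    proof
      fix \<zeta> assume "\<zeta> \<in> S"
      then show "\<exists>f'. (f \<circ> p has_field_derivative f') (at \<zeta>)"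
        using holo_slice[of f D z \<zeta> v] f by (auto simp: S_def p_def[abs_def] disc_algebra_def o_def)
    qed
    show "continuous_on (closure S) (f \<circ> p)"
      by (rule continuous_on_compose[OF cp continuous_on_subset[OF _ clS]])
         (use f in \<open>simp add: disc_algebra_def\<close>)
    obtain R where R: "\<And>w. w \<in> D \<Longrightarrow> norm w \<le> R" using D by (auto simp: bounded_iff)
    have "cmod \<zeta> \<le> R + norm z" if "\<zeta> \<in> S" for \<zeta>
    proof -
      have "cmod \<zeta> = norm (p \<zeta> - z)" by (simp add: p_def norm_smult_vec v)
      also have "\<dots> \<le> norm (p \<zeta>) + norm z" by (rule norm_triangle_ineq4)
      also have "\<dots> \<le> R + norm z" using R[of "p \<zeta>"] that by (simp add: S_def)
      finally show ?thesis .
    qed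
    then show "bounded S" by (auto simp: bounded_iff)
    show "0 \<in> S" using z by (simp add: S_def p_def)
  qed (use frS B in auto)
  then show ?thesis by (simp add: p_def)
qed

text \<open>By the maximum principle the frontier is itself one of the sets being intersected. Hence
  decay towards the frontier includes decay towards the Shilov boundary.\<close>

lemma shilov_boundary_subset_frontier:
  fixes D :: "(complex ^ 'n) set"
  assumes D: "open D" "bounded D" "D \<noteq> {}"
  shows "shilov_boundary D \<subseteq> frontier D"
proof -
  have cf: "compact (frontier D)" using D by (simp add: compact_frontier_bounded)
  have nf: "frontier D \<noteq> {}"
    using frontier_not_empty[OF D(3)] D(2) not_bounded_UNIV by blast
  have "\<exists>w\<in>frontier D. \<forall>z\<in>closure D. cmod (f z) \<le> cmod (f w)" if f: "f \<in> disc_algebra D" for f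
  proof -
    have "continuous_on (closure D) f" using f by (simp add: disc_algebra_def)
    then have "continuous_on (frontier D) f"
      by (rule continuous_on_subset) (simp add: frontier_def)
    then have "continuous_on (frontier D) (\<lambda>w. cmod (f w))"
      by (rule continuous_on_norm)
    then obtain w where w: "w \<in> frontier D" "\<And>x. x \<in> frontier D \<Longrightarrow> cmod (f x) \<le> cmod (f w)"
      using continuous_attains_sup[OF cf nf, of "\<lambda>w. cmod (f w)"] by metis
    have "cmod (f z) \<le> cmod (f w)" if "z \<in> closure D" for z
    proof (cases "z \<in> D")
      case True
      then show ?thesis using max_modulus_frontier[OF D(2) f _ D(1) w(2)] by blast
    next
      case False
      then show ?thesis using that w(2) D(1) by (simp add: frontier_def interior_open)
    qed
    then show ?thesis using w(1) by blast
  qed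
  then have "frontier D \<in> {S. closed S \<and> S \<subseteq> closure D \<and>
      (\<forall>f\<in>disc_algebra D. \<exists>w\<in>S. \<forall>z\<in>closure D. cmod (f z) \<le> cmod (f w))}"
    by (simp add: frontier_def closed_Diff)
  then show ?thesis unfolding shilov_boundary_def by (rule Inter_lower)
qed

lemma weighted_comp_star_little_bloch:
  fixes D :: "(complex ^ 'n) set"
  assumes D: "open D" "bounded D" "0 \<in> D" and \<phi>: "\<phi> \<in> holo_self_map D" and \<psi>: "\<psi> \<in> bloch D"
    and v1: "vanishes_towards D (frontier D) (Q D \<psi>)"
    and v2: "vanishes_towards D (frontier D) (\<lambda>z. ennreal (cmod (\<psi> z)) * theta D \<phi> z)"
    and f: "f \<in> H_infty D"
  shows "weighted_comp \<psi> \<phi> f \<in> star_little_bloch D"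
proof -
  let ?W = "weighted_comp \<psi> \<phi> f"
  have \<psi>h: "\<psi> \<in> holo D" using \<psi> by (simp add: bloch_def)
  have fh: "f \<in> holo D" using f by (simp add: H_infty_def)
  have fph: "f \<circ> \<phi> \<in> holo D" by (rule holo_compose[OF fh holo_self_mapD(1,2)[OF \<phi>]])
  define M where "M = max 1 (sup_norm D f)"
  have M: "0 < M" "\<And>w. w \<in> D \<Longrightarrow> cmod (f w) \<le> M"
    using cmod_le_sup_norm[OF f] by (auto simp: M_def le_max_iff_disj)
  have Q1: "Q D ?W z \<le> ennreal M * Q D \<psi> z + ennreal (cmod (\<psi> z)) * Q D (f \<circ> \<phi>) z" if z: "z \<in> D" for z
    by (rule Q_weighted_comp[OF fh \<phi> \<psi>h z M(2)[OF holo_self_mapD(3)[OF \<phi> z]]])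
  have Q2: "Q D ?W z \<le> ennreal M * (Q D \<psi> z + ennreal (cmod (\<psi> z)) * theta D \<phi> z)" if z: "z \<in> D" for z
  proof -
    have "ennreal (cmod (\<psi> z)) * Q D (f \<circ> \<phi>) z \<le> ennreal (cmod (\<psi> z)) * (ennreal M * theta D \<phi> z)"
      by (intro mult_left_mono Q_compose_theta[OF fh \<phi> z M]) auto
    with Q1[OF z] show ?thesis
      by (elim order_trans) (simp add: distrib_left mult_ac)
  qed
  have near: "\<exists>\<delta>>0. \<forall>z\<in>D. (\<exists>w\<in>frontier D. dist z w < \<delta>) \<longrightarrow> Q D ?W z < ennreal e"
    if e: "0 < e" for e :: real
  proof -
    \<comment> \<open>Gives M (\<eta> + \<eta>) = e / 2, strictly below e.\<close>
    define \<eta> where "\<eta> = e / (4 * M)"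
    have \<eta>: "0 < \<eta>" using e M by (simp add: \<eta>_def)
    obtain \<delta>1 where \<delta>1: "0 < \<delta>1"
      "\<And>z w. z \<in> D \<Longrightarrow> w \<in> frontier D \<Longrightarrow> dist z w < \<delta>1 \<Longrightarrow> Q D \<psi> z < ennreal \<eta>"
      by (rule vanishes_towardsE[OF v1 \<eta>]) blast
    obtain \<delta>2 where \<delta>2: "0 < \<delta>2"
      "\<And>z w. z \<in> D \<Longrightarrow> w \<in> frontier D \<Longrightarrow> dist z w < \<delta>2 \<Longrightarrow>
        ennreal (cmod (\<psi> z)) * theta D \<phi> z < ennreal \<eta>"
      by (rule vanishes_towardsE[OF v2 \<eta>]) blast
    have "Q D ?W z < ennreal e" if z: "z \<in> D" and w: "w \<in> frontier D" "dist z w < min \<delta>1 \<delta>2" for z w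
    proof -
      have "Q D ?W z \<le> ennreal M * (ennreal \<eta> + ennreal \<eta>)"
        using \<delta>1(2)[OF z w(1)] \<delta>2(2)[OF z w(1)] w(2)
        by (intro order_trans[OF Q2[OF z]] mult_left_mono add_mono) auto
      also have "\<dots> = ennreal (M * (\<eta> + \<eta>))"
        using M \<eta> by (subst ennreal_mult', simp, subst ennreal_plus) auto
      also have "\<dots> < ennreal e"
        using e M by (intro ennreal_lessI) (auto simp: \<eta>_def)
      finally show ?thesis .
    qed
    then show ?thesis using \<delta>1(1) \<delta>2(1)
      by (intro exI[of _ "min \<delta>1 \<delta>2"]) auto
  qed
  \<comment> \<open>For membership in the Bloch space only finiteness counts, so any tolerance will
    do near the frontier. What remains of D is compact.\<close>
  obtain \<delta> where \<delta>: "0 < \<delta>" "\<And>z w. z \<in> D \<Longrightarrow> w \<in> frontier D \<Longrightarrow> dist z w < \<delta> \<Longrightarrow> Q D ?W z < ennreal 1"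
    using near[of 1] by auto
  define P where "P = {z \<in> D. \<forall>w\<in>frontier D. \<delta> \<le> dist z w}"
  have P: "compact P" "P \<subseteq> D" using compact_inner_part[OF D(1,2) \<delta>(1)] by (auto simp: P_def)
  obtain B where B: "0 < B" "\<And>z. z \<in> P \<Longrightarrow> cmod (\<psi> z) \<le> B"
    by (rule holo_continuous_bound[OF \<psi>h P]) blast
  \<comment> \<open>Bounds Q over the compact part P: \<psi> is at most B there, and
    \<open>Q_le_sup\<close> applies to f \<circ> \<phi>, which has the same bound M as f.\<close>
  define \<beta> where "\<beta> = ennreal M * bloch_seminorm D \<psi> + ennreal B * ennreal (3 * M)"
  have "Q D ?W z \<le> max (ennreal 1) \<beta>" if z: "z \<in> D" for z
  proof (cases "z \<in> P")
    case True
    have "Q D (f \<circ> \<phi>) z \<le> ennreal (3 * M)"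
      by (rule Q_le_sup[OF D(1,2) z fph M(1)]) (use M(2) holo_self_mapD(3)[OF \<phi>] in auto)
    then have "Q D ?W z \<le> \<beta>" unfolding \<beta>_def
      by (intro order_trans[OF Q1[OF z]] add_mono mult_mono Q_le_bloch_seminorm z ennreal_leI B(2) True) auto
    then show ?thesis by (simp add: le_max_iff_disj)
  next
    case False
    then obtain w where "w \<in> frontier D" "dist z w < \<delta>" using z by (auto simp: P_def not_le)
    from \<delta>(2)[OF z this] show ?thesis by (simp add: le_max_iff_disj less_imp_le)
  qed
  then have "bloch_seminorm D ?W \<le> max (ennreal 1) \<beta>"
    unfolding bloch_seminorm_def by (rule SUP_least)
  moreover have "max (ennreal 1) \<beta> < \<infinity>"
    using \<psi> by (simp add: \<beta>_def bloch_def ennreal_mult_less_top)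
  ultimately have "bloch_seminorm D ?W < \<infinity>" by (rule le_less_trans)
  moreover have "?W \<in> holo D"
    unfolding weighted_comp_eq by (intro holo_mult \<psi>h fph)
  moreover have "vanishes_towards D (shilov_boundary D) (Q D ?W)"
    unfolding vanishes_towards_def
  proof (intro allI impI)
    fix e :: real assume "0 < e"
    from near[OF this] obtain \<delta> where "0 < \<delta>"
      "\<forall>z\<in>D. (\<exists>w\<in>frontier D. dist z w < \<delta>) \<longrightarrow> Q D ?W z < ennreal e" by blast
    moreover have "shilov_boundary D \<subseteq> frontier D"
      using shilov_boundary_subset_frontier[OF D(1,2)] D(3) by blast
    ultimately show "\<exists>\<delta>>0. \<forall>z\<in>D. (\<exists>w\<in>shilov_boundary D. dist z w < \<delta>) \<longrightarrow> Q D ?W z < ennreal e"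
      by blast
  qed
  ultimately show ?thesis by (simp add: star_little_bloch_def bloch_def)
qed

theorem theorem4p2:
  fixes D :: "(complex ^ 'n) set"
    and \<phi> :: "complex ^ 'n \<Rightarrow> complex ^ 'n"
    and \<psi> :: "complex ^ 'n \<Rightarrow> complex"
  assumes "bounded_homogeneous_domain D"
    and "0 \<in> D"
    and "\<phi> \<in> holo_self_map D"
  shows
    \<comment> \<open>In the first part, that the operator maps bounded functions to Bloch functions is the meaning of
      the arrow and does not follow from the two limits: on the unit disc take
      \<open>\<psi>(z) = - log (1 - z)\<close> and \<open>\<phi>(z) = exp (- (1 + z) / (1 - z)) / 2\<close>. In the second part it is
      part of the conclusion.\<close>
    "(\<psi> \<in> bloch D \<longrightarrow>
        weighted_comp \<psi> \<phi> \<in> H_infty D \<rightarrow> bloch D \<longrightarrow>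
        vanishes_along D \<phi> (Q D \<psi>) \<longrightarrow>
        vanishes_along D \<phi> (\<lambda>z. ennreal (cmod (\<psi> z)) * theta D \<phi> z) \<longrightarrow>
        compact_operator (H_infty D) (sup_norm D) (bloch D) (bloch_norm D) (weighted_comp \<psi> \<phi>)) \<and>
     (\<psi> \<in> star_little_bloch D \<longrightarrow>
        vanishes_towards D (frontier D) (Q D \<psi>) \<longrightarrow>
        vanishes_towards D (frontier D) (\<lambda>z. ennreal (cmod (\<psi> z)) * theta D \<phi> z) \<longrightarrow>
        compact_operator (H_infty D) (sup_norm D) (star_little_bloch D) (bloch_norm D)
          (weighted_comp \<psi> \<phi>))"
proof (intro conjI impI)
  have D: "open D" "bounded D" "0 \<in> D" using assms by (auto simp: bounded_homogeneous_domain_def)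
  note \<phi> = assms(3)
  show "compact_operator (H_infty D) (sup_norm D) (bloch D) (bloch_norm D) (weighted_comp \<psi> \<phi>)"
    if "\<psi> \<in> bloch D" "weighted_comp \<psi> \<phi> \<in> H_infty D \<rightarrow> bloch D" "vanishes_along D \<phi> (Q D \<psi>)"
      "vanishes_along D \<phi> (\<lambda>z. ennreal (cmod (\<psi> z)) * theta D \<phi> z)"
    by (rule compact_operator_weighted_comp[OF D \<phi> that(1) order_refl that(2-4)])
  assume \<psi>: "\<psi> \<in> star_little_bloch D"
    and v: "vanishes_towards D (frontier D) (Q D \<psi>)"
      "vanishes_towards D (frontier D) (\<lambda>z. ennreal (cmod (\<psi> z)) * theta D \<phi> z)"
  have \<psi>b: "\<psi> \<in> bloch D" using \<psi> by (simp add: star_little_bloch_def)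
  show "compact_operator (H_infty D) (sup_norm D) (star_little_bloch D) (bloch_norm D)
          (weighted_comp \<psi> \<phi>)"
  \<comment> \<open>The compactness argument again, now with the little Bloch space as
    target.\<close>
  proof (rule compact_operator_weighted_comp[OF D \<phi> \<psi>b])
    show "star_little_bloch D \<subseteq> bloch D" by (auto simp: star_little_bloch_def)
    show "weighted_comp \<psi> \<phi> \<in> H_infty D \<rightarrow> star_little_bloch D"
      using weighted_comp_star_little_bloch[OF D \<phi> \<psi>b v] by blast
  qed (intro vanishes_towards_imp_along[OF D(1,2) \<phi>] v)+
qed

end
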